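(* For every odd prime $p$ there exist two tame fields $(L,v)$ and $(L',v')$, both algebraic over $\mathbb{Q}$, with $v$ and $v'$ extending the $p$-adic valuation $v_p$ of $\mathbb{Q}$, such that $Lv=\mathbb{F}_p=L'v'$ and $vL=v'L'$ equals the $p$-divisible hull of $\frac12(v_pp)\mathbb{Z}$, but $(L,v)\not\equiv(L',v')$.
   Context: $v_p$ denotes the $p$-adic valuation on $\mathbb{Q}$; value groups of algebraic extensions are viewed inside the divisible hull of $v_p\mathbb{Q}$. For a valued field $(K,v)$, $vK$ is its value group and $Kv$ its residue field. A valued field $(K,v)$ is a tame field if it is henselian and the algebraic closure $\tilde K$ of $K$ equals the ramification field of the extension $(\tilde K|K,v)$. $\equiv$ denotes elementary equivalence of valued fields. *)

theory Defs
  imports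
    "HOL-Computational_Algebra.Computational_Algebra"
    "HOL-Number_Theory.Number_Theory"
    "HOL-Algebra.Algebraic_Closure_Type"
begin

hide_const (open) Divisibility.prime

text \<open>
  Fields are subfields \<open>K\<close> of an ambient type of class \<open>field\<close>; notions that involve the algebraic
  closure of \<open>K\<close> require the ambient type to be algebraically closed.
\<close>

abbreviation subring_struct :: "'a::field set \<Rightarrow> 'a ring" where
  "subring_struct A \<equiv> ring_of_type_algebra\<lparr>carrier := A\<rparr>"


section \<open>Valued fields\<close>

text \<open>
  Krull valuations, written additively. The value of 0 is infinity; this is encoded by never
  looking at \<open>v 0\<close>. Likewise \<open>v\<close> is irrelevant outside of \<open>K\<close>.
\<close>

definition valued_field :: "'a::field set \<Rightarrow> ('a \<Rightarrow> 'g::linordered_ab_group_add) \<Rightarrow> bool" where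
  "valued_field K v \<longleftrightarrow>
     subfield K (ring_of_type_algebra :: 'a ring) \<and>
     (\<forall>x\<in>K - {0}. \<forall>y\<in>K - {0}. v (x * y) = v x + v y) \<and>
     (\<forall>x\<in>K - {0}. \<forall>y\<in>K - {0}. x + y \<noteq> 0 \<longrightarrow> min (v x) (v y) \<le> v (x + y))"

definition valuation_ring :: "'a::field set \<Rightarrow> ('a \<Rightarrow> 'g::linordered_ab_group_add) \<Rightarrow> 'a set" where
  "valuation_ring K v = {x\<in>K. x = 0 \<or> v x \<ge> 0}"

definition valuation_ideal :: "'a::field set \<Rightarrow> ('a \<Rightarrow> 'g::linordered_ab_group_add) \<Rightarrow> 'a set" where
  "valuation_ideal K v = {x\<in>K. x = 0 \<or> v x > 0}"

definition value_group :: "'a::field set \<Rightarrow> ('a \<Rightarrow> 'g::linordered_ab_group_add) \<Rightarrow> 'g set" where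
  "value_group K v = v ` (K - {0})"

definition residue_field :: "'a::field set \<Rightarrow> ('a \<Rightarrow> 'g::linordered_ab_group_add) \<Rightarrow> 'a set ring" where
  "residue_field K v = subring_struct (valuation_ring K v) Quot valuation_ideal K v"

definition extends_valuation ::
    "'a::field set \<Rightarrow> ('a \<Rightarrow> 'g::linordered_ab_group_add) \<Rightarrow> 'a set \<Rightarrow> ('a \<Rightarrow> 'g) \<Rightarrow> bool" where
  "extends_valuation N w K v \<longleftrightarrow> K \<subseteq> N \<and> (\<forall>x\<in>K - {0}. w x = v x)"

text \<open>Henselian means that Hensel's Lemma holds: simple residual roots lift.\<close>

definition henselian :: "'a::field set \<Rightarrow> ('a \<Rightarrow> 'g::linordered_ab_group_add) \<Rightarrow> bool" where
  "henselian K v \<longleftrightarrow>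
     valued_field K v \<and>
     (\<forall>f b. (\<forall>i. coeff f i \<in> valuation_ring K v) \<and> b \<in> valuation_ring K v \<and>
            poly f b \<in> valuation_ideal K v \<and> poly (pderiv f) b \<notin> valuation_ideal K v
        \<longrightarrow> (\<exists>a\<in>valuation_ring K v. poly f a = 0 \<and> a - b \<in> valuation_ideal K v))"


section \<open>Ramification theory and tame fields\<close>

definition algebraic_closure_in :: "'a::alg_closed_field set \<Rightarrow> 'a set" where
  "algebraic_closure_in K = {x. \<exists>f. f \<noteq> 0 \<and> (\<forall>i. coeff f i \<in> K) \<and> poly f x = 0}"

definition separable_over :: "'a::field set \<Rightarrow> 'a \<Rightarrow> bool" where
  "separable_over K x \<longleftrightarrow>
     (\<exists>f. f \<noteq> 0 \<and> (\<forall>i. coeff f i \<in> K) \<and> coprime f (pderiv f) \<and> poly f x = 0)"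

text \<open>Automorphisms of \<open>N\<close> over \<open>K\<close>; their values outside of \<open>N\<close> are irrelevant.\<close>

definition automorphisms_over :: "'a::field set \<Rightarrow> 'a set \<Rightarrow> ('a \<Rightarrow> 'a) set" where
  "automorphisms_over N K =
     {\<sigma> \<in> ring_iso (subring_struct N) (subring_struct N). \<forall>x\<in>K. \<sigma> x = x}"

definition ramification_group ::
    "'a::field set \<Rightarrow> 'a set \<Rightarrow> ('a \<Rightarrow> 'g::linordered_ab_group_add) \<Rightarrow> ('a \<Rightarrow> 'a) set" where
  "ramification_group N K w =
     {\<sigma> \<in> automorphisms_over N K. \<forall>x\<in>N - {0}. \<sigma> x - x = 0 \<or> w (\<sigma> x - x) > w x}"

text \<open>
  The ramification field of a normal extension is the fixed field of the ramification group in the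
  maximal separable subextension. In characteristic 0 the separability clause is void.
\<close>

definition ramification_field ::
    "'a::field set \<Rightarrow> 'a set \<Rightarrow> ('a \<Rightarrow> 'g::linordered_ab_group_add) \<Rightarrow> 'a set" where
  "ramification_field N K w =
     {x\<in>N. separable_over K x \<and> (\<forall>\<sigma>\<in>ramification_group N K w. \<sigma> x = x)}"

text \<open>
  The valuation of a henselian field extends uniquely to its algebraic closure, with values in the
  divisible hull of the value group. The type \<open>'g\<close> has to contain this hull, as \<open>rat\<close> does for
  algebraic extensions of the \<open>p\<close>-adically valued rationals.
\<close>

definition tame_field :: "'a::alg_closed_field set \<Rightarrow> ('a \<Rightarrow> 'g::linordered_ab_group_add) \<Rightarrow> bool" where
  "tame_field K v \<longleftrightarrow>
     henselian K v \<and>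
     (\<exists>w. valued_field (algebraic_closure_in K) w \<and>
          extends_valuation (algebraic_closure_in K) w K v \<and>
          ramification_field (algebraic_closure_in K) K w = algebraic_closure_in K)"


section \<open>Elementary equivalence of valued fields\<close>

text \<open>
  The first-order language of valued fields: the language of rings with a unary predicate for
  membership in the valuation ring.
\<close>

datatype vf_term =
    TVar nat
  | TZero
  | TOne
  | TNeg vf_term
  | TAdd vf_term vf_term
  | TMul vf_term vf_term

datatype vf_formula =
    FEq vf_term vf_term
  | FVal vf_term
  | FNot vf_formula
  | FAnd vf_formula vf_formula
  | FEx nat vf_formula

primrec term_vars :: "vf_term \<Rightarrow> nat set" where
  "term_vars (TVar n) = {n}"
| "term_vars TZero = {}"
| "term_vars TOne = {}"
| "term_vars (TNeg s) = term_vars s"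
| "term_vars (TAdd s t) = term_vars s \<union> term_vars t"
| "term_vars (TMul s t) = term_vars s \<union> term_vars t"

primrec free_vars :: "vf_formula \<Rightarrow> nat set" where
  "free_vars (FEq s t) = term_vars s \<union> term_vars t"
| "free_vars (FVal s) = term_vars s"
| "free_vars (FNot \<phi>) = free_vars \<phi>"
| "free_vars (FAnd \<phi> \<psi>) = free_vars \<phi> \<union> free_vars \<psi>"
| "free_vars (FEx n \<phi>) = free_vars \<phi> - {n}"

definition is_sentence :: "vf_formula \<Rightarrow> bool" where
  "is_sentence \<phi> \<longleftrightarrow> free_vars \<phi> = {}"

primrec term_value :: "(nat \<Rightarrow> 'a::field) \<Rightarrow> vf_term \<Rightarrow> 'a" where
  "term_value e (TVar n) = e n"
| "term_value e TZero = 0"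
| "term_value e TOne = 1"
| "term_value e (TNeg s) = - term_value e s"
| "term_value e (TAdd s t) = term_value e s + term_value e t"
| "term_value e (TMul s t) = term_value e s * term_value e t"

primrec satisfies ::
    "'a::field set \<Rightarrow> ('a \<Rightarrow> 'g::linordered_ab_group_add) \<Rightarrow> (nat \<Rightarrow> 'a) \<Rightarrow> vf_formula \<Rightarrow> bool" where
  "satisfies K v e (FEq s t) \<longleftrightarrow> term_value e s = term_value e t"
| "satisfies K v e (FVal s) \<longleftrightarrow> term_value e s \<in> valuation_ring K v"
| "satisfies K v e (FNot \<phi>) \<longleftrightarrow> \<not> satisfies K v e \<phi>"
| "satisfies K v e (FAnd \<phi> \<psi>) \<longleftrightarrow> satisfies K v e \<phi> \<and> satisfies K v e \<psi>"
| "satisfies K v e (FEx n \<phi>) \<longleftrightarrow> (\<exists>x\<in>K. satisfies K v (e(n := x)) \<phi>)"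

text \<open>The truth value of a sentence does not depend on the assignment.\<close>

definition elementarily_equivalent ::
    "'a::field set \<Rightarrow> ('a \<Rightarrow> 'g::linordered_ab_group_add) \<Rightarrow>
     'b::field set \<Rightarrow> ('b \<Rightarrow> 'h::linordered_ab_group_add) \<Rightarrow> bool" where
  "elementarily_equivalent K v K' v' \<longleftrightarrow>
     (\<forall>\<phi>. is_sentence \<phi> \<longrightarrow> (satisfies K v (\<lambda>_. 0) \<phi> \<longleftrightarrow> satisfies K' v' (\<lambda>_. 0) \<phi>))"


section \<open>The \<open>p\<close>-adic valuation of the rationals\<close>

text \<open>
  The value group of \<open>padic_valuation p\<close> is the group of integers, so its divisible hull is \<open>rat\<close>.
\<close>

definition padic_valuation :: "nat \<Rightarrow> rat \<Rightarrow> rat" where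
  "padic_valuation p q =
     of_nat (multiplicity (int p) (fst (quotient_of q))) -
     of_nat (multiplicity (int p) (snd (quotient_of q)))"

definition extends_padic :: "nat \<Rightarrow> ('a::field_char_0 \<Rightarrow> rat) \<Rightarrow> bool" where
  "extends_padic p v \<longleftrightarrow> (\<forall>q. q \<noteq> 0 \<longrightarrow> v (of_rat q) = padic_valuation p q)"

definition p_divisible_hull :: "nat \<Rightarrow> rat set \<Rightarrow> rat set" where
  "p_divisible_hull p G = {x. \<exists>n. of_nat (p ^ n) * x \<in> G}"

end

theory Submission
  imports Defs "HOL-Analysis.Function_Topology" "HOL-Algebra.Sylow"
begin

text \<open>
  Fix an extension \<open>w\<close> of the \<open>p\<close>-adic valuation to the algebraic numbers and a rational \<open>c\<close> of
  value 1. Let \<open>L\<close> be a maximal field of algebraic numbers that contains the radicals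
  \<open>c\<^bsup>1/(2p^k)\<^esup>\<close>, has residue field \<open>F\<^sub>p\<close>, and has its values in the \<open>p\<close>-divisible hull of
  \<open>1/2 \<int>\<close>. The closure of \<open>L\<close> in the \<open>w\<close>-topology has the same residues and values, so \<open>L\<close> is
  closed. This makes \<open>w\<close> invariant under the Galois group \<open>G\<close> of \<open>L\<close>, and \<open>L\<close> henselian.

  For tameness, choose \<open>\<phi>\<close> in \<open>G\<close> inducing the Frobenius on residues and \<open>\<tau>\<close> in the inertia group
  generating the tame inertia. By maximality, \<open>L\<close> is the fixed field of every such pair. On a finite
  set of algebraic numbers, \<open>\<tau>\<close> may be replaced by a power of order prime to \<open>p\<close>, and \<open>\<phi>\<close> may be
  corrected by an element of the wild group, a \<open>p\<close>-group there, so that \<open>\<phi> \<tau> \<phi>\<^sup>-\<^sup>1 = \<tau>\<^sup>p\<close> holds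
  exactly. Hence every element of \<open>G\<close> acts there as some \<open>\<tau>\<^sup>i \<phi>\<^sup>j\<close>, and if it is wild then it is
  trivial.

  The choices \<open>c = p\<close> and \<open>c = p u\<close> with a quadratic nonresidue \<open>u\<close> are distinguished by the sentence
  \<open>\<exists>x. x * x = p\<close>: two square roots of \<open>p\<close> and \<open>p u\<close> would make \<open>u\<close> a square in \<open>F\<^sub>p\<close>.
\<close>

section \<open>Extension of field homomorphisms\<close>

text \<open>The roots of unity \<open>mu\<close> and the radicals \<open>d (2 * n)\<close> with
  \<open>n\<close> prime to \<open>p\<close> serve as coordinates for the tame part of the Galois
  group: an automorphism over \<open>L\<close> is wild exactly if it fixes all of them.

  No complement of the wild group is constructed. The pair that satisfies the exact relation depends
  on the finite set at hand. This does no harm: maximality gives every such pair the fixed field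
  \<open>L\<close>, so any automorphism over \<open>L\<close> agrees on that set with a word in the
  pair.

  The step from closed to henselian relies on rank one: values lie in \<open>rat\<close>, which is
  archimedean.

  The two fields are inequivalent because value group and residue field do not determine a tamely
  ramified extension: adjoining a square root of \<open>p\<close> or of \<open>p u\<close> yields
  the same ones. Oddness of \<open>p\<close> makes ramification of index 2 tame and provides
  nonresidues.

  The algebra takes place in a type of algebraic numbers, where automorphisms are total functions.
  The complex numbers supply roots of unity and a compatible system of radicals, and carry the final
  statement.\<close>

definition is_subfield :: "'a::field set \<Rightarrow> bool" where
  "is_subfield A \<longleftrightarrow> 1 \<in> A \<and> (\<forall>x\<in>A. \<forall>y\<in>A. x - y \<in> A \<and> x * y \<in> A) \<and> (\<forall>x\<in>A. inverse x \<in> A)"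

definition hom_on :: "'a::field set \<Rightarrow> ('a \<Rightarrow> 'b::field) \<Rightarrow> bool" where
  "hom_on A f \<longleftrightarrow> f 1 = 1 \<and> (\<forall>x\<in>A. \<forall>y\<in>A. f (x + y) = f x + f y \<and> f (x * y) = f x * f y)"

definition coeffs_in :: "'a::field set \<Rightarrow> 'a poly \<Rightarrow> bool" where
  "coeffs_in A h \<longleftrightarrow> (\<forall>i. coeff h i \<in> A)"

lemma is_subfieldD:
  assumes "is_subfield A"
  shows "1 \<in> A" "0 \<in> A" "\<And>x y. x \<in> A \<Longrightarrow> y \<in> A \<Longrightarrow> x - y \<in> A"
    "\<And>x y. x \<in> A \<Longrightarrow> y \<in> A \<Longrightarrow> x * y \<in> A" "\<And>x. x \<in> A \<Longrightarrow> inverse x \<in> A"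
    "\<And>x. x \<in> A \<Longrightarrow> - x \<in> A" "\<And>x y. x \<in> A \<Longrightarrow> y \<in> A \<Longrightarrow> x + y \<in> A"
    "\<And>x y. x \<in> A \<Longrightarrow> y \<in> A \<Longrightarrow> x / y \<in> A" "\<And>x n. x \<in> A \<Longrightarrow> x ^ n \<in> A"
proof -
  show 1: "1 \<in> A" and d: "\<And>x y. x \<in> A \<Longrightarrow> y \<in> A \<Longrightarrow> x - y \<in> A"
    and m: "\<And>x y. x \<in> A \<Longrightarrow> y \<in> A \<Longrightarrow> x * y \<in> A" and i: "\<And>x. x \<in> A \<Longrightarrow> inverse x \<in> A"
    using assms by (auto simp: is_subfield_def)
  show 0: "0 \<in> A" using d[OF 1 1] by simp
  show n: "- x \<in> A" if "x \<in> A" for x using d[OF 0 that] by simp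
  show "x + y \<in> A" if "x \<in> A" "y \<in> A" for x y using d[OF that(1) n[OF that(2)]] by simp
  show "x / y \<in> A" if "x \<in> A" "y \<in> A" for x y
    using m[OF that(1) i[OF that(2)]] by (simp add: divide_inverse)
  show "x ^ n \<in> A" if "x \<in> A" for x n using that by (induction n) (auto simp: 1 m)
qed

lemma is_subfield_sum: "is_subfield A \<Longrightarrow> (\<And>x. x \<in> S \<Longrightarrow> f x \<in> A) \<Longrightarrow> sum f S \<in> A"
  by (induction S rule: infinite_finite_induct) (auto simp: is_subfieldD)

lemma is_subfield_of_int: "is_subfield A \<Longrightarrow> of_int n \<in> A"
proof -
  assume A: "is_subfield A"
  have "of_nat m \<in> A" for m by (induction m) (auto simp: is_subfieldD[OF A])
  then show ?thesis by (cases n rule: int_cases2) (auto simp: is_subfieldD[OF A])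
qed

lemma is_subfield_of_rat: "is_subfield A \<Longrightarrow> of_rat q \<in> (A :: 'a::field_char_0 set)"
  by (cases q) (auto simp: of_rat_rat intro!: is_subfieldD is_subfield_of_int)

lemma hom_onD:
  assumes "is_subfield A" "hom_on A f"
  shows "f 1 = 1" "f 0 = 0" "\<And>x y. x \<in> A \<Longrightarrow> y \<in> A \<Longrightarrow> f (x + y) = f x + f y"
    "\<And>x y. x \<in> A \<Longrightarrow> y \<in> A \<Longrightarrow> f (x * y) = f x * f y" "\<And>x. x \<in> A \<Longrightarrow> f (- x) = - f x"
    "\<And>x y. x \<in> A \<Longrightarrow> y \<in> A \<Longrightarrow> f (x - y) = f x - f y"
    "\<And>x. x \<in> A \<Longrightarrow> f (inverse x) = inverse (f x)"
proof -
  note A = is_subfieldD[OF assms(1)]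
  show 1: "f 1 = 1" and a: "\<And>x y. x \<in> A \<Longrightarrow> y \<in> A \<Longrightarrow> f (x + y) = f x + f y"
    and m: "\<And>x y. x \<in> A \<Longrightarrow> y \<in> A \<Longrightarrow> f (x * y) = f x * f y"
    using assms(2) by (auto simp: hom_on_def)
  show 0: "f 0 = 0" using a[OF A(2) A(2)] by (metis add_0 add_cancel_left_left)
  show n: "f (- x) = - f x" if "x \<in> A" for x
    using a[OF that A(6)[OF that]] 0 by (simp add: eq_neg_iff_add_eq_0 add.commute)
  show "f (x - y) = f x - f y" if "x \<in> A" "y \<in> A" for x y
    using a[OF that(1) A(6)[OF that(2)]] n[OF that(2)] by simp
  show "f (inverse x) = inverse (f x)" if "x \<in> A" for x
  proof (cases "x = 0")
    case False
    then have "f x * f (inverse x) = 1" using m[OF that A(5)[OF that]] 1 by simp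
    then show ?thesis by (metis inverse_unique)
  qed (simp add: 0)
qed

lemma coeffs_in_ring:
  assumes "is_subfield A" "coeffs_in A f" "coeffs_in A g"
  shows "coeffs_in A (f + g)" "coeffs_in A (f - g)" "coeffs_in A (f * g)"
  using assms by (auto simp: coeffs_in_def coeff_mult is_subfieldD intro!: is_subfield_sum)

lemma map_poly_hom_on:
  fixes f :: "'a::field \<Rightarrow> 'b::field"
  assumes A: "is_subfield A" and f: "hom_on A f" and g: "coeffs_in A g" and h: "coeffs_in A h"
  shows "map_poly f (g + h) = map_poly f g + map_poly f h"
    "map_poly f (g - h) = map_poly f g - map_poly f h"
    "map_poly f (g * h) = map_poly f g * map_poly f h"
proof -
  note D = is_subfieldD[OF A] note F = hom_onD[OF A f]
  have c: "coeff g i \<in> A" "coeff h i \<in> A" for i using g h by (auto simp: coeffs_in_def)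
  have s: "f (sum u S) = (\<Sum>i\<in>S. f (u i))" if "\<And>i. i \<in> S \<Longrightarrow> u i \<in> A" for u and S :: "nat set"
    using that by (induction S rule: infinite_finite_induct) (auto simp: F is_subfield_sum[OF A])
  show "map_poly f (g + h) = map_poly f g + map_poly f h"
    by (rule poly_eqI) (simp add: coeff_map_poly F c)
  show "map_poly f (g - h) = map_poly f g - map_poly f h"
    by (rule poly_eqI) (simp add: coeff_map_poly F c)
  show "map_poly f (g * h) = map_poly f g * map_poly f h"
    by (rule poly_eqI) (simp add: coeff_map_poly F c coeff_mult s D)
qed

lemma poly_coeffs_in: "is_subfield A \<Longrightarrow> coeffs_in A h \<Longrightarrow> x \<in> A \<Longrightarrow> poly h x \<in> A"
  by (auto simp: poly_altdef coeffs_in_def is_subfieldD intro!: is_subfield_sum)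

text \<open>Division by a polynomial of minimal degree with root \<open>x\<close>, without leaving \<open>A\<close>.\<close>

lemma minimal_root_transfer:
  fixes f :: "'a::field \<Rightarrow> 'b::field"
  assumes A: "is_subfield A" and f: "hom_on A f"
    and m: "coeffs_in A m" "m \<noteq> 0" "poly m x = 0"
    and min: "\<And>h. coeffs_in A h \<Longrightarrow> h \<noteq> 0 \<Longrightarrow> poly h x = 0 \<Longrightarrow> degree m \<le> degree h"
    and y: "poly (map_poly f m) y = 0"
    and h: "coeffs_in A h" "poly h x = 0"
  shows "poly (map_poly f h) y = 0"
  using h
proof (induction "degree h" arbitrary: h rule: less_induct)
  case less
  show ?case
  proof (cases "h = 0")
    case False
    with min less have dg: "degree m \<le> degree h" by auto
    define q where "q = monom (lead_coeff h / lead_coeff m) (degree h - degree m)"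
    have q: "coeffs_in A q"
      using less(2) m(1) by (auto simp: q_def coeffs_in_def is_subfieldD[OF A])
    define r where "r = h - q * m"
    have r: "coeffs_in A r" unfolding r_def by (intro coeffs_in_ring A less q m)
    have rx: "poly r x = 0" using less m by (simp add: r_def)
    have rf: "poly (map_poly f r) y = poly (map_poly f h) y"
      using y by (simp add: r_def map_poly_hom_on[OF A f] coeffs_in_ring A less q m)
    have q0: "q \<noteq> 0" using False m by (simp add: q_def)
    have dqm: "degree (q * m) = degree h"
    proof -
      have "lead_coeff h / lead_coeff m \<noteq> 0" using False m by simp
      then have "degree q = degree h - degree m" unfolding q_def by (rule degree_monom_eq)
      then show ?thesis using m q0 dg by (simp add: degree_mult_eq)
    qed
    have lqm: "lead_coeff (q * m) = lead_coeff h"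
    proof -
      have "lead_coeff q = lead_coeff h / lead_coeff m" unfolding q_def by (rule lead_coeff_monom)
      then show ?thesis using m(2) by (simp add: lead_coeff_mult del: coeff_mult_degree_sum)
    qed
    have "r = 0 \<or> degree r < degree h"
    proof (cases "degree h = 0")
      case True
      then have "degree m = 0" using dg by simp
      then obtain c where "m = [:c:]" by (metis degree_eq_zeroE)
      with m show ?thesis by simp
    next
      case nz: False
      have "coeff r (degree h) = 0" using lqm dqm by (simp add: r_def)
      moreover have "degree r \<le> degree h" using dqm by (simp add: r_def degree_diff_le)
      ultimately show ?thesis
        by (metis leading_coeff_0_iff le_neq_implies_less)
    qed
    then show ?thesis
    proof
      assume "r = 0"
      then show ?thesis using rf by simp
    next
      assume "degree r < degree h"
      then show ?thesis using less(1)[OF _ r rx] rf by simp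
    qed
  qed simp
qed

text \<open>Only inverses need an argument: a relation for \<open>z\<close> over \<open>A\<close>,
  divided by a power of the variable, has a constant term \<open>a \<noteq> 0\<close>, and
  \<open>z * poly k z = - a\<close> then exhibits \<open>inverse z\<close> as a polynomial in
  \<open>z\<close>.\<close>

lemma adjoin_subfield:
  fixes x :: "'a::field"
  assumes A: "is_subfield A" and alg: "\<And>z. \<exists>h. h \<noteq> 0 \<and> coeffs_in A h \<and> poly h z = 0"
  shows "is_subfield {poly h x |h. coeffs_in A h}" (is "is_subfield ?B")
proof -
  note D = is_subfieldD[OF A]
  have sub: "u - v \<in> ?B" and mul: "u * v \<in> ?B" if uv: "u \<in> ?B" "v \<in> ?B" for u v
  proof -
    obtain h k where "coeffs_in A h" "coeffs_in A k" "u = poly h x" "v = poly k x" using uv by blast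
    then show "u - v \<in> ?B" "u * v \<in> ?B"
      using coeffs_in_ring(2)[OF A, of h k] coeffs_in_ring(3)[OF A, of h k]
      by (auto intro: exI[of _ "h - k"] exI[of _ "h * k"])
  qed
  have const: "a \<in> ?B" if "a \<in> A" for a
    using that D(2) by (intro CollectI exI[of _ "[:a:]"]) (auto simp: coeffs_in_def coeff_pCons split: nat.splits)
  have add: "u + v \<in> ?B" if "u \<in> ?B" "v \<in> ?B" for u v
    using sub[OF that(1) sub[OF const[OF D(2)] that(2)]] by simp
  have pol: "poly g z \<in> ?B" if "coeffs_in A g" "z \<in> ?B" for g z
    using that(1)
  proof (induction g)
    case (pCons a g)
    then have "a \<in> A" "coeffs_in A g"
      by (auto simp: coeffs_in_def coeff_pCons dest: spec[of _ 0] spec[of _ "Suc _"])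
    with pCons have "poly g z \<in> ?B" "a \<in> A" by blast+
    then have "a + z * poly g z \<in> ?B" by (rule add[OF const mul[OF that(2)], rotated])
    then show ?case by simp
  qed (use const[OF D(2)] in auto)
  have inv: "inverse z \<in> ?B" if z: "z \<in> ?B" for z
  proof (cases "z = 0")
    case nz: False
    obtain h where h: "h \<noteq> 0" "coeffs_in A h" "poly h z = 0" using alg by blast
    have "\<exists>g. coeffs_in A g \<and> coeff g 0 \<noteq> 0 \<and> poly g z = 0"
      using h
    proof (induction h)
      case (pCons a h)
      have ah: "a \<in> A" "coeffs_in A h"
        using pCons.prems(2) by (auto simp: coeffs_in_def coeff_pCons dest: spec[of _ 0] spec[of _ "Suc _"])
      show ?case
      proof (cases "a = 0")
        case True
        then show ?thesis using pCons ah nz by auto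
      next
        case False
        then show ?thesis using pCons by (intro exI[of _ "pCons a h"]) auto
      qed
    qed simp
    then obtain g where g: "coeffs_in A g" "coeff g 0 \<noteq> 0" "poly g z = 0" by blast
    obtain a k where gk: "g = pCons a k" by (cases g)
    have ak: "a \<in> A" "coeffs_in A k"
      using g(1) gk by (auto simp: coeffs_in_def coeff_pCons dest: spec[of _ 0] spec[of _ "Suc _"])
    have "a \<noteq> 0" using g gk by simp
    have "z * poly k z = - a" using g(3) gk by (simp add: eq_neg_iff_add_eq_0 add.commute)
    then have "inverse z = inverse (- a) * poly k z"
      using nz \<open>a \<noteq> 0\<close> by (simp add: field_simps)
    also have "\<dots> \<in> ?B" using ak by (intro mul const pol z) (auto simp: D)
    finally show ?thesis .
  qed (use const[OF D(2)] in auto)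
  show ?thesis unfolding is_subfield_def using sub mul inv const[OF D(1)] by blast
qed

lemma hom_extend_simple:
  fixes f :: "'a::field \<Rightarrow> 'b::field"
  assumes A: "is_subfield A" and f: "hom_on A f"
    and alg: "\<And>z. \<exists>h. h \<noteq> 0 \<and> coeffs_in A h \<and> poly h z = 0"
    and m: "coeffs_in A m" "m \<noteq> 0" "poly m x = 0"
    and min: "\<And>h. coeffs_in A h \<Longrightarrow> h \<noteq> 0 \<Longrightarrow> poly h x = 0 \<Longrightarrow> degree m \<le> degree h"
    and y: "poly (map_poly f m) y = 0"
  shows "\<exists>B g. is_subfield B \<and> hom_on B g \<and> A \<subseteq> B \<and> (\<forall>a\<in>A. g a = f a) \<and> x \<in> B \<and> g x = y"
proof -
  note D = is_subfieldD[OF A] note F = hom_onD[OF A f]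
  define B where "B = {poly h x |h. coeffs_in A h}"
  have B: "is_subfield B" unfolding B_def by (rule adjoin_subfield[OF A alg])
  \<comment> \<open>\<open>x\<close> is sent to \<open>y\<close>. The representing polynomial is
    chosen arbitrarily; the next fact shows with \<open>minimal_root_transfer\<close> that the
    choice does not matter.\<close>
  define g where "g z = poly (map_poly f (SOME h. coeffs_in A h \<and> poly h x = z)) y" for z
  have g: "g (poly h x) = poly (map_poly f h) y" if h: "coeffs_in A h" for h
  proof -
    define h' where "h' = (SOME h'. coeffs_in A h' \<and> poly h' x = poly h x)"
    have h': "coeffs_in A h' \<and> poly h' x = poly h x"
      unfolding h'_def by (rule someI[of _ h]) (use h in auto)
    have "poly (map_poly f (h' - h)) y = 0"
      by (rule minimal_root_transfer[OF A f m min y]) (use h h' coeffs_in_ring[OF A] in auto)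
    then show ?thesis
      using h h' by (simp add: map_poly_hom_on[OF A f] g_def flip: h'_def)
  qed
  have c: "coeffs_in A [:a:]" if "a \<in> A" for a
    using that D(2) by (auto simp: coeffs_in_def coeff_pCons split: nat.splits)
  have cx: "coeffs_in A [:0, 1:]"
    using D(1,2) by (auto simp: coeffs_in_def coeff_pCons split: nat.splits)
  have ga: "g a = f a" if "a \<in> A" for a
    using g[OF c[OF that]] by (simp add: F map_poly_pCons)
  have gx: "g x = y" using g[OF cx] by (simp add: F map_poly_pCons)
  have "hom_on B g" unfolding hom_on_def
  proof (intro conjI ballI)
    show "g 1 = 1" using ga[OF D(1)] F by simp
    fix u v assume "u \<in> B" "v \<in> B"
    then obtain h k where hk: "coeffs_in A h" "coeffs_in A k" "u = poly h x" "v = poly k x"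
      unfolding B_def by blast
    show "g (u + v) = g u + g v" "g (u * v) = g u * g v"
      using g[OF coeffs_in_ring(1)[OF A hk(1,2)]] g[OF coeffs_in_ring(3)[OF A hk(1,2)]] hk g
      by (simp_all add: map_poly_hom_on[OF A f])
  qed
  moreover have "A \<subseteq> B" unfolding B_def using c by (force intro: exI[of _ "[:_:]"])
  moreover have "x \<in> B" unfolding B_def using cx by (intro CollectI exI[of _ "[:0,1:]"]) auto
  ultimately show ?thesis using B ga gx by blast
qed

lemma minimal_poly_exists:
  fixes x :: "'a::field"
  assumes "\<exists>h. h \<noteq> 0 \<and> coeffs_in A h \<and> poly h x = 0"
  obtains m where "coeffs_in A m" "m \<noteq> 0" "poly m x = 0"
    "\<And>h. coeffs_in A h \<Longrightarrow> h \<noteq> 0 \<Longrightarrow> poly h x = 0 \<Longrightarrow> degree m \<le> degree h"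
proof -
  obtain h where "h \<noteq> 0 \<and> coeffs_in A h \<and> poly h x = 0" using assms by blast
  from ex_has_least_nat[of "\<lambda>h. h \<noteq> 0 \<and> coeffs_in A h \<and> poly h x = 0", OF this, of degree]
  show ?thesis using that by blast
qed

theorem hom_extend:
  fixes f :: "'a::field \<Rightarrow> 'b::alg_closed_field"
  assumes A: "is_subfield A" and f: "hom_on A f"
    and alg: "\<And>z. \<exists>h. h \<noteq> 0 \<and> coeffs_in A h \<and> poly h z = 0"
  shows "\<exists>g. hom_on UNIV g \<and> (\<forall>a\<in>A. g a = f a)"
proof -
  \<comment> \<open>Partial homomorphisms are handled as graphs, so that a chain has its union as
    upper bound. Since graphs are closed under subtraction, the clause on \<open>(0, y)\<close> says
    that they are single-valued.\<close>
  define gr where "gr G \<longleftrightarrow> (1, 1) \<in> G \<and>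
     (\<forall>x y x' y'. (x, y) \<in> G \<longrightarrow> (x', y') \<in> G \<longrightarrow> (x - x', y - y') \<in> G \<and> (x * x', y * y') \<in> G) \<and>
     (\<forall>x y. (x, y) \<in> G \<longrightarrow> (inverse x, inverse y) \<in> G) \<and>
     (\<forall>y. (0, y) \<in> G \<longrightarrow> y = 0)" for G :: "('a \<times> 'b) set"
  define \<G> where "\<G> = {G. gr G \<and> (\<lambda>a. (a, f a)) ` A \<subseteq> G}"
  have graph: "gr ((\<lambda>a. (a, g a)) ` B)" if "is_subfield B" "hom_on B g" for B and g :: "'a \<Rightarrow> 'b"
    unfolding gr_def using is_subfieldD[OF that(1)] hom_onD[OF that]
    by (auto simp: image_iff)
  have "\<exists>M\<in>\<G>. \<forall>G\<in>\<G>. M \<subseteq> G \<longrightarrow> G = M"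
  proof (rule subset_Zorn_nonempty)
    show "\<G> \<noteq> {}" using graph[OF A f] by (auto simp: \<G>_def)
    fix C assume C: "C \<noteq> {}" "subset.chain \<G> C"
    have CG: "G \<in> \<G>" if "G \<in> C" for G using C that by (auto simp: subset.chain_def)
    have two: "\<exists>G\<in>C. a \<in> G \<and> b \<in> G" if "a \<in> \<Union>C" "b \<in> \<Union>C" for a b
      using that C(2) unfolding subset.chain_def by blast
    have "gr (\<Union>C)" unfolding gr_def
    proof (intro conjI allI impI)
      show "(1, 1) \<in> \<Union>C" using C(1) CG by (fastforce simp: \<G>_def gr_def)
      fix x y x' y' assume "(x, y) \<in> \<Union>C" "(x', y') \<in> \<Union>C"
      from two[OF this] CG show "(x - x', y - y') \<in> \<Union>C" "(x * x', y * y') \<in> \<Union>C"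
        unfolding \<G>_def gr_def by blast+
    next
      fix x y assume "(x, y) \<in> \<Union>C"
      then show "(inverse x, inverse y) \<in> \<Union>C" using CG unfolding \<G>_def gr_def by blast
    next
      fix y assume "(0, y) \<in> \<Union>C"
      then show "y = 0" using CG unfolding \<G>_def gr_def by blast
    qed
    then show "\<Union>C \<in> \<G>" using C(1) CG unfolding \<G>_def by blast
  qed
  then obtain M where M': "M \<in> \<G>" "\<forall>G\<in>\<G>. M \<subseteq> G \<longrightarrow> G = M" ..
  then have M: "gr M" "(\<lambda>a. (a, f a)) ` A \<subseteq> M" by (simp_all add: \<G>_def)
  have Mmax: "G = M" if "gr G" "M \<subseteq> G" for G
    using M'(2) M(2) that by (metis (mono_tags, lifting) \<G>_def mem_Collect_eq order_trans)
  define B where "B = fst ` M"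
  define g where "g x = (THE y. (x, y) \<in> M)" for x
  have uniq: "y = y'" if "(x, y) \<in> M" "(x, y') \<in> M" for x y y'
  proof -
    have "(x - x, y - y') \<in> M" using M(1) that unfolding gr_def by blast
    then have "y - y' = 0" using M(1) unfolding gr_def by (metis diff_self)
    then show ?thesis by simp
  qed
  have g: "g x = y" if "(x, y) \<in> M" for x y
    unfolding g_def using that uniq by blast
  have Mg: "M = (\<lambda>x. (x, g x)) ` B" using g by (force simp: B_def image_iff)
  have one: "(1, 1) \<in> M" and mul: "\<And>x y x' y'. (x, y) \<in> M \<Longrightarrow> (x', y') \<in> M \<Longrightarrow> (x * x', y * y') \<in> M"
    and sub: "\<And>x y x' y'. (x, y) \<in> M \<Longrightarrow> (x', y') \<in> M \<Longrightarrow> (x - x', y - y') \<in> M"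
    and inv: "\<And>x y. (x, y) \<in> M \<Longrightarrow> (inverse x, inverse y) \<in> M"
    using M(1) unfolding gr_def by blast+
  have inB: "x \<in> B \<longleftrightarrow> (x, g x) \<in> M" for x using Mg by auto
  have B: "is_subfield B" unfolding is_subfield_def
    using one mul sub inv inB by (metis fst_conv imageI B_def)
  have add: "(x + x', y + y') \<in> M" if "(x, y) \<in> M" "(x', y') \<in> M" for x y x' y'
    using sub[OF that(1) sub[OF sub[OF that(2) that(2)] that(2)]] by simp
  have gB: "hom_on B g" unfolding hom_on_def
  proof (intro conjI ballI)
    show "g 1 = 1" by (rule g[OF one])
    fix u v assume "u \<in> B" "v \<in> B"
    then have uv: "(u, g u) \<in> M" "(v, g v) \<in> M" using Mg by auto
    show "g (u + v) = g u + g v" "g (u * v) = g u * g v"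
      using g[OF add[OF uv]] g[OF mul[OF uv]] by simp_all
  qed
  have AB: "A \<subseteq> B" and fg: "\<forall>a\<in>A. g a = f a" using M(2) g by (force simp: B_def)+
  have algB: "\<exists>h. h \<noteq> 0 \<and> coeffs_in B h \<and> poly h z = 0" for z
    using alg[of z] AB by (auto simp: coeffs_in_def)
  have "x \<in> B" for x
  proof -
    obtain m where m: "coeffs_in B m" "m \<noteq> 0" "poly m x = 0"
      "\<And>h. coeffs_in B h \<Longrightarrow> h \<noteq> 0 \<Longrightarrow> poly h x = 0 \<Longrightarrow> degree m \<le> degree h"
      using minimal_poly_exists[OF algB] by blast
    have "degree m \<noteq> 0"
    proof
      assume "degree m = 0"
      then obtain c where "m = [:c:]" by (rule degree_eq_zeroE)
      with m(2,3) show False by simp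
    qed
    moreover have "g (lead_coeff m) \<noteq> 0"
    proof -
      have "g (inverse (lead_coeff m)) * g (lead_coeff m) = 1"
        using hom_onD(4)[OF B gB, of "inverse (lead_coeff m)" "lead_coeff m"] hom_onD(1)[OF B gB] m(1,2)
          is_subfieldD(5)[OF B] by (simp add: coeffs_in_def)
      then show ?thesis by auto
    qed
    ultimately have "degree (map_poly g m) > 0"
      by (subst map_poly_degree_eq) auto
    then obtain y where "poly (map_poly g m) y = 0" using alg_closed_imp_poly_has_root by blast
    from hom_extend_simple[OF B gB algB m this]
    obtain B' g' where B': "is_subfield B'" "hom_on B' g'" "B \<subseteq> B'" "\<forall>a\<in>B. g' a = g a" "x \<in> B'"
      by blast
    have "M \<subseteq> (\<lambda>a. (a, g' a)) ` B'" using Mg B' by auto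
    then have "(\<lambda>a. (a, g' a)) ` B' = M" by (intro Mmax graph B')
    then show "x \<in> B" using B'(5) by (force simp: B_def)
  qed
  then have "B = UNIV" by blast
  then show ?thesis using gB fg by blast
qed

section \<open>Extension of the \<open>p\<close>-adic valuation\<close>

definition is_subring :: "'a::comm_ring_1 set \<Rightarrow> bool" where
  "is_subring R \<longleftrightarrow> 1 \<in> R \<and> (\<forall>x\<in>R. \<forall>y\<in>R. x - y \<in> R \<and> x * y \<in> R)"

lemma is_subringD:
  assumes "is_subring R"
  shows "1 \<in> R" "0 \<in> R" "\<And>x y. x \<in> R \<Longrightarrow> y \<in> R \<Longrightarrow> x - y \<in> R"
    "\<And>x y. x \<in> R \<Longrightarrow> y \<in> R \<Longrightarrow> x * y \<in> R" "\<And>x. x \<in> R \<Longrightarrow> - x \<in> R"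
    "\<And>x y. x \<in> R \<Longrightarrow> y \<in> R \<Longrightarrow> x + y \<in> R" "\<And>x n. x \<in> R \<Longrightarrow> x ^ n \<in> R"
    "\<And>f S. (\<And>i. i \<in> S \<Longrightarrow> f i \<in> R) \<Longrightarrow> sum f S \<in> R" "of_int k \<in> R"
proof -
  show 1: "1 \<in> R" and d: "\<And>x y. x \<in> R \<Longrightarrow> y \<in> R \<Longrightarrow> x - y \<in> R"
    and m: "\<And>x y. x \<in> R \<Longrightarrow> y \<in> R \<Longrightarrow> x * y \<in> R"
    using assms by (auto simp: is_subring_def)
  show 0: "0 \<in> R" using d[OF 1 1] by simp
  show n: "- x \<in> R" if "x \<in> R" for x using d[OF 0 that] by simp
  show a: "x + y \<in> R" if "x \<in> R" "y \<in> R" for x y using d[OF that(1) n[OF that(2)]] by simp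
  show "x ^ n \<in> R" if "x \<in> R" for x n using that by (induction n) (auto simp: 1 m)
  show "sum f S \<in> R" if "\<And>i. i \<in> S \<Longrightarrow> f i \<in> R" for f S
    using that by (induction S rule: infinite_finite_induct) (auto simp: 0 a)
  have "of_nat m \<in> R" for m by (induction m) (auto simp: 0 1 a)
  then show "of_int k \<in> R" by (cases k rule: int_cases2) (auto simp: n)
qed

lemma maximal_subring:
  fixes y :: "'a::comm_ring_1"
  assumes "is_subring A" "y \<notin> A"
  obtains R where "is_subring R" "A \<subseteq> R" "y \<notin> R" "\<And>S. is_subring S \<Longrightarrow> R \<subseteq> S \<Longrightarrow> y \<notin> S \<Longrightarrow> S = R"
proof -
  define \<G> where "\<G> = {R. is_subring R \<and> A \<subseteq> R \<and> y \<notin> R}"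
  have "\<exists>M\<in>\<G>. \<forall>G\<in>\<G>. M \<subseteq> G \<longrightarrow> G = M"
  proof (rule subset_Zorn_nonempty)
    show "\<G> \<noteq> {}" using assms by (auto simp: \<G>_def)
    fix C assume C: "C \<noteq> {}" "subset.chain \<G> C"
    have CG: "G \<in> \<G>" if "G \<in> C" for G using C that by (auto simp: subset.chain_def)
    have two: "\<exists>G\<in>C. a \<in> G \<and> b \<in> G" if "a \<in> \<Union>C" "b \<in> \<Union>C" for a b
      using that C(2) unfolding subset.chain_def by blast
    have "is_subring (\<Union>C)" unfolding is_subring_def
    proof (intro conjI ballI)
      show "1 \<in> \<Union>C" using C(1) CG by (fastforce simp: \<G>_def is_subring_def)
      fix x y assume "x \<in> \<Union>C" "y \<in> \<Union>C"
      from two[OF this] CG show "x - y \<in> \<Union>C" "x * y \<in> \<Union>C"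
        unfolding \<G>_def is_subring_def by blast+
    qed
    then show "\<Union>C \<in> \<G>" using C(1) CG unfolding \<G>_def by blast
  qed
  then obtain M where M: "M \<in> \<G>" "\<forall>G\<in>\<G>. M \<subseteq> G \<longrightarrow> G = M" ..
  have 1: "is_subring M" "A \<subseteq> M" "y \<notin> M" using M(1) by (auto simp: \<G>_def)
  show ?thesis
  proof (rule that[OF 1])
    fix S assume "is_subring S" "M \<subseteq> S" "y \<notin> S"
    then have "S \<in> \<G>" using 1 by (auto simp: \<G>_def)
    then show "S = M" using M(2) \<open>M \<subseteq> S\<close> by blast
  qed
qed

lemma adjoin_subring:
  assumes "is_subring R"
  shows "is_subring {poly h x |h. coeffs_in R h}"
proof -
  note D = is_subringD[OF assms]
  have "coeffs_in R 1" using D by (auto simp: coeffs_in_def coeff_1)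
  moreover have "coeffs_in R (g - h)" "coeffs_in R (g * h)" if "coeffs_in R g" "coeffs_in R h" for g h
    using that by (auto simp: coeffs_in_def coeff_mult intro!: D)
  ultimately show ?thesis unfolding is_subring_def
    by (auto intro: exI[of _ "1 :: 'a poly"] exI[of _ "_ - _"] exI[of _ "_ * _"] simp flip: poly_diff poly_mult)
qed

text \<open>Chevalley's construction: a subring maximal among those without \<open>1/p\<close> is a
  valuation ring, and \<open>p\<close> lies in its maximal ideal.\<close>

locale maximal_without_inverse =
  fixes R :: "'a::field_char_0 set" and p :: nat
  assumes p: "prime p"
    and ring: "is_subring R"
    and inv_notin: "inverse (of_nat p) \<notin> R"
    and maximal: "\<And>S. is_subring S \<Longrightarrow> R \<subseteq> S \<Longrightarrow> inverse (of_nat p) \<notin> S \<Longrightarrow> S = R"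
begin

abbreviation P :: 'a where "P \<equiv> of_nat p"

lemmas D = is_subringD[OF ring]

lemma P_nz: "P \<noteq> 0" using p by (auto simp: prime_gt_0_nat)

lemma P_in: "P \<in> R" using D(9)[of "int p"] by simp

lemma adjoin_inv:
  assumes "x \<notin> R"
  obtains h where "coeffs_in R h" "P * poly h x = 1"
proof -
  let ?S = "{poly h x |h. coeffs_in R h}"
  have "[:a:] = [:a:] \<and> coeffs_in R [:a:]" if "a \<in> R" for a
    using that D(2) by (auto simp: coeffs_in_def coeff_pCons split: nat.splits)
  then have "R \<subseteq> ?S" by (force intro: exI[of _ "[:_:]"])
  moreover have "x \<in> ?S" using D(1,2)
    by (auto simp: coeffs_in_def coeff_pCons split: nat.splits intro!: exI[of _ "[:0,1:]"])
  ultimately have "inverse P \<in> ?S" using maximal[OF adjoin_subring[OF ring, of x]] assms by blast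
  then show ?thesis using that P_nz by (auto simp: field_simps)
qed

text \<open>If the inverse were missing, \<open>1/p\<close> would be a polynomial of some degree
  \<open>n\<close> in it. Multiplication with \<open>(1 - P * a) ^ n\<close>, which is 1 modulo
  \<open>p\<close>, would turn this into \<open>1/p - b \<in> R\<close> with
  \<open>b \<in> R\<close>.\<close>

lemma one_minus_unit:
  assumes a: "a \<in> R"
  shows "1 - P * a \<noteq> 0" "inverse (1 - P * a) \<in> R"
proof -
  show nz: "1 - P * a \<noteq> 0"
  proof
    assume "1 - P * a = 0"
    then have "a = inverse P" using P_nz by (simp add: field_simps)
    then show False using a inv_notin by simp
  qed
  have pw: "\<exists>b\<in>R. (1 - P * a) ^ n = 1 - P * b" for n
  proof (induction n)
    case 0
    then show ?case using D(2) by (intro bexI[of _ 0]) auto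
  next
    case (Suc n)
    then obtain b where "b \<in> R" "(1 - P * a) ^ n = 1 - P * b" by blast
    then show ?case using a
      by (intro bexI[of _ "a + b - P * a * b"])
        (simp only: power_Suc, simp add: algebra_simps, auto intro!: D P_in)
  qed
  show "inverse (1 - P * a) \<in> R"
  proof (rule ccontr)
    assume "inverse (1 - P * a) \<notin> R"
    then obtain h where h: "coeffs_in R h" "P * poly h (inverse (1 - P * a)) = 1" by (rule adjoin_inv)
    define n where "n = degree h"
    have "(1 - P * a) ^ n * poly h (inverse (1 - P * a)) = (\<Sum>i\<le>n. coeff h i * (1 - P * a) ^ (n - i))"
      unfolding poly_altdef n_def[symmetric] sum_distrib_left
      by (intro sum.cong refl) (use nz in \<open>simp add: power_diff field_simps\<close>)
    also have "\<dots> \<in> R" using h(1) a by (intro D P_in) (auto simp: coeffs_in_def)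
    finally have "(1 - P * a) ^ n * poly h (inverse (1 - P * a)) \<in> R" .
    moreover obtain b where b: "b \<in> R" "(1 - P * a) ^ n = 1 - P * b" using pw by blast
    moreover have "poly h (inverse (1 - P * a)) = inverse P" using h(2) P_nz by (simp add: field_simps)
    moreover have "(1 - P * b) * inverse P = inverse P - b" using P_nz by (simp add: field_simps)
    ultimately have "inverse P - b \<in> R" by (simp only:)
    then have "inverse P - b + b \<in> R" using b by (intro D(6))
    then show False using inv_notin by simp
  qed
qed

text \<open>The relation for \<open>inverse x\<close> can be solved for \<open>x\<close> because
  \<open>1 - P * g0\<close> is a unit. This gives \<open>x ^ n\<close> as a polynomial in
  \<open>x\<close> of smaller degree, which replaces the leading term of \<open>h\<close>.\<close>

lemma shorten_relation:
  assumes x: "x \<noteq> 0" and h: "coeffs_in R h" "degree h \<le> n" "P * poly h x = 1"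
    and g: "coeffs_in R g" "degree g \<le> m" "P * poly g (inverse x) = 1"
    and mn: "m \<le> n" "n > 0"
  shows "\<exists>h'. coeffs_in R h' \<and> degree h' \<le> n - 1 \<and> P * poly h' x = 1"
proof -
  obtain g0 g' where gg: "g = pCons g0 g'" by (cases g)
  have g0: "g0 \<in> R" and g': "coeffs_in R g'"
    using g(1) gg by (auto simp: coeffs_in_def coeff_pCons dest: spec[of _ 0] spec[of _ "Suc _"])
  note u = one_minus_unit[OF g0]
  define k where "k = smult (P * inverse (1 - P * g0)) g'"
  have k: "coeffs_in R k" using g' u(2) by (auto simp: k_def coeffs_in_def intro!: D P_in)
  have dk: "degree k \<le> n - 1"
    using g(2) mn by (cases "g' = 0") (auto simp: k_def gg)
  have "1 - P * g0 = P * (inverse x * poly g' (inverse x))"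
    using g(3) by (simp add: gg algebra_simps)
  then have xk: "x = poly k (inverse x)" using u(1) x P_nz by (simp add: k_def field_simps)
  \<comment> \<open>\<open>s\<close> is \<open>x ^ (n - 1) * poly k (inverse x)\<close> written as a
    polynomial in \<open>x\<close>; as \<open>x = poly k (inverse x)\<close>, its value is
    \<open>x ^ n\<close>.\<close>
  define s where "s = (\<Sum>j\<le>degree k. monom (coeff k j) (n - 1 - j))"
  have s: "coeffs_in R s" using k by (auto simp: s_def coeffs_in_def coeff_sum intro!: D)
  have ds: "degree s \<le> n - 1" unfolding s_def
    by (intro degree_sum_le) (auto intro: order_trans[OF degree_monom_le])
  have "poly s x = x ^ (n - 1) * poly k (inverse x)"
    unfolding s_def poly_sum poly_altdef[of k] sum_distrib_left
  proof (intro sum.cong refl)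
    fix j assume "j \<in> {..degree k}"
    then have "n - 1 = j + (n - 1 - j)" using dk by simp
    then have "x ^ (n - 1) = x ^ j * x ^ (n - 1 - j)" by (metis power_add)
    then show "poly (monom (coeff k j) (n - 1 - j)) x = x ^ (n - 1) * (coeff k j * inverse x ^ j)"
      using x by (simp add: poly_monom field_simps)
  qed
  then have sx: "poly s x = x ^ n" using xk[symmetric] mn by (cases n) auto
  define h' where "h' = h - monom (coeff h n) n + smult (coeff h n) s"
  have "coeffs_in R h'" using h(1) s by (auto simp: h'_def coeffs_in_def intro!: D)
  moreover have "poly h' x = poly h x" by (simp add: h'_def poly_monom sx)
  moreover have "degree h' \<le> n - 1"
  proof (rule degree_le, intro allI impI)
    fix i assume i: "n - 1 < i"
    then have "coeff s i = 0" using ds by (intro coeff_eq_0) auto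
    moreover have "coeff (h - monom (coeff h n) n) i = 0"
      using i h(2) mn by (cases "i = n") (auto intro!: coeff_eq_0)
    ultimately show "coeff h' i = 0" by (simp add: h'_def)
  qed
  ultimately show ?thesis using h(3) by metis
qed

text \<open>With both elements outside of \<open>R\<close>, take relations of least degree for each;
  the longer one could be shortened.\<close>

lemma total: "x \<in> R \<or> inverse x \<in> R"
proof (rule ccontr)
  assume "\<not> ?thesis"
  then have nin: "x \<notin> R" "inverse x \<notin> R" by auto
  then have x: "x \<noteq> 0" using D(2) by auto
  define Q where "Q y n \<longleftrightarrow> (\<exists>h. coeffs_in R h \<and> degree h \<le> n \<and> P * poly h y = 1)" for y n
  have ex: "\<exists>n. Q y n" if "y \<notin> R" for y using adjoin_inv[OF that] by (metis Q_def order_refl)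
  have pos: "n > 0" if "Q y n" for y n
  proof (rule ccontr)
    assume "\<not> n > 0"
    then have "Q y 0" using that by simp
    then obtain h where h: "coeffs_in R h" "degree h = 0" "P * poly h y = 1" by (auto simp: Q_def)
    from h(2) obtain c where "h = [:c:]" by (rule degree_eq_zeroE)
    then have "poly h y = coeff h 0" by simp
    then have "coeff h 0 = inverse P" using h P_nz by (simp add: field_simps)
    then show False using h(1) inv_notin by (metis coeffs_in_def)
  qed
  define n where "n = (LEAST n. Q x n)"
  define m where "m = (LEAST n. Q (inverse x) n)"
  have n: "Q x n" and m: "Q (inverse x) m" unfolding n_def m_def using ex[OF nin(1)] ex[OF nin(2)]
    by (auto intro: LeastI_ex)
  show False
  proof (cases "m \<le> n")
    case True
    have "Q x (n - 1)" using n m shorten_relation[OF x _ _ _ _ _ _ True pos[OF n]] unfolding Q_def by blast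
    then show False using pos[OF n] not_less_Least[of "n - 1" "Q x"] by (simp add: n_def)
  next
    case False
    have "Q (inverse x) (m - 1)"
      using n m shorten_relation[of "inverse x" _ m _ n] pos[OF m] x False unfolding Q_def
      by (metis inverse_inverse_eq inverse_nonzero_iff_nonzero nat_le_linear)
    then show False using pos[OF m] not_less_Least[of "m - 1" "Q (inverse x)"] by (simp add: m_def)
  qed
qed

definition U :: "'a set" where "U = {u. u \<noteq> 0 \<and> u \<in> R \<and> inverse u \<in> R}"

lemma U_mult: "u \<in> U \<Longrightarrow> v \<in> U \<Longrightarrow> u * v \<in> U"
  by (auto simp: U_def D)

lemma U_inverse: "u \<in> U \<Longrightarrow> inverse u \<in> U"
  by (auto simp: U_def)

lemma U_1: "1 \<in> U" by (auto simp: U_def D)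

lemma U_power: "u \<in> U \<Longrightarrow> u ^ n \<in> U"
  by (induction n) (auto simp: U_mult U_1)

lemma int_unit:
  assumes "coprime n (int p)"
  shows "of_int n \<in> U"
proof -
  obtain a b where ab: "a * n + b * int p = 1" using bezout_int[of n "int p"] assms by auto
  have "of_int n * of_int a = (of_int (a * n) :: 'a)" by simp
  also have "a * n = 1 - int p * b" using ab by (simp add: algebra_simps)
  finally have e: "of_int n * of_int a = 1 - P * of_int b" by simp
  note u = one_minus_unit[OF D(9)[of b]]
  have "n \<noteq> 0" using assms p by auto
  then have "inverse (of_int n) = of_int a * inverse (1 - P * of_int b)"
    using e u(1) by (simp add: field_simps)
  then show ?thesis using \<open>n \<noteq> 0\<close> u D by (auto simp: U_def)
qed

lemma P_powi_unit: "P powi k \<in> U \<Longrightarrow> k = 0"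
proof -
  have *: False if "P ^ n \<in> U" "n > 0" for n
  proof -
    have "inverse P = P ^ (n - 1) * inverse (P ^ n)" using that P_nz by (cases n) (auto simp: field_simps)
    also have "\<dots> \<in> R" using that by (auto simp: U_def intro!: D P_in)
    finally show False using inv_notin by simp
  qed
  assume k: "P powi k \<in> U"
  show "k = 0"
  proof (rule ccontr)
    assume "k \<noteq> 0"
    then show False
    proof (cases "k > 0")
      case True
      then show False using *[of "nat k"] k by (simp add: power_int_def)
    next
      case False
      then have "inverse (P powi k) = P ^ nat (- k)" using \<open>k \<noteq> 0\<close>
        by (simp add: power_int_def power_inverse)
      then show False using *[of "nat (- k)"] U_inverse[OF k] \<open>k \<noteq> 0\<close> False by simp
    qed
  qed
qed

text \<open>The value of \<open>x\<close> is read off from a power of \<open>x\<close> that is a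
  power of \<open>p\<close> up to a unit. For nonzero algebraic elements such a power exists, so
  values are rational numbers from the outset.\<close>

definition rel :: "'a \<Rightarrow> rat \<Rightarrow> bool" where
  "rel x r \<longleftrightarrow> (\<exists>n k u. n > 0 \<and> u \<in> U \<and> x ^ n = P powi k * u \<and> r = of_int k / of_nat n)"

lemma rel_unique:
  assumes "rel x r" "rel x s"
  shows "r = s"
proof -
  obtain n k u where 1: "n > 0" "u \<in> U" "x ^ n = P powi k * u" "r = of_int k / of_nat n"
    using assms(1) by (auto simp: rel_def)
  obtain m l v where 2: "m > 0" "v \<in> U" "x ^ m = P powi l * v" "s = of_int l / of_nat m"
    using assms(2) by (auto simp: rel_def)
  have "(x ^ n) ^ m = (x ^ m) ^ n" by (simp add: mult.commute flip: power_mult)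
  then have "P powi (k * int m) * u ^ m = P powi (l * int n) * v ^ n"
    unfolding 1 2 by (simp add: power_mult_distrib power_int_mult)
  then have "P powi (k * int m - l * int n) = v ^ n * inverse (u ^ m)"
    using 1(2) 2(2) P_nz by (simp add: power_int_diff U_def field_simps)
  then have "P powi (k * int m - l * int n) \<in> U" using 1 2 by (simp add: U_mult U_power U_inverse)
  from P_powi_unit[OF this] have "k * int m = l * int n" by simp
  then have "(of_int (k * int m) :: rat) = of_int (l * int n)" by simp
  then show ?thesis unfolding 1 2 using 1(1) 2(1) by (simp add: frac_eq_eq)
qed

lemma rel_mult:
  assumes "rel x r" "rel y s"
  shows "rel (x * y) (r + s)"
proof -
  obtain n k u where 1: "n > 0" "u \<in> U" "x ^ n = P powi k * u" "r = of_int k / of_nat n"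
    using assms(1) by (auto simp: rel_def)
  obtain m l v where 2: "m > 0" "v \<in> U" "y ^ m = P powi l * v" "s = of_int l / of_nat m"
    using assms(2) by (auto simp: rel_def)
  have "(x * y) ^ (n * m) = (x ^ n) ^ m * (y ^ m) ^ n"
    by (simp add: power_mult_distrib mult.commute flip: power_mult)
  also have "\<dots> = P powi (k * int m + l * int n) * (u ^ m * v ^ n)"
    unfolding 1 2 using P_nz by (simp add: power_mult_distrib power_int_mult power_int_add)
  finally show ?thesis unfolding rel_def using 1 2
    by (intro exI[of _ "n * m"] exI[of _ "k * int m + l * int n"] exI[of _ "u ^ m * v ^ n"])
       (auto simp: field_simps U_mult U_power)
qed

lemma rel_int:
  assumes "n \<noteq> 0"
  shows "rel (of_int n) (of_nat (multiplicity (int p) n))"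
proof -
  have pp: "prime (int p)" using p by simp
  obtain m where m: "n = int p ^ multiplicity (int p) n * m" "\<not> int p dvd m"
    using multiplicity_decompose'[of n "int p"] assms pp by (metis not_prime_unit)
  have "coprime (int p) m" using pp m(2) by (rule prime_imp_coprime)
  then have "of_int m \<in> U" by (intro int_unit) (simp add: coprime_commute)
  moreover have "of_int n ^ 1 = P powi int (multiplicity (int p) n) * of_int m"
    by (subst m(1)) simp
  ultimately show ?thesis unfolding rel_def
    by (intro exI[of _ 1] exI[of _ "int (multiplicity (int p) n)"] exI[of _ "of_int m"]) auto
qed

lemma rel_inverse: "rel x r \<Longrightarrow> rel (inverse x) (- r)"
proof -
  assume "rel x r"
  then obtain n k u where 1: "n > 0" "u \<in> U" "x ^ n = P powi k * u" "r = of_int k / of_nat n"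
    by (auto simp: rel_def)
  have "inverse x ^ n = P powi (- k) * inverse u"
    using 1(3) by (simp add: power_inverse power_int_minus)
  then show ?thesis unfolding rel_def using 1 U_inverse
    by (intro exI[of _ n] exI[of _ "- k"] exI[of _ "inverse u"]) auto
qed

lemma nonunit_add:
  assumes "x \<in> R - U" "y \<in> R - U"
  shows "x + y \<in> R - U"
proof -
  have *: "x + y \<in> R - U" if "x \<in> R - U" "y \<in> R - U" "x / y \<in> R" "y \<noteq> 0" for x y
  proof -
    have e: "x + y = y * (1 + x / y)" using that(4) by (simp add: field_simps)
    show ?thesis
    proof (rule ccontr)
      assume "\<not> ?thesis"
      moreover have "x + y \<in> R" using that by (intro D) auto
      ultimately have xy: "x + y \<in> U" by auto
      have "inverse y = (1 + x / y) * inverse (x + y)"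
        using xy that(4) by (simp add: U_def field_simps)
      also have "\<dots> \<in> R" using xy that by (intro D) (auto simp: U_def)
      finally show False using that by (auto simp: U_def)
    qed
  qed
  show ?thesis
  proof (cases "x = 0 \<or> y = 0")
    case False
    then show ?thesis using *[of x y] *[of y x] total[of "x / y"] assms by (auto simp: add.commute)
  qed (use assms in auto)
qed

text \<open>In the vanishing sum of the terms \<open>t i\<close> of an integer polynomial relation,
  two terms must agree up to a unit; their quotient shows that a positive power of \<open>x\<close>
  is a rational number times a unit.\<close>

lemma rel_exists:
  assumes x: "x \<noteq> 0" "algebraic x"
  shows "\<exists>r. rel x r"
proof -
  obtain h where h: "\<And>i. coeff h i \<in> \<int>" "h \<noteq> 0" "poly h x = 0" using x(2) unfolding algebraic_def by blast
  define I where "I = {i. i \<le> degree h \<and> coeff h i \<noteq> 0}"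
  define t where "t i = coeff h i * x ^ i" for i
  have fin: "finite I" by (simp add: I_def)
  have ne: "I \<noteq> {}" using h(2) by (auto simp: I_def intro: exI[of _ "degree h"])
  have tnz: "t i \<noteq> 0" if "i \<in> I" for i using that x by (simp add: t_def I_def)
  have sum0: "(\<Sum>i\<in>I. t i) = 0"
  proof -
    have "(\<Sum>i\<in>I. t i) = (\<Sum>i\<le>degree h. t i)"
      unfolding I_def t_def by (intro sum.mono_neutral_left) auto
    then show ?thesis using h(3) by (simp add: poly_altdef t_def)
  qed
  have "\<exists>i\<in>I. \<forall>j\<in>I. t j / t i \<in> R" using fin ne tnz
  proof (induction I rule: finite_ne_induct)
    case (singleton i)
    then show ?case using D(1) by simp
  next
    case (insert k F)
    then obtain i where i: "i \<in> F" "\<forall>j\<in>F. t j / t i \<in> R" by auto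
    show ?case
    proof (cases "t k / t i \<in> R")
      case True
      then show ?thesis using i by auto
    next
      case False
      then have ik: "t i / t k \<in> R" using total[of "t k / t i"] by (simp add: divide_inverse mult.commute)
      have "t j / t k \<in> R" if "j \<in> F" for j
      proof -
        have "t j / t k = (t j / t i) * (t i / t k)" using insert i(1) by simp
        then show ?thesis using i that ik by (simp only:) (intro D, auto)
      qed
      then show ?thesis using D(1) insert(5)[of k] by auto
    qed
  qed
  then obtain i where i: "i \<in> I" "\<And>j. j \<in> I \<Longrightarrow> t j / t i \<in> R" by blast
  \<comment> \<open>Otherwise all quotients with \<open>j \<noteq> i\<close> are non-units, and so
    is their sum, which equals -1.\<close>
  have "\<exists>j\<in>I - {i}. t j / t i \<in> U"
  proof (rule ccontr)
    assume "\<not> ?thesis"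
    then have non: "t j / t i \<in> R - U" if "j \<in> I - {i}" for j using that i by auto
    have "(\<Sum>j\<in>J. t j / t i) \<in> R - U" if "J \<subseteq> I - {i}" for J
      using finite_subset[OF that] fin that
    proof (induction J rule: infinite_finite_induct)
      case (insert j J)
      then show ?case unfolding sum.insert[OF insert(1,2)]
        by (intro nonunit_add non) auto
    qed (auto simp: D U_def)
    then have "(\<Sum>j\<in>I - {i}. t j / t i) \<in> R - U" by blast
    moreover have "(\<Sum>j\<in>I - {i}. t j / t i) = -1"
    proof -
      have "t i + (\<Sum>j\<in>I - {i}. t j) = 0" using sum0 fin i(1) by (simp add: sum.remove)
      then have "(\<Sum>j\<in>I - {i}. t j) = - t i" by (simp add: eq_neg_iff_add_eq_0 add.commute)
      then show ?thesis using tnz[OF i(1)] by (simp flip: sum_divide_distrib)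
    qed
    ultimately show False using D by (auto simp: U_def)
  qed
  then obtain j where j: "j \<in> I" "j \<noteq> i" "t j / t i \<in> U" by blast
  have *: "\<exists>r. rel x r" if ij: "i < j" "t j / t i \<in> U" "i \<in> I" "j \<in> I" for i j
  proof -
    obtain a b where ab: "coeff h i = of_int a" "coeff h j = of_int b"
      using h(1)[of i] h(1)[of j] by (auto elim!: Ints_cases)
    have ab0: "a \<noteq> 0" "b \<noteq> 0" using ij ab by (auto simp: I_def)
    define u where "u = t j / t i"
    have xu: "x ^ (j - i) = of_int a * inverse (of_int b) * u"
      using x ij(1) ab ab0 by (simp add: u_def t_def power_diff field_simps)
    have "rel u 0" unfolding rel_def using ij
      by (intro exI[of _ 1] exI[of _ 0] exI[of _ u]) (auto simp: u_def)
    then obtain r where "rel (x ^ (j - i)) r"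
      using rel_mult[OF rel_mult[OF rel_int[OF ab0(1)] rel_inverse[OF rel_int[OF ab0(2)]]], of u 0] xu by auto
    then obtain n k v where "n > 0" "v \<in> U" "(x ^ (j - i)) ^ n = P powi k * v"
      by (auto simp: rel_def)
    then show ?thesis unfolding rel_def using ij(1)
      by (intro exI exI[of _ "(j - i) * n"] exI[of _ k] exI[of _ v]) (auto simp: power_mult)
  qed
  show ?thesis
  proof (cases "i < j")
    case True
    then show ?thesis using *[of i j] i j by auto
  next
    case False
    moreover have "t i / t j \<in> U" using U_inverse[OF j(3)] by simp
    ultimately show ?thesis using *[of j i] i j by auto
  qed
qed

lemma rel_nonneg:
  assumes "rel x r" "x \<noteq> 0"
  shows "r \<ge> 0 \<longleftrightarrow> x \<in> R"
proof -
  obtain n k u where 1: "n > 0" "u \<in> U" "x ^ n = P powi k * u" "r = of_int k / of_nat n"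
    using assms(1) by (auto simp: rel_def)
  show ?thesis
  proof (cases "k \<ge> 0")
    case True
    then have "x ^ n \<in> R" using 1 by (auto simp: power_int_def U_def intro!: D P_in)
    have "x \<in> R"
    proof (rule ccontr)
      assume "x \<notin> R"
      then have "inverse x \<in> R" using total by blast
      \<comment> \<open>Valuation rings are integrally closed: \<open>x\<close> is recovered from
        \<open>x ^ n\<close> and a power of \<open>inverse x\<close>.\<close>
      then have "x ^ n * inverse x ^ (n - 1) \<in> R" using \<open>x ^ n \<in> R\<close> by (intro D(4) D(7)[of "inverse x"])
      moreover have "x ^ n * inverse x ^ (n - 1) = x" using 1(1) assms(2)
        by (cases n) (auto simp: power_inverse field_simps)
      ultimately show False using \<open>x \<notin> R\<close> by (simp only:)
    qed
    then show ?thesis using 1 True by simp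
  next
    case False
    have "x \<notin> R"
    proof
      assume "x \<in> R"
      have "inverse P = P ^ (nat (- k) - 1) * x ^ n * inverse u"
        using 1(2) P_nz False unfolding 1(3)
        by (cases "nat (- k)") (auto simp: power_int_def U_def power_inverse field_simps)
      also have "\<dots> \<in> R" using \<open>x \<in> R\<close> 1(2) by (auto simp: U_def intro!: D P_in)
      finally show False using inv_notin by simp
    qed
    moreover have "r < 0" using 1(1,4) False by (simp add: divide_less_0_iff)
    ultimately show ?thesis by simp
  qed
qed

end

theorem padic_extension_exists:
  fixes p :: nat
  assumes p: "prime p" and alg: "\<And>x::'a::field_char_0. algebraic x"
  shows "\<exists>w :: 'a \<Rightarrow> rat. (\<forall>x y. x \<noteq> 0 \<longrightarrow> y \<noteq> 0 \<longrightarrow> w (x * y) = w x + w y) \<and>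
    (\<forall>x y. x \<noteq> 0 \<longrightarrow> y \<noteq> 0 \<longrightarrow> x + y \<noteq> 0 \<longrightarrow> min (w x) (w y) \<le> w (x + y)) \<and>
    (\<forall>q. q \<noteq> 0 \<longrightarrow> w (of_rat q) = padic_valuation p q)"
proof -
  \<comment> \<open>The integers are a sufficient start: those prime to \<open>p\<close> become
    units of \<open>R\<close> by \<open>int_unit\<close>, so the valuation restricts to the
    \<open>p\<close>-adic one.\<close>
  have "is_subring (\<int> :: 'a set)" by (auto simp: is_subring_def)
  moreover have "inverse (of_nat p) \<notin> (\<int> :: 'a set)"
  proof
    assume "inverse (of_nat p) \<in> (\<int> :: 'a set)"
    then obtain k where "inverse (of_nat p) = (of_int k :: 'a)" by (auto elim: Ints_cases)
    then have "of_int (k * int p) = (of_int 1 :: 'a)" using p by (simp add: field_simps prime_gt_0_nat)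
    then have "k * int p = 1" by (simp only: of_int_eq_iff)
    then have "int p dvd 1" by (metis dvd_triv_right)
    then show False using p by (simp add: prime_gt_1_nat)
  qed
  ultimately obtain R :: "'a set" where R: "is_subring R" "inverse (of_nat p) \<notin> R"
    "\<And>S. is_subring S \<Longrightarrow> R \<subseteq> S \<Longrightarrow> inverse (of_nat p) \<notin> S \<Longrightarrow> S = R"
    by (rule maximal_subring) blast
  interpret maximal_without_inverse R p by unfold_locales (use p R in auto)
  define w where "w x = (THE r. rel x r)" for x
  have w: "rel x (w x)" if "x \<noteq> 0" for x
    unfolding w_def using rel_exists[OF that alg] rel_unique by (metis theI)
  have weq: "w x = r" if "rel x r" for x r
    unfolding w_def using that rel_unique by blast
  have mult: "w (x * y) = w x + w y" if "x \<noteq> 0" "y \<noteq> 0" for x y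
    using weq[OF rel_mult[OF w w]] that by blast
  have inv: "w (inverse x) = - w x" if "x \<noteq> 0" for x
    using weq[OF rel_inverse[OF w]] that by blast
  have le: "w y \<le> w x \<longleftrightarrow> x / y \<in> R" if "x \<noteq> 0" "y \<noteq> 0" for x y
    using rel_nonneg[OF w, of "x / y"] mult[of x "inverse y"] inv[of y] that by (auto simp: divide_inverse)
  have add: "min (w x) (w y) \<le> w (x + y)" if "x \<noteq> 0" "y \<noteq> 0" "x + y \<noteq> 0" for x y
  proof -
    have *: "w y \<le> w (x + y)" if "x \<noteq> 0" "y \<noteq> 0" "x + y \<noteq> 0" "w y \<le> w x" for x y
    proof -
      have "1 + x / y \<in> R" using le[OF that(1,2)] that(4) by (intro D) auto
      moreover have "(x + y) / y = 1 + x / y" using that by (simp add: field_simps)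
      ultimately show ?thesis using le[OF that(3,2)] by simp
    qed
    show ?thesis using *[of x y] *[of y x] that by (cases "w y \<le> w x") (auto simp: min_def add.commute)
  qed
  have rat: "w (of_rat q) = padic_valuation p q" if "q \<noteq> 0" for q
  proof -
    obtain a b where ab: "quotient_of q = (a, b)" by fastforce
    have b: "b \<noteq> 0" using quotient_of_denom_pos[OF ab] by simp
    have q: "q = of_int a / of_int b" using quotient_of_div[OF ab] by simp
    have a: "a \<noteq> 0" using that q by auto
    have "(of_rat q :: 'a) = of_int a * inverse (of_int b)" by (simp add: q of_rat_divide flip: divide_inverse)
    then have "w (of_rat q) = of_nat (multiplicity (int p) a) + - of_nat (multiplicity (int p) b)"
      using weq[OF rel_mult[OF rel_int[OF a] rel_inverse[OF rel_int[OF b]]]] by simp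
    then show ?thesis by (simp add: padic_valuation_def ab)
  qed
  show ?thesis using mult add rat by blast
qed

section \<open>The field of algebraic numbers\<close>

text \<open>Every element of this type is algebraic over the rationals, so Galois groups of the
  algebraic closure consist of plain functions on the type.\<close>

type_synonym qbar = "rat alg_closure"

abbreviation fhom :: "('a::field \<Rightarrow> 'b::field) \<Rightarrow> bool" where
  "fhom f \<equiv> hom_on UNIV f"

lemma is_subfield_UNIV: "is_subfield UNIV"
  by (simp add: is_subfield_def)

lemma hom_simps:
  assumes "fhom f"
  shows "f 1 = 1" "f 0 = 0" "f (x + y) = f x + f y" "f (x * y) = f x * f y" "f (- x) = - f x"
    "f (x - y) = f x - f y" "f (inverse x) = inverse (f x)" "f (x / y) = f x / f y"
    "f (x ^ n) = f x ^ n" "f x = 0 \<longleftrightarrow> x = 0" "f x = f y \<longleftrightarrow> x = y" "f (of_int k) = of_int k"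
    "f (of_nat n) = of_nat n"
proof -
  note F = hom_onD[OF is_subfield_UNIV assms, simplified]
  show "f 1 = 1" "f 0 = 0" "f (x + y) = f x + f y" "f (x * y) = f x * f y" "f (- x) = - f x"
    "f (x - y) = f x - f y" "f (inverse x) = inverse (f x)" by (rule F)+
  show "f (x / y) = f x / f y" by (simp add: divide_inverse F)
  show "f (x ^ n) = f x ^ n" by (induction n) (auto simp: F)
  show 0: "f x = 0 \<longleftrightarrow> x = 0" for x
    using F(4)[of x "inverse x"] F(1,2) by (cases "x = 0") auto
  show "f x = f y \<longleftrightarrow> x = y" using 0[of "x - y"] F(6)[of x y] by auto
  show n: "f (of_nat n) = of_nat n" for n by (induction n) (auto simp: F)
  show "f (of_int k) = of_int k" by (cases k rule: int_cases2) (auto simp: F n)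
qed

lemma hom_of_rat:
  fixes f :: "'a::field_char_0 \<Rightarrow> 'b::field_char_0"
  shows "fhom f \<Longrightarrow> f (of_rat q) = of_rat q"
  by (cases q) (simp add: of_rat_rat hom_simps)

lemma hom_sum: "fhom f \<Longrightarrow> f (sum g S) = (\<Sum>i\<in>S. f (g i))"
  by (induction S rule: infinite_finite_induct) (auto simp: hom_simps)

lemma hom_prod: "fhom f \<Longrightarrow> f (prod g S) = (\<Prod>i\<in>S. f (g i))"
  by (induction S rule: infinite_finite_induct) (auto simp: hom_simps)

lemma hom_poly: "fhom f \<Longrightarrow> f (poly h x) = poly (map_poly f h) (f x)"
  by (induction h) (auto simp: hom_simps map_poly_pCons)

lemma hom_map_poly:
  assumes "fhom f"
  shows "map_poly f (g + h) = map_poly f g + map_poly f h"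
    "map_poly f (g * h) = map_poly f g * map_poly f h" "map_poly f 1 = 1"
    "degree (map_poly f g) = degree g" "map_poly f g = 0 \<longleftrightarrow> g = 0"
proof -
  show "map_poly f (g + h) = map_poly f g + map_poly f h"
    "map_poly f (g * h) = map_poly f g * map_poly f h"
    by (rule map_poly_hom_on[OF is_subfield_UNIV assms]; simp add: coeffs_in_def)+
  show "map_poly f 1 = 1" by (simp add: hom_simps[OF assms])
  show "degree (map_poly f g) = degree g"
    by (rule degree_map_poly) (simp add: hom_simps[OF assms])
  show "map_poly f g = 0 \<longleftrightarrow> g = 0"
    by (rule map_poly_eq_0_iff) (simp_all add: hom_simps[OF assms])
qed

lemma hom_comp: "fhom f \<Longrightarrow> fhom g \<Longrightarrow> fhom (f \<circ> g)"
  by (simp add: hom_on_def)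

lemma to_ac_rat: "to_ac q = of_rat q"
  by (cases q) (simp add: of_rat_divide Fract_of_int_quotient)

lemma algebraic_qbar: "algebraic (x :: qbar)"
proof -
  obtain h :: "rat poly" where h: "h \<noteq> 0" "poly (map_poly to_ac h) x = 0"
    by (rule alg_closure_algebraic)
  show ?thesis
  proof (rule algebraicI')
    show "coeff (map_poly to_ac h) i \<in> \<rat>" for i by (simp add: coeff_map_poly to_ac_rat)
    show "map_poly to_ac h \<noteq> (0 :: qbar poly)" using h(1) by (simp add: map_poly_eq_0_iff)
  qed (rule h(2))
qed

lemma algebraic_over_subfield:
  fixes x :: qbar
  assumes "is_subfield A"
  shows "\<exists>h. h \<noteq> 0 \<and> coeffs_in A h \<and> poly h x = 0"
  using algebraic_qbar[of x] is_subfield_of_int[OF assms]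
  unfolding algebraic_def coeffs_in_def by (metis Ints_cases)

lemma qbar_hom_extend:
  fixes f :: "qbar \<Rightarrow> 'b::alg_closed_field"
  assumes "is_subfield A" "hom_on A f"
  shows "\<exists>g. fhom g \<and> (\<forall>a\<in>A. g a = f a)"
  by (rule hom_extend[OF assms algebraic_over_subfield[OF assms(1)]])

lemma splits:
  fixes h :: "'a::alg_closed_field poly"
  assumes "h \<noteq> 0"
  obtains A where "h = smult (lead_coeff h) (\<Prod>x\<in>#A. [:-x, 1:])"
  using alg_closed_imp_factorization[OF assms] by blast

lemma poly_prod_mset_linear: "poly (\<Prod>a\<in>#A. [:-a, 1:]) x = (\<Prod>a\<in>#A. x - a)"
  for x :: "'a::comm_ring_1"
  by (induction A) (auto simp: algebra_simps)

text \<open>\<open>h\<close> splits into linear factors in the source, so the roots of its image are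
  the images of its roots. This yields surjectivity of endomorphisms and determines the range of
  embeddings.\<close>

lemma hom_root_in_range:
  fixes f :: "'a::alg_closed_field \<Rightarrow> 'b::field"
  assumes f: "fhom f" and h: "h \<noteq> 0" "poly (map_poly f h) y = 0"
  shows "\<exists>x. poly h x = 0 \<and> y = f x"
proof -
  obtain A where A: "h = smult (lead_coeff h) (\<Prod>x\<in>#A. [:-x, 1:])" using splits[OF h(1)] .
  have "map_poly f (\<Prod>x\<in>#A. [:-x, 1:]) = (\<Prod>x\<in>#A. [:-f x, 1:])" for A
    by (induction A) (simp_all add: hom_map_poly[OF f] hom_simps[OF f] map_poly_pCons del: mult_pCons_left)
  moreover have "map_poly f (smult c g) = smult (f c) (map_poly f g)" for c g
    by (rule poly_eqI) (simp add: coeff_map_poly hom_simps[OF f])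
  ultimately have "map_poly f h = smult (f (lead_coeff h)) (\<Prod>x\<in>#A. [:-f x, 1:])"
    by (subst A) simp
  then have "f (lead_coeff h) * (\<Prod>a\<in>#A. y - f a) = 0"
    using h(2) poly_prod_mset_linear[of "image_mset f A" y] by (simp add: image_mset.compositionality o_def)
  then obtain a where a: "a \<in># A" "y = f a"
    using h(1) by (auto simp: hom_simps[OF f] prod_mset_zero_iff)
  have "poly h a = lead_coeff h * (\<Prod>x\<in>#A. a - x)"
    by (subst A) (simp add: poly_prod_mset_linear)
  also have "\<dots> = 0" using a(1) by (auto simp: prod_mset_zero_iff)
  finally show ?thesis using a by auto
qed

lemma qbar_embedding:
  obtains e :: "qbar \<Rightarrow> complex" where "fhom e" "range e = {x. algebraic x}"
proof -
  have sQ: "is_subfield (\<rat> :: qbar set)" by (auto simp: is_subfield_def)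
  define f where "f x = (of_rat (THE q. x = of_rat q) :: complex)" for x :: qbar
  have f: "f (of_rat q) = of_rat q" for q by (simp add: f_def)
  have "hom_on \<rat> f" unfolding hom_on_def
  proof (intro conjI ballI)
    show "f 1 = 1" using f[of 1] by simp
    fix x y :: qbar assume "x \<in> \<rat>" "y \<in> \<rat>"
    then obtain q r where "x = of_rat q" "y = of_rat r" by (auto elim!: Rats_cases)
    then show "f (x + y) = f x + f y" "f (x * y) = f x * f y"
      using f[of "q + r"] f[of "q * r"] by (simp_all add: f of_rat_add of_rat_mult)
  qed
  from qbar_hom_extend[OF sQ this] obtain e :: "qbar \<Rightarrow> complex" where e: "fhom e" by blast
  have "algebraic (e x)" for x
  proof -
    obtain h where h: "\<And>i. coeff h i \<in> \<int>" "h \<noteq> 0" "poly h x = 0"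
      using algebraic_qbar[of x] unfolding algebraic_def by blast
    have "coeff (map_poly e h) i \<in> \<int>" for i
      using h(1)[of i] by (auto simp: coeff_map_poly hom_simps[OF e] elim!: Ints_cases)
    moreover have "poly (map_poly e h) (e x) = 0" using h(3) hom_poly[OF e, of h x] by (simp add: hom_simps[OF e])
    ultimately show ?thesis unfolding algebraic_def using h(2) hom_map_poly(5)[OF e] by blast
  qed
  moreover have "y \<in> range e" if "algebraic y" for y
  proof -
    obtain h where h: "\<And>i. coeff h i \<in> \<int>" "h \<noteq> 0" "poly h y = 0"
      using \<open>algebraic y\<close> unfolding algebraic_def by blast
    \<comment> \<open>The coefficients of \<open>h\<close> are integers inside
      \<open>complex\<close>; \<open>floor (Re c)\<close> reads them off, so that \<open>h'\<close>
      is the same polynomial over \<open>qbar\<close>.\<close>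
    define h' where "h' = map_poly (\<lambda>c. of_int (floor (Re c)) :: qbar) h"
    have "e (of_int \<lfloor>Re c\<rfloor>) = c" if "c \<in> \<int>" for c
      using that by (auto simp: hom_simps[OF e] elim!: Ints_cases)
    then have hh: "map_poly e h' = h"
      by (intro poly_eqI) (simp add: h'_def coeff_map_poly hom_simps[OF e] h(1) del: hom_simps)
    then have "h' \<noteq> 0" using h(2) by auto
    then show ?thesis using hom_root_in_range[OF e, of h' y] hh h(3) by auto
  qed
  ultimately show ?thesis using that[OF e] by blast
qed

text \<open>Pulled back from \<open>cis (2 * pi / real n)\<close> along an embedding into the
  complex numbers.\<close>

lemma primitive_root_exists:
  assumes "n > 0"
  obtains \<zeta> :: qbar where "\<And>k. \<zeta> ^ k = 1 \<longleftrightarrow> n dvd k" "\<And>z. z ^ n = 1 \<Longrightarrow> \<exists>k. z = \<zeta> ^ k"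
proof -
  obtain e :: "qbar \<Rightarrow> complex" where e: "fhom e" "range e = {x. algebraic x}"
    using qbar_embedding by metis
  define c where "c = cis (2 * pi / real n)"
  have cn: "c ^ k = cis (2 * pi * real k / real n)" for k by (simp add: c_def DeMoivre mult_ac)
  have bij: "bij_betw (\<lambda>k. c ^ k) {..<n} {z. z ^ n = 1}"
    unfolding cn by (rule bij_betw_roots_unity[OF assms])
  have "c \<in> {z. z ^ n = 1}"
    unfolding c_def using assms by (simp add: DeMoivre)
  have "c ^ k = c ^ (k mod n)" for k
  proof -
    have "c ^ k = (c ^ n) ^ (k div n) * c ^ (k mod n)" by (simp flip: power_mult power_add)
    then show ?thesis using \<open>c \<in> _\<close> by simp
  qed
  moreover have "c ^ (k mod n) = c ^ 0 \<longleftrightarrow> k mod n = 0" for k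
    using bij assms by (intro inj_on_eq_iff[of _ "{..<n}"]) (auto simp: bij_betw_def)
  ultimately have c1: "c ^ k = 1 \<longleftrightarrow> n dvd k" for k
    by (metis mod_eq_0_iff_dvd power_0)
  have "algebraic c" using c1[of n] assms
    by (intro algebraicI[of "monom 1 n - 1"]) (auto simp: poly_monom coeff_1 monom_eq_1_iff)
  then obtain \<zeta> where z: "e \<zeta> = c" using e(2) by (metis CollectI imageE)
  have pw: "e (\<zeta> ^ k) = c ^ k" for k by (simp add: hom_simps[OF e(1)] z)
  show ?thesis
  proof (rule that[of \<zeta>])
    show "\<zeta> ^ k = 1 \<longleftrightarrow> n dvd k" for k
      using pw[of k] c1[of k] hom_simps(1,11)[OF e(1)] by metis
    fix y :: qbar assume "y ^ n = 1"
    then have "(e y) ^ n = 1" by (metis hom_simps(1,9)[OF e(1)])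
    then obtain k where "e y = c ^ k" using bij by (auto simp: bij_betw_def)
    then show "\<exists>k. y = \<zeta> ^ k" using pw[of k] hom_simps(11)[OF e(1)] by metis
  qed
qed

section \<open>Residues and roots of unity\<close>

locale padic_qbar =
  fixes p :: nat and w :: "qbar \<Rightarrow> rat"
  assumes p: "prime p" and odd_p: "odd p"
    and w_mult: "x \<noteq> 0 \<Longrightarrow> y \<noteq> 0 \<Longrightarrow> w (x * y) = w x + w y"
    and w_add: "x \<noteq> 0 \<Longrightarrow> y \<noteq> 0 \<Longrightarrow> x + y \<noteq> 0 \<Longrightarrow> min (w x) (w y) \<le> w (x + y)"
    and w_rat: "q \<noteq> 0 \<Longrightarrow> w (of_rat q) = padic_valuation p q"
begin

text \<open>These comparisons treat the value of 0 as infinite. The abbreviation \<open>cg\<close>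
  is congruence modulo the maximal ideal, through which residues are handled without forming the
  residue field.\<close>

definition vge :: "qbar \<Rightarrow> rat \<Rightarrow> bool" where "vge x r \<longleftrightarrow> x = 0 \<or> r \<le> w x"
definition vgt :: "qbar \<Rightarrow> rat \<Rightarrow> bool" where "vgt x r \<longleftrightarrow> x = 0 \<or> r < w x"
abbreviation cg :: "qbar \<Rightarrow> qbar \<Rightarrow> bool" where "cg x y \<equiv> vgt (x - y) 0"

lemma p_pos: "p > 0" "p > 1" using p prime_gt_0_nat prime_gt_1_nat by blast+

lemma w_1 [simp]: "w 1 = 0" using w_mult[of 1 1] by simp

lemma w_minus [simp]: "w (- x) = w x"
proof (cases "x = 0")
  case False
  have "w (-1) = 0" using w_mult[of "-1" "-1"] by simp
  then show ?thesis using w_mult[of "-1" x] False by simp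
qed simp

lemma w_inverse: "x \<noteq> 0 \<Longrightarrow> w (inverse x) = - w x"
  using w_mult[of x "inverse x"] by simp

lemma w_divide: "x \<noteq> 0 \<Longrightarrow> y \<noteq> 0 \<Longrightarrow> w (x / y) = w x - w y"
  using w_mult[of x "inverse y"] w_inverse[of y] by (simp add: divide_inverse)

lemma w_power: "x \<noteq> 0 \<Longrightarrow> w (x ^ n) = of_nat n * w x"
  by (induction n) (auto simp: w_mult algebra_simps)

lemma w_prod: "finite S \<Longrightarrow> (\<And>i. i \<in> S \<Longrightarrow> f i \<noteq> 0) \<Longrightarrow> w (prod f S) = (\<Sum>i\<in>S. w (f i))"
  by (induction S rule: finite_induct) (auto simp: w_mult)

lemma w_int: "k \<noteq> 0 \<Longrightarrow> w (of_int k) = of_nat (multiplicity (int p) k)"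
  using w_rat[of "of_int k"] by (simp add: padic_valuation_def)

lemma w_int_unit: "\<not> int p dvd k \<Longrightarrow> w (of_int k) = 0"
  using w_int[of k] by (cases "k = 0") (auto simp: not_dvd_imp_multiplicity_0)

lemma w_nat_unit: "\<not> p dvd k \<Longrightarrow> w (of_nat k) = 0"
  using w_int_unit[of "int k"] by simp

lemma w_p: "w (of_nat p) = 1"
  using w_int[of "int p"] p by (simp add: prime_gt_0_nat)

lemma vge_0 [simp]: "vge 0 r" and vgt_0 [simp]: "vgt 0 r" by (simp_all add: vge_def vgt_def)
lemma vge_1 [simp]: "vge 1 0" by (simp add: vge_def)
lemma not_vgt_1 [simp]: "\<not> vgt 1 0" by (simp add: vgt_def)

lemma vge_add: "vge x r \<Longrightarrow> vge y r \<Longrightarrow> vge (x + y) r"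
  using w_add[of x y] by (cases "x = 0"; cases "y = 0"; cases "x + y = 0") (auto simp: vge_def min_def split: if_splits)

lemma vgt_add: "vgt x r \<Longrightarrow> vgt y r \<Longrightarrow> vgt (x + y) r"
  using w_add[of x y] by (cases "x = 0"; cases "y = 0"; cases "x + y = 0") (auto simp: vgt_def min_def split: if_splits)

lemma vge_minus [simp]: "vge (- x) r = vge x r" and vgt_minus [simp]: "vgt (- x) r = vgt x r"
  by (simp_all add: vge_def vgt_def)

lemma vge_diff: "vge x r \<Longrightarrow> vge y r \<Longrightarrow> vge (x - y) r"
  using vge_add[of x r "- y"] by simp

lemma vgt_diff: "vgt x r \<Longrightarrow> vgt y r \<Longrightarrow> vgt (x - y) r"
  using vgt_add[of x r "- y"] by simp

lemma vge_mult: "vge x r \<Longrightarrow> vge y s \<Longrightarrow> vge (x * y) (r + s)"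
  by (cases "x = 0"; cases "y = 0") (auto simp: vge_def w_mult)

lemma vge_mult0: "vge x 0 \<Longrightarrow> vge y 0 \<Longrightarrow> vge (x * y) 0"
  using vge_mult[of x 0 y 0] by simp

lemma vgt_mult: "vge x r \<Longrightarrow> vgt y s \<Longrightarrow> vgt (x * y) (r + s)" "vgt y s \<Longrightarrow> vge x r \<Longrightarrow> vgt (y * x) (r + s)"
  by (cases "x = 0"; cases "y = 0"; auto simp: vge_def vgt_def w_mult)+

lemma vgt_mult0: "vge x 0 \<Longrightarrow> vgt y r \<Longrightarrow> vgt (x * y) r" "vgt y r \<Longrightarrow> vge x 0 \<Longrightarrow> vgt (y * x) r"
  using vgt_mult[of x 0 y r] by (simp_all add: mult.commute)

lemma vge_sum: "(\<And>i. i \<in> S \<Longrightarrow> vge (f i) r) \<Longrightarrow> vge (sum f S) r"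
  by (induction S rule: infinite_finite_induct) (auto intro: vge_add)

lemma vgt_sum: "(\<And>i. i \<in> S \<Longrightarrow> vgt (f i) r) \<Longrightarrow> vgt (sum f S) r"
  by (induction S rule: infinite_finite_induct) (auto intro: vgt_add)

lemma vge_power: "vge x 0 \<Longrightarrow> vge (x ^ n) 0"
  by (induction n) (auto intro: vge_mult0)

lemma vge_of_int [simp]: "vge (of_int k) 0"
  by (cases "k = 0") (auto simp: vge_def w_int)

lemma vge_of_nat [simp]: "vge (of_nat k) 0"
  using vge_of_int[of "int k"] by simp

lemma vge_p_mult: "int p dvd k \<Longrightarrow> vgt (of_int k) 0"
proof (elim dvdE)
  fix m assume "k = int p * m"
  moreover have "vgt (of_nat p) 0" by (simp add: vgt_def w_p)
  ultimately show ?thesis by (simp add: vgt_mult0)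
qed

lemma vgt_imp_vge: "vgt x r \<Longrightarrow> vge x r" by (auto simp: vgt_def vge_def)

lemma vgt_mono: "vgt x r \<Longrightarrow> s \<le> r \<Longrightarrow> vgt x s" by (auto simp: vgt_def)

lemma vge_imp_vgt: "vge x r \<Longrightarrow> s < r \<Longrightarrow> vgt x s" by (auto simp: vgt_def vge_def)

lemma w_dominant:
  assumes "x \<noteq> 0" "vgt y (w x)"
  shows "x + y \<noteq> 0" "w (x + y) = w x"
proof -
  show nz: "x + y \<noteq> 0"
  proof
    assume "x + y = 0"
    then have "y = - x" by (simp add: eq_neg_iff_add_eq_0 add.commute)
    then show False using assms by (simp add: vgt_def)
  qed
  have "w x \<le> w (x + y)" using w_add[of x y] assms nz by (cases "y = 0") (auto simp: vgt_def)
  moreover have "w (x + y) \<le> w x"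
  proof (rule ccontr)
    assume "\<not> ?thesis"
    then have "vgt (x + y) (w x)" by (simp add: vgt_def)
    from vgt_diff[OF this assms(2)] show False using assms(1) by (simp add: vgt_def)
  qed
  ultimately show "w (x + y) = w x" by simp
qed

lemma cg_sym: "cg x y \<Longrightarrow> cg y x" using vgt_minus[of "x - y" 0] by simp

lemma cg_trans: "cg x y \<Longrightarrow> cg y z \<Longrightarrow> cg x z" using vgt_add[of "x - y" 0 "y - z"] by simp

lemma cg_add: "cg x y \<Longrightarrow> cg x' y' \<Longrightarrow> cg (x + x') (y + y')"
  using vgt_add[of "x - y" 0 "x' - y'"] by (simp add: algebra_simps)

lemma cg_vge: "cg x y \<Longrightarrow> vge x 0 \<Longrightarrow> vge y 0"
  using vge_diff[of x 0 "x - y"] vgt_imp_vge by simp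

lemma cg_mult: "cg x y \<Longrightarrow> cg x' y' \<Longrightarrow> vge x 0 \<Longrightarrow> vge y' 0 \<Longrightarrow> cg (x * x') (y * y')"
  using vgt_add[OF vgt_mult0(1)[of x "x' - y'" 0] vgt_mult0(2)[of "x - y" 0 y']] by (simp add: algebra_simps)

lemma cg_power: "cg x y \<Longrightarrow> vge x 0 \<Longrightarrow> cg (x ^ n) (y ^ n)"
  by (induction n) (auto intro!: cg_mult vge_power dest: cg_vge)

lemma cg_cancel: "cg (u * x) (u * y) \<Longrightarrow> u \<noteq> 0 \<Longrightarrow> w u = 0 \<Longrightarrow> cg x y"
  using vgt_mult0(1)[of "inverse u" "u * x - u * y" 0]
  by (simp add: vge_def w_inverse flip: right_diff_distrib mult.assoc)

section \<open>Polynomials modulo the maximal ideal\<close>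

lemma poly_vge: "(\<And>i. vge (coeff h i) 0) \<Longrightarrow> vge x 0 \<Longrightarrow> vge (poly h x) 0"
  by (auto simp: poly_altdef intro!: vge_sum vge_mult0 vge_power)

lemma vge_synthetic_div:
  "(\<And>i. vge (coeff h i) 0) \<Longrightarrow> vge c 0 \<Longrightarrow> vge (coeff (synthetic_div h c) i) 0"
proof (induction h arbitrary: i)
  case (pCons a h)
  have h: "vge (coeff h i) 0" for i using pCons.prems(1)[of "Suc i"] by simp
  then show ?case using pCons.IH pCons.prems(2) poly_vge[OF h pCons.prems(2)]
    by (auto simp: coeff_pCons split: nat.splits)
qed simp

text \<open>Divide off one residual root \<open>a\<close>: for the other roots \<open>s\<close>,
  incongruent to \<open>a\<close>, the difference \<open>s - a\<close> is a unit, so the quotient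
  inherits them. This is the bound on the number of roots over the residue field.\<close>

lemma root_bound:
  assumes "finite S" "degree h < card S" "\<And>i. vge (coeff h i) 0" "\<And>s. s \<in> S \<Longrightarrow> vge s 0"
    and "\<And>s t. s \<in> S \<Longrightarrow> t \<in> S \<Longrightarrow> cg s t \<Longrightarrow> s = t" "\<And>s. s \<in> S \<Longrightarrow> vgt (poly h s) 0"
  shows "vgt (coeff h i) 0"
  using assms
proof (induction "degree h" arbitrary: h S i)
  case 0
  then obtain s where "s \<in> S" by fastforce
  moreover obtain c where "h = [:c:]" using 0(1) by (metis degree_eq_zeroE)
  ultimately show ?case using 0(7)[of s] by (simp add: coeff_pCons split: nat.splits)
next
  case (Suc n)
  then obtain a where a: "a \<in> S" by fastforce
  define q where "q = synthetic_div h a"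
  have h: "h = [:-a, 1:] * q + [:poly h a:]" unfolding q_def by (rule synthetic_div_correct'[symmetric])
  have vq: "vgt (coeff q i) 0" for i
  proof (rule Suc(1)[of q "S - {a}"])
    show "n = degree q" unfolding q_def degree_synthetic_div using Suc(2) by simp
    then show "degree q < card (S - {a})" using Suc(2-4) a by simp
    show "vge (coeff q i) 0" for i unfolding q_def using Suc a by (intro vge_synthetic_div) auto
    fix s assume s: "s \<in> S - {a}"
    have "vgt (poly h s - poly h a) 0" using Suc(8) a s by (intro vgt_diff) auto
    moreover have "poly h s = (s - a) * poly q s + poly h a" by (subst h) (simp add: algebra_simps)
    ultimately have "vgt ((s - a) * poly q s) 0" by simp
    moreover have "s - a \<noteq> 0" "w (s - a) = 0"
    proof -
      have "\<not> cg s a" using Suc(7)[of s a] s a by blast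
      moreover have "vge (s - a) 0" using s a by (intro vge_diff Suc(6)) auto
      ultimately show "s - a \<noteq> 0" "w (s - a) = 0" by (auto simp: vgt_def vge_def)
    qed
    ultimately show "vgt (poly q s) 0" by (cases "poly q s = 0") (auto simp: vgt_def w_mult)
  qed (use Suc in auto)
  have "vgt (coeff ([:-a, 1:] * q) i) 0"
    using vq Suc(6)[OF a] by (cases i) (auto intro!: vgt_diff vgt_mult0(1))
  moreover have "vgt (coeff [:poly h a:] i) 0" using Suc(8)[OF a] by (simp add: coeff_pCons split: nat.splits)
  ultimately show ?case by (subst h) (simp only: coeff_add vgt_add)
qed

lemma frobenius_add:
  assumes "vge x 0" "vge y 0"
  shows "cg ((x + y) ^ p) (x ^ p + y ^ p)"
proof -
  let ?t = "\<lambda>k. of_nat (p choose k) * x ^ k * y ^ (p - k)"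
  have "(x + y) ^ p = (\<Sum>k\<le>p. ?t k)" by (rule binomial_ring)
  also have "{..p} = insert 0 (insert p {0<..<p})" by auto
  also have "sum ?t \<dots> = y ^ p + (x ^ p + sum ?t {0<..<p})" using p_pos by (subst sum.insert) auto
  finally have "(x + y) ^ p - (x ^ p + y ^ p) = sum ?t {0<..<p}" by simp
  also have "vgt \<dots> 0"
  proof (rule vgt_sum)
    fix k assume "k \<in> {0<..<p}"
    then have "p dvd p choose k" using p by (intro dvd_choose_prime) auto
    then have "vgt (of_nat (p choose k)) 0" using vge_p_mult[of "int (p choose k)"] by simp
    then show "vgt (?t k) 0" using assms by (intro vgt_mult0(2) vge_power)
  qed
  finally show ?thesis .
qed

lemma fermat_int: "cg (of_int k ^ p) (of_int k)"
proof -
  have n: "cg (of_nat n ^ p) (of_nat n)" for n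
  proof (induction n)
    case (Suc n)
    have "cg ((of_nat n + 1) ^ p) (of_nat n ^ p + 1 ^ p)" by (rule frobenius_add) auto
    also have "cg (of_nat n ^ p + 1 ^ p) (of_nat n + 1)" using Suc by simp
    finally (cg_trans) show ?case by (simp add: add.commute)
  qed (use p_pos in \<open>simp add: zero_power\<close>)
  show ?thesis
  proof (cases k rule: int_cases2)
    case (nonneg n)
    then show ?thesis using n by simp
  next
    case (nonpos n)
    then show ?thesis using cg_sym[OF n[of n]] odd_p by (simp add: power_minus_odd)
  qed
qed

text \<open>Coefficients with residues in the prime field are fixed by Frobenius, so Frobenius maps
  residual roots of \<open>h\<close> to residual roots.\<close>

lemma frobenius_poly:
  assumes "\<And>i. vge (coeff h i) 0" "\<And>i. cg (coeff h i ^ p) (coeff h i)" "vge x 0"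
  shows "cg (poly h x ^ p) (poly h (x ^ p))"
  using assms
proof (induction h)
  case (pCons a h)
  have a: "vge a 0" "cg (a ^ p) a" and h: "\<And>i. vge (coeff h i) 0" "\<And>i. cg (coeff h i ^ p) (coeff h i)"
    using pCons.prems(1)[of 0] pCons.prems(2)[of 0] pCons.prems(1)[of "Suc _"] pCons.prems(2)[of "Suc _"] by auto
  have hx: "vge (poly h x) 0" using poly_vge h pCons.prems by blast
  have "cg ((a + x * poly h x) ^ p) (a ^ p + (x * poly h x) ^ p)"
    using a hx pCons.prems by (intro frobenius_add vge_mult0)
  also have "cg (a ^ p + (x * poly h x) ^ p) (a + x ^ p * poly h (x ^ p))"
    unfolding power_mult_distrib using a hx h pCons
    by (intro cg_add cg_mult vge_power poly_vge) auto
  finally (cg_trans) show ?case by simp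
qed (use p_pos in simp)

text \<open>In residue characteristic \<open>p\<close>, \<open>v ^ p - 1\<close> is congruent to
  \<open>(v - 1) ^ p\<close>; oddness of \<open>p\<close> gives the sign.\<close>

lemma cg_1_of_power_p: "vge u 0 \<Longrightarrow> cg (u ^ p ^ k) 1 \<Longrightarrow> cg u 1"
proof (induction k)
  case (Suc k)
  define v where "v = u ^ p ^ k"
  have v: "vge v 0" using Suc unfolding v_def by (intro vge_power)
  have "cg ((v + (-1)) ^ p) (v ^ p + (-1) ^ p)" using v by (intro frobenius_add) auto
  moreover have "v ^ p + (-1) ^ p = u ^ p ^ Suc k - 1"
    using odd_p by (simp add: v_def power_minus_odd mult.commute flip: power_mult)
  ultimately have "vgt ((v - 1) ^ p) 0" using vgt_add[OF _ Suc.prems(2)] by fastforce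
  then have "vgt (v - 1) 0" using p_pos by (cases "v = 1") (auto simp: vgt_def w_power zero_less_mult_iff)
  then show ?case using Suc v_def by auto
qed simp

text \<open>These are the Teichmueller representatives: each unit is congruent to exactly one of
  them (\<open>unit_cg_mu\<close>, \<open>mu_inj\<close>).\<close>

definition mu :: "qbar set" where "mu = {z. \<exists>n>0. \<not> p dvd n \<and> z ^ n = 1}"

lemma root_of_unity_unit: "z ^ n = 1 \<Longrightarrow> n > 0 \<Longrightarrow> z \<noteq> 0 \<and> w z = 0"
  using w_power[of z n] by (cases "z = 0") (auto simp: zero_power)

lemma mu_unit: "z \<in> mu \<Longrightarrow> z \<noteq> 0" "z \<in> mu \<Longrightarrow> w z = 0"
  using root_of_unity_unit by (auto simp: mu_def)

lemma mu_1: "1 \<in> mu" using p_pos by (auto simp: mu_def intro!: exI[of _ 1])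

lemma mu_mult: "x \<in> mu \<Longrightarrow> y \<in> mu \<Longrightarrow> x * y \<in> mu"
proof -
  assume "x \<in> mu" "y \<in> mu"
  then obtain n m where "n > 0" "\<not> p dvd n" "x ^ n = 1" "m > 0" "\<not> p dvd m" "y ^ m = 1"
    by (auto simp: mu_def)
  moreover have "(x * y) ^ (n * m) = (x ^ n) ^ m * (y ^ m) ^ n"
    by (simp add: power_mult_distrib mult.commute flip: power_mult)
  ultimately show ?thesis using p unfolding mu_def
    by (intro CollectI exI[of _ "n * m"]) (auto simp: prime_dvd_mult_iff)
qed

lemma mu_inverse: "x \<in> mu \<Longrightarrow> inverse x \<in> mu"
  by (auto simp: mu_def power_inverse)

lemma mu_power: "x \<in> mu \<Longrightarrow> x ^ k \<in> mu"
  by (induction k) (auto simp: mu_1 mu_mult)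

text \<open>For \<open>u \<noteq> 1\<close> the geometric sum of the powers of \<open>u\<close>
  vanishes, whereas \<open>u\<close> congruent to 1 makes it congruent to \<open>n\<close>, a
  unit.\<close>

lemma mu_cg_1: "u \<in> mu \<Longrightarrow> cg u 1 \<Longrightarrow> u = 1"
proof (rule ccontr)
  assume u: "u \<in> mu" "cg u 1" "u \<noteq> 1"
  then obtain n where n: "n > 0" "\<not> p dvd n" "u ^ n = 1" by (auto simp: mu_def)
  have "(u - 1) * (\<Sum>i<n. u ^ i) = 0" using n(3) by (simp add: power_diff_1_eq[symmetric])
  then have "(\<Sum>i<n. u ^ i) = 0" using u(3) by simp
  moreover have "vgt (\<Sum>i<n. u ^ i - 1) 0"
  proof (intro vgt_sum)
    show "cg (u ^ i) 1" for i using cg_power[OF u(2), of i] mu_unit[OF u(1)] by (simp add: vge_def)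
  qed
  ultimately have "vgt (of_nat n) 0" by (simp add: sum_subtractf)
  then show False using n w_nat_unit[of n] by (simp add: vgt_def)
qed

lemma mu_inj: "u \<in> mu \<Longrightarrow> v \<in> mu \<Longrightarrow> cg u v \<Longrightarrow> u = v"
proof -
  assume uv: "u \<in> mu" "v \<in> mu" "cg u v"
  have "cg (v * (u / v)) (v * 1)" using uv mu_unit(1)[of v] by simp
  then have "cg (u / v) 1" using cg_cancel[of v "u / v" 1] mu_unit[OF uv(2)] by blast
  then have "u / v = 1" using mu_cg_1 mu_mult[OF uv(1) mu_inverse[OF uv(2)]] by (simp add: divide_inverse)
  then show ?thesis using mu_unit(1)[OF uv(2)] by simp
qed

text \<open>The residue of \<open>x\<close> is a root of a nonzero polynomial over
  \<open>F_p\<close>, hence so are its Frobenius iterates. By the root bound two of these coincide,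
  which gives a finite residual order.\<close>

lemma residue_finite_order:
  assumes x: "x \<noteq> 0" "w x = 0"
  shows "\<exists>n>0. \<not> p dvd n \<and> cg (x ^ n) 1"
proof -
  obtain h0 where h0: "\<And>i. coeff h0 i \<in> \<int>" "h0 \<noteq> 0" "poly h0 x = 0"
    using algebraic_qbar[of x] unfolding algebraic_def by blast
  define f where "f c = (THE k. c = (of_int k :: qbar))" for c
  have f: "f (of_int k) = k" for k by (simp add: f_def)
  define h1 where "h1 = map_poly f h0"
  have h1: "map_poly of_int h1 = h0"
  proof (rule poly_eqI)
    fix i
    obtain k where "coeff h0 i = of_int k" using h0(1)[of i] by (auto elim: Ints_cases)
    then show "coeff (map_poly of_int h1) i = coeff h0 i"
      using f[of 0] by (simp add: h1_def coeff_map_poly f)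
  qed
  then have "h1 \<noteq> 0" using h0(2) by auto
  \<comment> \<open>A primitive integer polynomial has a coefficient prime to \<open>p\<close>, so
    it stays nonzero modulo \<open>p\<close>.\<close>
  define h where "h = primitive_part h1"
  have hh: "h1 = smult (content h1) h" by (simp add: h_def)
  have c: "content h1 \<noteq> 0" "content h = 1" using \<open>h1 \<noteq> 0\<close> by (auto simp: h_def content_primitive_part)
  define g :: "qbar poly" where "g = map_poly of_int h"
  have g: "coeff g i = of_int (coeff h i)" for i by (simp add: g_def coeff_map_poly)
  have "h0 = smult (of_int (content h1)) g"
    by (subst h1[symmetric], subst hh, rule poly_eqI) (simp add: coeff_map_poly g)
  then have gx: "poly g x = 0" using h0(3) c by simp
  have "\<exists>i. \<not> int p dvd coeff h i"
  proof (rule ccontr)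
    assume "\<not> ?thesis"
    then have "int p dvd content h" by (auto simp: const_poly_dvd_iff simp flip: const_poly_dvd_iff_dvd_content)
    then show False using c(2) p_pos by simp
  qed
  then obtain i where i: "\<not> int p dvd coeff h i" by blast
  then have gi: "\<not> vgt (coeff g i) 0" using w_int_unit[of "coeff h i"] by (auto simp: g vgt_def)
  have xk: "x ^ k \<noteq> 0" "w (x ^ k) = 0" for k using x by (auto simp: w_power)
  have root: "vgt (poly g (x ^ p ^ k)) 0" for k
  proof (induction k)
    case (Suc k)
    have "cg (poly g (x ^ p ^ k) ^ p) (poly g ((x ^ p ^ k) ^ p))"
    proof (rule frobenius_poly)
      show "vge (x ^ p ^ k) 0" by (simp add: vge_def xk)
    qed (simp_all add: g fermat_int)
    moreover have "vgt (poly g (x ^ p ^ k) ^ p) 0"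
      using Suc p_pos by (cases "poly g (x ^ p ^ k) = 0") (auto simp: vgt_def w_power)
    ultimately have "vgt (poly g ((x ^ p ^ k) ^ p)) 0" using vgt_diff by fastforce
    then show ?case by (simp add: mult.commute flip: power_mult)
  qed (use gx in simp)
  have "\<exists>a b. a < b \<and> cg (x ^ p ^ a) (x ^ p ^ b)"
  proof (rule ccontr)
    assume neg: "\<not> ?thesis"
    have inj: "a = b" if "cg (x ^ p ^ a) (x ^ p ^ b)" for a b
      using neg that cg_sym[OF that] by (meson linorder_neqE_nat)
    then have "inj_on (\<lambda>k. x ^ p ^ k) {..degree g}" by (auto simp: inj_on_def)
    then have "card ((\<lambda>k. x ^ p ^ k) ` {..degree g}) = Suc (degree g)" by (simp add: card_image)
    moreover have "vge (coeff g j) 0" for j by (simp add: g)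
    moreover have "vge (x ^ p ^ k) 0" for k by (simp add: vge_def xk)
    ultimately have "vgt (coeff g i) 0"
      by (intro root_bound[of "(\<lambda>k. x ^ p ^ k) ` {..degree g}"]) (use inj root in auto)
    then show False using gi by blast
  qed
  then obtain a b where ab: "a < b" "cg (x ^ p ^ a) (x ^ p ^ b)" by blast
  define n where "n = p ^ (b - a) - 1"
  have pb: "p ^ (b - a) > 1" using ab(1) p_pos by (intro one_less_power) auto
  then have n: "n > 0" "Suc n = p ^ (b - a)" by (auto simp: n_def)
  have "\<not> p dvd n"
  proof
    assume "p dvd n"
    moreover have "p dvd Suc n" unfolding n using ab(1) by simp
    ultimately have "p dvd 1" by (metis dvd_add_right_iff plus_1_eq_Suc add.commute)
    then show False using p_pos by simp
  qed
  moreover have "cg (x ^ n) 1"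
  proof (rule cg_1_of_power_p[of _ a])
    have "p ^ b = p ^ a * Suc n" unfolding n using ab(1) by (simp flip: power_add)
    then have "x ^ p ^ b = x ^ p ^ a * (x ^ n) ^ p ^ a" by (simp add: power_add power_mult[symmetric] mult.commute)
    then have "cg (x ^ p ^ a * (x ^ n) ^ p ^ a) (x ^ p ^ a * 1)" using cg_sym[OF ab(2)] by simp
    then show "cg ((x ^ n) ^ p ^ a) 1" by (rule cg_cancel) (use xk in auto)
  qed (simp add: vge_def xk)
  ultimately show ?thesis using n(1) by blast
qed

text \<open>The product of \<open>x - a\<close> over the \<open>n\<close>-th roots of unity
  \<open>a\<close> is \<open>x ^ n - 1\<close>, which lies in the maximal ideal for a suitable
  \<open>n\<close> prime to \<open>p\<close>; so one factor lies there.\<close>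

lemma unit_cg_mu:
  assumes x: "x \<noteq> 0" "w x = 0"
  shows "\<exists>z\<in>mu. cg x z"
proof -
  obtain n where n: "n > 0" "\<not> p dvd n" "cg (x ^ n) 1" using residue_finite_order[OF x] by blast
  define h :: "qbar poly" where "h = monom 1 n + [:-1:]"
  have dh: "degree h = n" using n(1) unfolding h_def
    by (subst degree_add_eq_left) (simp_all add: degree_monom_eq)
  have lc: "lead_coeff h = 1" unfolding dh using n(1)
    by (simp add: h_def coeff_pCons split: nat.splits)
  then have "h \<noteq> 0" by auto
  then obtain A where "h = smult (lead_coeff h) (\<Prod>a\<in>#A. [:-a, 1:])" by (rule splits)
  then have A: "h = (\<Prod>a\<in>#A. [:-a, 1:])" using lc by simp
  have hp: "poly h y = y ^ n - 1" for y by (simp add: h_def poly_monom)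
  have Amu: "a \<in> mu" if "a \<in># A" for a
  proof -
    have "poly h a = 0" using that by (subst A) (auto simp: poly_prod_mset_linear prod_mset_zero_iff)
    then show ?thesis using n hp by (auto simp: mu_def)
  qed
  have "\<exists>a\<in>#A. vgt (x - a) 0" if "vgt (\<Prod>a\<in>#A. x - a) 0" "\<And>a. a \<in># A \<Longrightarrow> a \<in> mu" for A
    using that
  proof (induction A)
    case (add a A)
    show ?case
    proof (cases "cg x a")
      case False
      moreover have "vge (x - a) 0" using x mu_unit[of a] add.prems(2)[of a] by (intro vge_diff) (auto simp: vge_def)
      ultimately have "x - a \<noteq> 0" "w (x - a) = 0" by (auto simp: vgt_def vge_def)
      then have "vgt (\<Prod>a\<in>#A. x - a) 0" using add.prems(1) by (cases "(\<Prod>a\<in>#A. x - a) = 0") (auto simp: vgt_def w_mult)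
      then show ?thesis using add by auto
    qed auto
  qed simp
  moreover have "vgt (\<Prod>a\<in>#A. x - a) 0"
    using n(3) hp[of x] by (subst (asm) A) (simp add: poly_prod_mset_linear)
  ultimately show ?thesis using Amu by blast
qed

text \<open>Otherwise \<open>x\<close> and the integers \<open>0..p-1\<close> would be
  \<open>p + 1\<close> incongruent residual roots of the monic polynomial
  \<open>X ^ p - X\<close>.\<close>

lemma residue_prime_field:
  assumes x: "vge x 0" "cg (x ^ p) x"
  shows "\<exists>k::nat. k < p \<and> cg x (of_nat k)"
proof (rule ccontr)
  assume neg: "\<not> ?thesis"
  define h :: "qbar poly" where "h = monom 1 p + [:0, -1:]"
  have hp: "poly h y = y ^ p - y" for y by (simp add: h_def poly_monom)
  define S where "S = insert x (of_nat ` {..<p})"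
  have ij: "a = b" if "a < p" "b < p" "cg (of_nat a) (of_nat b)" for a b :: nat
  proof -
    have "int p dvd int a - int b"
    proof (rule ccontr)
      assume c: "\<not> int p dvd int a - int b"
      then have "w (of_int (int a - int b)) = 0" by (rule w_int_unit)
      then show False using that c by (auto simp: vgt_def)
    qed
    then have "int a - int b = 0 \<or> int p \<le> \<bar>int a - int b\<bar>"
      using dvd_imp_le_int[of "int a - int b" "int p"] by auto
    then show ?thesis using that by linarith
  qed
  have "x \<notin> of_nat ` {..<p}" using neg by auto
  moreover have "inj_on (of_nat :: nat \<Rightarrow> qbar) {..<p}" by (simp add: inj_on_def)
  ultimately have cS: "card S = Suc p" "finite S" by (auto simp: S_def card_image)
  have dh: "degree h = p" using p_pos unfolding h_def
    by (subst degree_add_eq_left) (simp_all add: degree_monom_eq)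
  have "vgt (coeff h p) 0"
  proof (rule root_bound[of S])
    show "degree h < card S" using dh cS by simp
    show "vge (coeff h i) 0" for i by (auto simp: h_def coeff_pCons intro!: vge_add split: nat.splits)
    show "vge s 0" if "s \<in> S" for s using that x by (auto simp: S_def)
    show "s = t" if st: "s \<in> S" "t \<in> S" "cg s t" for s t
    proof -
      consider "s = x" "t = x" | b where "s = x" "b < p" "t = of_nat b" | a where "a < p" "s = of_nat a" "t = x"
        | a b where "a < p" "s = of_nat a" "b < p" "t = of_nat b"
        using st(1,2) unfolding S_def by blast
      then show ?thesis
      proof cases
        case 2
        then show ?thesis using neg st(3) by blast
      next
        case 3
        then show ?thesis using neg cg_sym[OF st(3)] by blast
      next
        case 4
        then show ?thesis using ij st(3) by blast
      qed simp
    qed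
    show "vgt (poly h s) 0" if s: "s \<in> S" for s
    proof (cases "s = x")
      case False
      then obtain a where "s = of_nat a" using s by (auto simp: S_def)
      then show ?thesis using fermat_int[of "int a"] by (simp add: hp)
    qed (use x in \<open>simp add: hp\<close>)
  qed (use cS in auto)
  moreover have "coeff h p = 1" using p_pos by (simp add: h_def coeff_pCons split: nat.splits)
  ultimately show False by simp
qed

end

section \<open>Galois groups\<close>

abbreviation finv :: "('a \<Rightarrow> 'b) \<Rightarrow> 'b \<Rightarrow> 'a" where
  "finv \<equiv> inv_into UNIV"

definition aut :: "qbar set \<Rightarrow> (qbar \<Rightarrow> qbar) set" where
  "aut L = {\<sigma>. fhom \<sigma> \<and> (\<forall>x\<in>L. \<sigma> x = x)}"

definition aut_group :: "(qbar \<Rightarrow> qbar) set \<Rightarrow> bool" where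
  "aut_group H \<longleftrightarrow> id \<in> H \<and> (\<forall>\<sigma>\<in>H. fhom \<sigma> \<and> finv \<sigma> \<in> H) \<and> (\<forall>\<sigma>\<in>H. \<forall>\<tau>\<in>H. \<sigma> \<circ> \<tau> \<in> H)"

definition fixed :: "(qbar \<Rightarrow> qbar) set \<Rightarrow> qbar set" where
  "fixed H = {x. \<forall>\<sigma>\<in>H. \<sigma> x = x}"

definition orbit :: "(qbar \<Rightarrow> qbar) set \<Rightarrow> qbar \<Rightarrow> qbar set" where
  "orbit H x = (\<lambda>\<sigma>. \<sigma> x) ` H"

lemma fhom_root:
  assumes "fhom \<sigma>" "\<And>i. coeff h i \<in> \<int>"
  shows "map_poly \<sigma> h = h"
proof (rule poly_eqI)
  fix i
  obtain k where "coeff h i = of_int k" using assms(2)[of i] by (auto elim: Ints_cases)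
  then show "coeff (map_poly \<sigma> h) i = coeff h i"
    by (simp add: coeff_map_poly hom_simps[OF assms(1)])
qed

text \<open>Every \<open>y\<close> is hit: \<open>\<sigma>\<close> leaves an integer polynomial
  \<open>h\<close> with root \<open>y\<close> unchanged, and the roots of its image are images of
  roots.\<close>

lemma fhom_bij:
  fixes \<sigma> :: "qbar \<Rightarrow> qbar"
  assumes s: "fhom \<sigma>"
  shows "bij \<sigma>"
proof (rule bijI)
  show "inj \<sigma>" by (rule injI) (simp add: hom_simps[OF s])
  show "surj \<sigma>" unfolding surj_def
  proof
    fix y :: qbar
    obtain h where h: "\<And>i. coeff h i \<in> \<int>" "h \<noteq> 0" "poly h y = 0"
      using algebraic_qbar[of y] unfolding algebraic_def by blast
    have "poly (map_poly \<sigma> h) y = 0" using h fhom_root[OF s, of h] by simp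
    then show "\<exists>x. y = \<sigma> x" using hom_root_in_range[OF s h(2)] by blast
  qed
qed

lemma fhom_inv:
  fixes \<sigma> :: "qbar \<Rightarrow> qbar"
  assumes s: "fhom \<sigma>"
  shows "fhom (finv \<sigma>)" "\<sigma> (finv \<sigma> x) = x" "finv \<sigma> (\<sigma> x) = x"
proof -
  note b = fhom_bij[OF s]
  show r: "\<sigma> (finv \<sigma> x) = x" and l: "finv \<sigma> (\<sigma> x) = x" for x
    using b by (simp_all add: bij_is_surj surj_f_inv_f bij_is_inj inv_f_f)
  show "fhom (finv \<sigma>)" unfolding hom_on_def
  proof (intro conjI ballI)
    show "finv \<sigma> 1 = 1" using l[of 1] by (simp add: hom_simps[OF s])
    fix x y
    show "finv \<sigma> (x + y) = finv \<sigma> x + finv \<sigma> y"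
      using l[of "finv \<sigma> x + finv \<sigma> y"] by (simp add: hom_simps[OF s] r)
    show "finv \<sigma> (x * y) = finv \<sigma> x * finv \<sigma> y"
      using l[of "finv \<sigma> x * finv \<sigma> y"] by (simp add: hom_simps[OF s] r)
  qed
qed

lemma aut_group_aut: "aut_group (aut L)"
  unfolding aut_group_def aut_def
proof (intro conjI ballI CollectI)
  show "fhom (id :: qbar \<Rightarrow> qbar)" by (simp add: hom_on_def)
  fix \<sigma> :: "qbar \<Rightarrow> qbar" assume s: "\<sigma> \<in> {\<sigma>. fhom \<sigma> \<and> (\<forall>x\<in>L. \<sigma> x = x)}"
  then show "fhom \<sigma>" "fhom (finv \<sigma>)" using fhom_inv by auto
  show "finv \<sigma> x = x" if "x \<in> L" for x using s that fhom_inv(3)[of \<sigma> x] by auto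
  fix \<tau> :: "qbar \<Rightarrow> qbar" assume "\<tau> \<in> {\<sigma>. fhom \<sigma> \<and> (\<forall>x\<in>L. \<sigma> x = x)}"
  then show "fhom (\<sigma> \<circ> \<tau>)" "\<And>x. x \<in> L \<Longrightarrow> (\<sigma> \<circ> \<tau>) x = x" using s hom_comp by auto
qed auto

lemma aut_groupD:
  assumes "aut_group H"
  shows "id \<in> H" "\<sigma> \<in> H \<Longrightarrow> fhom \<sigma>" "\<sigma> \<in> H \<Longrightarrow> finv \<sigma> \<in> H" "\<sigma> \<in> H \<Longrightarrow> \<tau> \<in> H \<Longrightarrow> \<sigma> \<circ> \<tau> \<in> H"
    "\<sigma> \<in> H \<Longrightarrow> \<sigma> ^^ n \<in> H"
proof -
  have c: "\<And>\<sigma> \<tau>. \<sigma> \<in> H \<Longrightarrow> \<tau> \<in> H \<Longrightarrow> \<sigma> \<circ> \<tau> \<in> H"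
    using assms unfolding aut_group_def by blast
  show 1: "id \<in> H" "\<sigma> \<in> H \<Longrightarrow> fhom \<sigma>" "\<sigma> \<in> H \<Longrightarrow> finv \<sigma> \<in> H"
    using assms unfolding aut_group_def by blast+
  show "\<sigma> \<in> H \<Longrightarrow> \<tau> \<in> H \<Longrightarrow> \<sigma> \<circ> \<tau> \<in> H" by (rule c)
  show "\<sigma> \<in> H \<Longrightarrow> \<sigma> ^^ n \<in> H" by (induction n) (auto simp: 1 c)
qed

lemma finite_orbit:
  assumes "aut_group H"
  shows "finite (orbit H x)"
proof -
  obtain h where h: "\<And>i. coeff h i \<in> \<int>" "h \<noteq> 0" "poly h x = 0"
    using algebraic_qbar[of x] unfolding algebraic_def by blast
  have "orbit H x \<subseteq> {y. poly h y = 0}"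
  proof
    fix y assume "y \<in> orbit H x"
    then obtain \<sigma> where s: "\<sigma> \<in> H" "y = \<sigma> x" by (auto simp: orbit_def)
    note f = aut_groupD(2)[OF assms s(1)]
    have "poly (map_poly \<sigma> h) (\<sigma> x) = 0" using h(3) hom_poly[OF f, of h x] by (simp add: hom_simps[OF f])
    then show "y \<in> {y. poly h y = 0}" using s fhom_root[OF f h(1)] by simp
  qed
  then show ?thesis using poly_roots_finite[OF h(2)] finite_subset by blast
qed

lemma orbit_self: "aut_group H \<Longrightarrow> x \<in> orbit H x"
  unfolding orbit_def using aut_groupD(1) by (metis id_apply imageI)

lemma orbit_closed: "aut_group H \<Longrightarrow> \<sigma> \<in> H \<Longrightarrow> y \<in> orbit H x \<Longrightarrow> \<sigma> y \<in> orbit H x"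
proof -
  assume H: "aut_group H" "\<sigma> \<in> H" and "y \<in> orbit H x"
  then obtain \<tau> where "\<tau> \<in> H" "y = \<tau> x" by (auto simp: orbit_def)
  then show ?thesis using aut_groupD(4)[OF H] unfolding orbit_def by (intro image_eqI[of _ _ "\<sigma> \<circ> \<tau>"]) auto
qed

lemma stable_bij:
  assumes "fhom \<sigma>" "finite S" "\<And>y. y \<in> S \<Longrightarrow> \<sigma> y \<in> S"
  shows "bij_betw \<sigma> S S"
proof -
  have i: "inj_on \<sigma> S" by (rule inj_onI) (simp add: hom_simps[OF assms(1)])
  then have "\<sigma> ` S = S" using assms by (intro card_subset_eq) (auto simp: card_image)
  then show ?thesis using i by (simp add: bij_betw_def)
qed

lemma stable_prod_fixed:
  assumes "aut_group H" "finite S" "\<And>\<sigma> y. \<sigma> \<in> H \<Longrightarrow> y \<in> S \<Longrightarrow> \<sigma> y \<in> S"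
  shows "(\<Prod>y\<in>S. y) \<in> fixed H"
  unfolding fixed_def
proof (intro CollectI ballI)
  fix \<sigma> assume s: "\<sigma> \<in> H"
  note f = aut_groupD(2)[OF assms(1) s]
  show "\<sigma> (\<Prod>y\<in>S. y) = (\<Prod>y\<in>S. y)"
    unfolding hom_prod[OF f] by (rule prod.reindex_bij_betw[OF stable_bij[OF f assms(2)]]) (use assms s in auto)
qed

definition orbit_poly :: "(qbar \<Rightarrow> qbar) set \<Rightarrow> qbar \<Rightarrow> qbar poly" where
  "orbit_poly H x = (\<Prod>y\<in>orbit H x. [:-y, 1:])"

lemma orbit_poly_root: "aut_group H \<Longrightarrow> poly (orbit_poly H x) y = 0 \<longleftrightarrow> y \<in> orbit H x"
  using finite_orbit[of H x] by (simp add: orbit_poly_def poly_prod)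

lemma orbit_poly_value: "poly (orbit_poly H x) z = (\<Prod>y\<in>orbit H x. z - y)"
  by (simp add: orbit_poly_def poly_prod)

lemma orbit_poly_nz: "orbit_poly H x \<noteq> 0"
  unfolding orbit_poly_def by (cases "finite (orbit H x)") auto

lemma orbit_poly_fixed:
  assumes H: "aut_group H"
  shows "coeffs_in (fixed H) (orbit_poly H x)"
  unfolding coeffs_in_def fixed_def
proof (intro allI CollectI ballI)
  fix i \<sigma> assume s: "\<sigma> \<in> H"
  note f = aut_groupD(2)[OF H s]
  have mp: "map_poly \<sigma> (\<Prod>y\<in>S. [:-y, 1:]) = (\<Prod>y\<in>S. [:-\<sigma> y, 1:])" for S
    by (induction S rule: infinite_finite_induct)
       (simp_all add: hom_map_poly[OF f] hom_simps[OF f] map_poly_pCons del: mult_pCons_left)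
  have "map_poly \<sigma> (orbit_poly H x) = orbit_poly H x"
    unfolding orbit_poly_def mp
    by (rule prod.reindex_bij_betw[OF stable_bij[OF f finite_orbit[OF H]]]) (rule orbit_closed[OF H s])
  then show "\<sigma> (coeff (orbit_poly H x) i) = coeff (orbit_poly H x) i"
    by (metis coeff_map_poly hom_simps(2)[OF f])
qed

text \<open>The orbit polynomial has coefficients in the fixed field. As \<open>H\<close> need not
  be closed, \<open>\<sigma>\<close> itself may lie outside of \<open>H\<close>; agreement at one
  element at a time is the usable part of the Galois correspondence.\<close>

lemma aut_fixed_orbit:
  assumes "aut_group H" "\<sigma> \<in> aut (fixed H)"
  shows "\<sigma> x \<in> orbit H x"
proof -
  have f: "fhom \<sigma>" and fx: "\<And>y. y \<in> fixed H \<Longrightarrow> \<sigma> y = y" using assms(2) by (auto simp: aut_def)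
  have "map_poly \<sigma> (orbit_poly H x) = orbit_poly H x"
    using orbit_poly_fixed[OF assms(1), of x]
    by (intro poly_eqI) (simp add: coeff_map_poly hom_simps[OF f] fx coeffs_in_def)
  then have "poly (orbit_poly H x) (\<sigma> x) = \<sigma> (poly (orbit_poly H x) x)"
    by (simp add: hom_poly[OF f])
  also have "poly (orbit_poly H x) x = 0" using orbit_poly_root[OF assms(1)] orbit_self[OF assms(1)] by simp
  finally show ?thesis using orbit_poly_root[OF assms(1)] by (simp add: hom_simps[OF f])
qed

text \<open>If all automorphisms fix \<open>x\<close>, its minimal polynomial has no other root. A
  multiple root would, in characteristic 0, be a root of the nonzero derivative of smaller degree,
  so the polynomial is linear.\<close>

lemma fixed_aut:
  assumes L: "is_subfield L"
  shows "fixed (aut L) = L"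
proof
  show "L \<subseteq> fixed (aut L)" by (auto simp: fixed_def aut_def)
  show "fixed (aut L) \<subseteq> L"
  proof
    fix x assume x: "x \<in> fixed (aut L)"
    obtain m where m: "coeffs_in L m" "m \<noteq> 0" "poly m x = 0"
      "\<And>h. coeffs_in L h \<Longrightarrow> h \<noteq> 0 \<Longrightarrow> poly h x = 0 \<Longrightarrow> degree m \<le> degree h"
      using minimal_poly_exists[OF algebraic_over_subfield[OF L]] by blast
    have idL: "hom_on L id" by (simp add: hom_on_def)
    have only: "y = x" if y: "poly m y = 0" for y
    proof -
      have "poly (map_poly id m) y = 0" using y by (simp add: map_poly_id)
      from hom_extend_simple[OF L idL algebraic_over_subfield[OF L] m this]
      obtain B g where B: "is_subfield B" "hom_on B g" "L \<subseteq> B" "\<forall>a\<in>L. g a = id a" "x \<in> B" "g x = y" by blast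
      obtain \<sigma> where s: "fhom \<sigma>" "\<forall>a\<in>B. \<sigma> a = g a" using qbar_hom_extend[OF B(1,2)] by blast
      have "\<sigma> \<in> aut L" using s B by (auto simp: aut_def)
      then show ?thesis using x s B by (auto simp: fixed_def)
    qed
    have "degree m = 1"
    proof (rule ccontr)
      assume "degree m \<noteq> 1"
      moreover have d0: "degree m \<noteq> 0"
      proof
        assume "degree m = 0"
        then obtain c where "m = [:c:]" by (rule degree_eq_zeroE)
        with m(2,3) show False by simp
      qed
      ultimately have d: "degree m > 1" by simp
      obtain q where q: "m = [:-x, 1:] * q" using m(3) by (metis dvd_def poly_eq_0_iff_dvd)
      have "q \<noteq> 0" using m(2) q by auto
      then have "degree m = Suc (degree q)" unfolding q by (subst degree_mult_eq) auto
      then have "degree q > 0" using d by simp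
      then obtain y where "poly q y = 0" using alg_closed_imp_poly_has_root by blast
      then have qx: "poly q x = 0" using only[of y] q by simp
      have "pderiv m = q + [:-x, 1:] * pderiv q" unfolding q pderiv_mult by (simp add: pderiv_pCons)
      then have "poly (pderiv m) x = 0" using qx by simp
      moreover have "pderiv m \<noteq> 0" using d0 by (simp add: pderiv_eq_0_iff)
      moreover have "of_nat k \<in> L" for k using is_subfield_of_int[OF L, of "int k"] by simp
      then have "coeffs_in L (pderiv m)" unfolding coeffs_in_def coeff_pderiv
        using m(1) by (intro allI is_subfieldD(4)[OF L]) (auto simp: coeffs_in_def simp del: of_nat_Suc)
      ultimately have "degree m \<le> degree (pderiv m)" using m(4) by blast
      then show False using d by (simp add: degree_pderiv)
    qed
    obtain a q where aq: "m = pCons a q" by (cases m)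
    have "degree q = 0" using \<open>degree m = 1\<close> aq by (simp split: if_splits)
    then obtain b where b: "q = [:b:]" by (rule degree_eq_zeroE)
    then have ab: "m = [:a, b:]" "b \<noteq> 0" using aq \<open>degree m = 1\<close> by auto
    have "a \<in> L" "b \<in> L" using m(1) ab by (auto simp: coeffs_in_def dest: spec[of _ 0] spec[of _ 1])
    moreover have "x = - a / b" using m(3) ab by (simp add: field_simps eq_neg_iff_add_eq_0)
    ultimately show "x \<in> L" using is_subfieldD[OF L] by metis
  qed
qed

section \<open>Compactness of the Galois group\<close>

lemma closedin_finitely_determined:
  assumes "finite F0" "\<And>\<sigma> \<tau>. (\<And>x. x \<in> F0 \<Longrightarrow> \<sigma> x = \<tau> x) \<Longrightarrow> \<sigma> \<in> A \<Longrightarrow> \<tau> \<in> A"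
  shows "closedin (product_topology (\<lambda>x. discrete_topology (S x)) UNIV) (A \<inter> PiE UNIV S)"
    (is "closedin ?T _")
proof -
  have "openin ?T (PiE UNIV S - A)"
  proof (subst openin_subopen, intro ballI)
    fix \<sigma> assume s: "\<sigma> \<in> PiE UNIV S - A"
    define B where "B = PiE UNIV (\<lambda>x. if x \<in> F0 then {\<sigma> x} else S x)"
    have "{i. (if i \<in> F0 then {\<sigma> i} else S i) \<noteq> S i} \<subseteq> F0" by auto
    then have "finite {i. (if i \<in> F0 then {\<sigma> i} else S i) \<noteq> S i}" using assms(1) finite_subset by blast
    then have "openin ?T B" unfolding B_def openin_PiE_gen using s by (auto simp: PiE_iff)
    moreover have "\<sigma> \<in> B" using s by (auto simp: B_def PiE_iff)
    moreover have "B \<subseteq> PiE UNIV S - A"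
    proof
      fix \<tau> assume t: "\<tau> \<in> B"
      have "\<tau> x = \<sigma> x" if "x \<in> F0" for x using t that by (auto simp: B_def PiE_iff dest: spec[of _ x])
      moreover have "\<tau> x \<in> S x" for x using t s by (auto simp: B_def PiE_iff split: if_splits dest!: spec[of _ x])
      ultimately show "\<tau> \<in> PiE UNIV S - A" using assms(2)[of \<tau> \<sigma>] s by (auto simp: PiE_iff)
    qed
    ultimately show "\<exists>B. openin ?T B \<and> \<sigma> \<in> B \<and> B \<subseteq> PiE UNIV S - A" by blast
  qed
  then show ?thesis unfolding closedin_def by (simp add: Diff_Int Diff_Int2 Diff_Int_distrib)
qed

text \<open>The functions that map each element into its orbit form a compact product of finite
  discrete spaces. Being a homomorphism and satisfying \<open>P n\<close> are closed conditions
  there, and decreasing \<open>P\<close> gives the finite intersection property.\<close>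

lemma aut_compact:
  assumes dec: "\<And>n \<sigma>. \<sigma> \<in> aut L \<Longrightarrow> P (Suc n) \<sigma> \<Longrightarrow> P n \<sigma>"
    and fin: "\<And>n. \<exists>F0. finite F0 \<and> (\<forall>\<sigma> \<tau>. (\<forall>x\<in>F0. \<sigma> x = \<tau> x) \<longrightarrow> P n \<sigma> \<longrightarrow> P n \<tau>)"
    and ex: "\<And>n. \<exists>\<sigma>\<in>aut L. P n \<sigma>"
  shows "\<exists>\<sigma>\<in>aut L. \<forall>n. P n \<sigma>"
proof -
  define S where "S = orbit (aut L)"
  let ?T = "product_topology (\<lambda>x. discrete_topology (S x)) UNIV"
  have finS: "finite (S x)" for x unfolding S_def by (rule finite_orbit[OF aut_group_aut])
  have comp: "compact_space ?T"
    unfolding compact_space_product_topology by (simp add: compact_space_discrete_topology finS)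
  define A where "A xy = {\<sigma> :: qbar \<Rightarrow> qbar. \<sigma> 1 = 1 \<and> \<sigma> (fst xy + snd xy) = \<sigma> (fst xy) + \<sigma> (snd xy) \<and>
      \<sigma> (fst xy * snd xy) = \<sigma> (fst xy) * \<sigma> (snd xy)}" for xy
  define \<U> where "\<U> = range (\<lambda>xy. A xy \<inter> PiE UNIV S) \<union> range (\<lambda>n. {\<sigma>. P n \<sigma>} \<inter> PiE UNIV S)"
  have "\<Inter>\<U> \<noteq> {}"
  proof (rule comp[unfolded compact_space_fip, rule_format], intro conjI ballI allI impI)
    fix C assume "C \<in> \<U>"
    then consider xy where "C = A xy \<inter> PiE UNIV S" | n where "C = {\<sigma>. P n \<sigma>} \<inter> PiE UNIV S"
      unfolding \<U>_def by blast
    then show "closedin ?T C"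
    proof cases
      case 1
      show ?thesis unfolding 1
        by (rule closedin_finitely_determined[of "{1, fst xy, snd xy, fst xy + snd xy, fst xy * snd xy}"])
           (auto simp: A_def)
    next
      case 2
      obtain F0 where "finite F0" "\<forall>\<sigma> \<tau>. (\<forall>x\<in>F0. \<sigma> x = \<tau> x) \<longrightarrow> P n \<sigma> \<longrightarrow> P n \<tau>" using fin by blast
      then show ?thesis unfolding 2 by (intro closedin_finitely_determined[of F0]) auto
    qed
  next
    fix F assume F: "finite F \<and> F \<subseteq> \<U>"
    then obtain I J where IJ: "finite J" "F = (\<lambda>xy. A xy \<inter> PiE UNIV S) ` I \<union> (\<lambda>n. {\<sigma>. P n \<sigma>} \<inter> PiE UNIV S) ` J"
    proof -
      obtain F1 F2 where F12: "F = F1 \<union> F2" "F1 \<subseteq> range (\<lambda>xy. A xy \<inter> PiE UNIV S)"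
        "F2 \<subseteq> range (\<lambda>n. {\<sigma>. P n \<sigma>} \<inter> PiE UNIV S)"
        using F unfolding \<U>_def by (auto elim!: subset_UnE)
      then have "finite F2" using F by auto
      then obtain J where "finite J" "F2 = (\<lambda>n. {\<sigma>. P n \<sigma>} \<inter> PiE UNIV S) ` J"
        using F12(3) by (auto dest: finite_subset_image)
      moreover obtain I where "F1 = (\<lambda>xy. A xy \<inter> PiE UNIV S) ` I" using F12(2) by (rule subset_imageE)
      ultimately show ?thesis using that[of J I] F12(1) by simp
    qed
    define N where "N = Max (insert 0 J)"
    obtain \<sigma> where s: "\<sigma> \<in> aut L" "P N \<sigma>" using ex by blast
    have down: "P n \<sigma> \<Longrightarrow> m \<le> n \<Longrightarrow> P m \<sigma>" for m n
      by (induction n) (auto simp: le_Suc_eq intro: dec[OF s(1)])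
    have "P n \<sigma>" if "n \<in> J" for n using down[OF s(2)] IJ(1) that by (simp add: N_def)
    moreover have "\<sigma> \<in> PiE UNIV S" using s(1) by (auto simp: S_def orbit_def)
    moreover have "\<sigma> \<in> A xy" for xy using s(1) by (auto simp: A_def aut_def hom_simps)
    ultimately have "\<sigma> \<in> \<Inter>F" unfolding IJ(2) by auto
    then show "\<Inter>F \<noteq> {}" by blast
  qed
  then obtain \<sigma> where s: "\<sigma> \<in> \<Inter>\<U>" by blast
  have "\<sigma> \<in> A xy" for xy using s unfolding \<U>_def by blast
  then have "fhom \<sigma>" by (auto simp: hom_on_def A_def)
  \<comment> \<open>An element of \<open>L\<close> has a singleton orbit, so membership in the
    product already fixes it.\<close>
  moreover have "\<sigma> x = x" if "x \<in> L" for x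
  proof -
    have "A (0, 0) \<inter> PiE UNIV S \<in> \<U>" by (simp add: \<U>_def)
    with s have "\<sigma> \<in> PiE UNIV S" by blast
    then have "\<sigma> x \<in> S x" by (simp add: PiE_iff)
    then show ?thesis using that by (auto simp: S_def orbit_def aut_def)
  qed
  moreover have "P n \<sigma>" for n
  proof -
    have "{\<sigma>. P n \<sigma>} \<inter> PiE UNIV S \<in> \<U>" by (simp add: \<U>_def)
    with s show ?thesis by blast
  qed
  ultimately show ?thesis by (auto simp: aut_def)
qed

section \<open>Fixed points of coprime actions\<close>

text \<open>A cycle of \<open>f\<close> has length 1 or \<open>l\<close>; without fixed points,
  removing one cycle would leave a smaller counterexample.\<close>

lemma fixed_point_prime_order:
  fixes f :: "'a \<Rightarrow> 'a"
  assumes l: "prime l" and S: "finite S" "f ` S \<subseteq> S" and id: "\<And>x. x \<in> S \<Longrightarrow> (f ^^ l) x = x"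
    and nd: "\<not> l dvd card S"
  shows "\<exists>x\<in>S. f x = x"
  using S id nd
proof (induction "card S" arbitrary: S rule: less_induct)
  case less
  show ?case
  proof (rule ccontr)
    assume no: "\<not> ?thesis"
    have "S \<noteq> {}" using less.prems(4) by auto
    then obtain x where x: "x \<in> S" by blast
    have inS: "(f ^^ i) y \<in> S" if "y \<in> S" for i y using that less.prems(2) by (induction i) auto
    define O1 where "O1 = (\<lambda>i. (f ^^ i) x) ` {..<l}"
    have per: "(f ^^ (l * k)) y = y" if "y \<in> S" for k y
      using that by (induction k) (auto simp: funpow_add less.prems(3))
    \<comment> \<open>A coincidence among the first \<open>l\<close> iterates gives a period
      \<open>d < l\<close>. It is prime to the period \<open>l\<close>, so by Bezout 1 is a period
      as well.\<close>
    have *: False if ij: "i < j" "j < l" "(f ^^ i) x = (f ^^ j) x" for i j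
    proof -
      define y where "y = (f ^^ i) x"
      define d where "d = j - i"
      have y: "y \<in> S" unfolding y_def by (rule inS[OF x])
      have "(f ^^ d) y = (f ^^ (d + i)) x" by (simp add: y_def funpow_add)
      also have "\<dots> = y" using ij by (simp add: y_def d_def)
      finally have "(f ^^ d) y = y" .
      then have dk: "(f ^^ (d * k)) y = y" for k by (induction k) (auto simp: funpow_add)
      have "\<not> l dvd d" using ij by (intro nat_dvd_not_less) (auto simp: d_def)
      then have "coprime l d" by (rule prime_imp_coprime[OF l])
      then have "coprime d l" by (rule coprime_commute[THEN iffD1])
      then have g1: "gcd d l = 1" by (rule coprime_imp_gcd_eq_1)
      have "d \<noteq> 0" using ij by (simp add: d_def)
      from bezout_nat[OF this, of l] obtain u v where uv: "d * u = l * v + 1"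
        unfolding g1 by blast
      have "f y = f ((f ^^ (l * v)) y)" by (simp add: per y)
      also have "\<dots> = (f ^^ (d * u)) y" unfolding uv by simp
      also have "\<dots> = y" by (rule dk)
      finally show False using no y by blast
    qed
    then have "inj_on (\<lambda>i. (f ^^ i) x) {..<l}"
      unfolding inj_on_def by (metis lessThan_iff linorder_neqE_nat)
    then have cO: "card O1 = l" by (simp add: O1_def card_image)
    have OS: "O1 \<subseteq> S" using inS[OF x] by (auto simp: O1_def)
    have stable: "f ` (S - O1) \<subseteq> S - O1"
    proof
      fix z assume "z \<in> f ` (S - O1)"
      then obtain y where y: "y \<in> S" "y \<notin> O1" "z = f y" by blast
      have "y = (f ^^ (l - 1)) (f y)"
        using less.prems(3)[OF y(1)] prime_gt_0_nat[OF l] by (metis Suc_diff_1 comp_apply funpow_Suc_right)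
      moreover have "(f ^^ k) w \<in> O1" if "w \<in> O1" for k w
      proof -
        have "f w \<in> O1" if w: "w \<in> O1" for w
        proof -
          obtain i where i: "i < l" "w = (f ^^ i) x" using w by (auto simp: O1_def)
          show ?thesis
          proof (cases "Suc i < l")
            case True
            then show ?thesis using i unfolding O1_def by (intro image_eqI[of _ _ "Suc i"]) auto
          next
            case False
            then have "Suc i = l" using i by simp
            then have "f w = x" using less.prems(3)[OF x] i by auto
            then show ?thesis unfolding O1_def using prime_gt_0_nat[OF l] by (intro image_eqI[of _ _ 0]) auto
          qed
        qed
        then show ?thesis using that by (induction k) auto
      qed
      ultimately have "f y \<notin> O1" using y(2) by metis
      then show "z \<in> S - O1" using y less.prems(2) by blast
    qed
    have cS: "card S = card (S - O1) + l" using OS less.prems(1) cO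
      by (metis card_Diff_subset card_mono finite_subset le_add_diff_inverse2)
    have "\<not> l dvd card (S - O1)" using less.prems(4) unfolding cS by simp
    moreover have "card (S - O1) < card S" using cS prime_gt_0_nat[OF l] by simp
    ultimately have "\<exists>x\<in>S - O1. f x = x" using less.hyps[of "S - O1"] less.prems stable by auto
    then show False using no by blast
  qed
qed

definition perm_group :: "('a \<Rightarrow> 'a) set \<Rightarrow> bool" where
  "perm_group Q \<longleftrightarrow> finite Q \<and> id \<in> Q \<and> (\<forall>g\<in>Q. \<forall>h\<in>Q. g \<circ> h \<in> Q) \<and> (\<forall>g\<in>Q. \<exists>h\<in>Q. g \<circ> h = id \<and> h \<circ> g = id)"

text \<open>A nontrivial Sylow \<open>l\<close>-subgroup would contain a nontrivial element, whose
  order would divide both a power of \<open>l\<close> and a power of \<open>p\<close>.\<close>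

lemma perm_group_card:
  assumes Q: "perm_group Q" and l: "prime l" and p: "prime p" "l \<noteq> p"
    and pw: "\<And>g. g \<in> Q \<Longrightarrow> \<exists>k. g ^^ (p ^ k) = id"
  shows "\<not> l dvd card Q"
proof
  assume dvd: "l dvd card Q"
  define G :: "('a \<Rightarrow> 'a) monoid" where "G = \<lparr>carrier = Q, mult = (\<circ>), one = id\<rparr>"
  interpret group G
    by (rule groupI) (use Q in \<open>auto simp: G_def perm_group_def comp_assoc\<close>)
  have pow: "g [^]\<^bsub>G\<^esub> (n::nat) = g ^^ n" for g n
    by (induction n) (auto simp: G_def funpow_swap1 fun_eq_iff nat_pow_def)
  have "Coset.order G \<noteq> 0" using Q unfolding Coset.order_def G_def perm_group_def by auto
  moreover have "\<not> is_unit l" using l by auto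
  ultimately obtain m where m: "Coset.order G = l ^ multiplicity l (Coset.order G) * m" by (metis multiplicity_decompose')
  define a where "a = multiplicity l (Coset.order G)"
  have "a > 0" using dvd l \<open>Coset.order G \<noteq> 0\<close> unfolding a_def Coset.order_def G_def
    by (simp add: prime_multiplicity_gt_zero_iff)
  have "\<exists>H. subgroup H G \<and> card H = l ^ a"
  proof (rule sylow_thm[OF l is_group])
    show "Coset.order G = l ^ a * m" unfolding a_def by (rule m)
    show "finite (carrier G)" using Q by (simp add: G_def perm_group_def)
  qed
  then obtain H where H: "subgroup H G" "card H = l ^ a" by blast
  have "card H > 1" unfolding H(2) using \<open>a > 0\<close> prime_gt_1_nat[OF l] by (intro one_less_power)
  then have "\<not> H \<subseteq> {id}" using card_mono[of "{id}" H] by auto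
  then obtain h where h: "h \<in> H" "h \<noteq> id" by blast
  interpret GH: group "G\<lparr>carrier := H\<rparr>" using subgroup.subgroup_is_group[OF H(1) is_group] .
  have "h [^]\<^bsub>G\<lparr>carrier := H\<rparr>\<^esub> Coset.order (G\<lparr>carrier := H\<rparr>) = \<one>\<^bsub>G\<lparr>carrier := H\<rparr>\<^esub>"
    by (rule GH.pow_order_eq_1) (use h in simp)
  moreover have "h [^]\<^bsub>G\<lparr>carrier := H\<rparr>\<^esub> (n::nat) = h [^]\<^bsub>G\<^esub> n" for n by (simp add: nat_pow_def)
  ultimately have h1: "h ^^ (l ^ a) = id" by (simp add: pow Coset.order_def H(2)) (simp add: G_def)
  have "h \<in> Q" using h(1) subgroup.subset[OF H(1)] by (auto simp: G_def)
  then obtain k where h2: "h ^^ (p ^ k) = id" using pw by blast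
  have "coprime l p" by (rule primes_coprime[OF l p(1) p(2)])
  then have "coprime (l ^ a) (p ^ k)" by (simp only: coprime_power_left_iff coprime_power_right_iff simp_thms)
  then have g1: "gcd (l ^ a) (p ^ k) = 1" by (rule coprime_imp_gcd_eq_1)
  have "l ^ a \<noteq> 0" using prime_gt_0_nat[OF l] by simp
  from bezout_nat[OF this, of "p ^ k"] obtain u v where uv: "l ^ a * u = p ^ k * v + 1"
    unfolding g1 by blast
  have idm: "h ^^ (n * m) = (h ^^ n) ^^ m" for n m by (simp only: funpow_mult)
  have "h ^^ (l ^ a * u) = id" unfolding idm h1 by simp
  moreover have "h ^^ (p ^ k * v) = id" unfolding idm h2 by simp
  ultimately have "h = id" unfolding uv by (simp add: funpow_add)
  then show False using h(2) by blast
qed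

text \<open>A cyclic group of order prime to \<open>p\<close> acting affinely on a \<open>p\<close>-group has a fixed point:
  descending through the divisors of \<open>N\<close>, the fixed points of each power form a coset of a
  centralizer, whose order is prime to the next prime \<open>l\<close>, so that an action of order \<open>l\<close> on them
  has a fixed point.\<close>

lemma coprime_conjugation:
  fixes a b :: "'a \<Rightarrow> 'a"
  assumes Q: "perm_group Q" and p: "prime p"
    and pw: "\<And>g. g \<in> Q \<Longrightarrow> \<exists>k. g ^^ (p ^ k) = id"
    and bij: "bij a" "bij b" and N: "N > 0" "\<not> p dvd N" "a ^^ N = id" "b ^^ N = id"
    and norm: "\<And>m. m \<in> Q \<Longrightarrow> a \<circ> m \<circ> finv b \<in> Q"
  shows "\<exists>m\<in>Q. a \<circ> m = m \<circ> b"
proof -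
  have Qc: "g \<circ> h \<in> Q" if "g \<in> Q" "h \<in> Q" for g h using Q that by (auto simp: perm_group_def)
  have Qi: "\<exists>h\<in>Q. g \<circ> h = id \<and> h \<circ> g = id" if "g \<in> Q" for g using Q that by (auto simp: perm_group_def)
  \<comment> \<open>\<open>a \<circ> m = m \<circ> b\<close> says that \<open>m\<close> is fixed by
    \<open>T\<close>; accordingly \<open>F k\<close> collects the fixed points in \<open>Q\<close>
    of the \<open>k\<close>-th iterate of \<open>T\<close>.\<close>
  define T where "T m = a \<circ> m \<circ> finv b" for m
  define F where "F k = {m \<in> Q. (a ^^ k) \<circ> m = m \<circ> (b ^^ k)}" for k
  have ib: "finv b \<circ> b = id" "b \<circ> finv b = id" using bij(2)
    by (auto simp: fun_eq_iff bij_is_inj bij_is_surj surj_f_inv_f)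
  have TQ: "(T ^^ k) m \<in> Q" if "m \<in> Q" for k m using that by (induction k) (auto simp: T_def norm)
  have Tk: "(T ^^ k) m \<circ> (b ^^ k) = (a ^^ k) \<circ> m" for k m
  proof (induction k)
    case (Suc k)
    have "(T ^^ Suc k) m \<circ> (b ^^ Suc k) = a \<circ> (T ^^ k) m \<circ> (finv b \<circ> b) \<circ> (b ^^ k)"
      by (simp add: T_def comp_assoc)
    also have "\<dots> = a \<circ> ((T ^^ k) m \<circ> (b ^^ k))" by (simp add: ib comp_assoc)
    also have "\<dots> = (a ^^ Suc k) \<circ> m" unfolding Suc by (simp add: comp_assoc)
    finally show ?case .
  qed simp
  have bk: "bij (b ^^ k)" for k using bij(2) by (rule bij_betw_funpow)
  have FT: "m \<in> F k \<longleftrightarrow> m \<in> Q \<and> (T ^^ k) m = m" for m k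
  proof -
    have "(a ^^ k) \<circ> m = m \<circ> (b ^^ k) \<longleftrightarrow> (T ^^ k) m \<circ> (b ^^ k) = m \<circ> (b ^^ k)" unfolding Tk ..
    also have "\<dots> \<longleftrightarrow> (T ^^ k) m = m"
    proof
      assume e: "(T ^^ k) m \<circ> (b ^^ k) = m \<circ> (b ^^ k)"
      show "(T ^^ k) m = m"
      proof
        fix x
        obtain y where "x = (b ^^ k) y" using bij_is_surj[OF bk[of k]] by (rule surjE)
        then show "(T ^^ k) m x = m x" using fun_cong[OF e, of y] by simp
      qed
    qed simp
    finally show ?thesis by (auto simp: F_def)
  qed
  \<comment> \<open>The induction starts at \<open>k = N\<close>, where the iterate of
    \<open>T\<close> is the identity, and passes from \<open>k * l\<close> to \<open>k\<close> for a
    prime \<open>l\<close>.\<close>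
  have main: "F k \<noteq> {}" if "k dvd N" for k
    using that
  proof (induction "N div k" arbitrary: k rule: less_induct)
    case less
    have k0: "k > 0" using less.prems N(1) by (auto intro: Nat.gr0I)
    show ?case
    proof (cases "N div k = 1")
      case True
      then have "k = N" using less.prems by (metis dvd_div_mult_self nat_mult_1)
      then have "id \<in> F k" using N Q by (auto simp: F_def perm_group_def)
      then show ?thesis by blast
    next
      case False
      then obtain l where l: "prime l" "l dvd N div k" by (metis prime_factor_nat)
      then have kl: "k * l dvd N" using less.prems k0
        by (metis dvd_div_iff_mult mult.commute not_gr_zero)
      have lp: "l \<noteq> p" using kl N(2) by (metis dvd_mult_right)
      have "N div (k * l) < N div k"
      proof -
        obtain q where q: "N = k * l * q" using kl by (rule dvdE)
        then have "q > 0" using N(1) by (auto intro: Nat.gr0I)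
        have "N div (k * l) = q" "N div k = l * q" using k0 prime_gt_0_nat[OF l(1)] by (simp_all add: q mult.assoc)
        then show ?thesis using prime_gt_1_nat[OF l(1)] \<open>q > 0\<close> by simp
      qed
      then obtain m0 where m0: "m0 \<in> F (k * l)" using less.hyps[OF _ kl] by blast
      \<comment> \<open>The centralizer of \<open>a ^^ (k * l)\<close> in \<open>Q\<close>.
        \<open>F (k * l)\<close> is its coset through \<open>m0\<close>, hence has cardinality prime
        to \<open>l\<close>, and \<open>T ^^ k\<close> acts on it with order dividing
        \<open>l\<close>.\<close>
      define C where "C = {n \<in> Q. (a ^^ (k * l)) \<circ> n = n \<circ> (a ^^ (k * l))}"
      have "perm_group C" unfolding perm_group_def
      proof (intro conjI ballI)
        show "finite C" "id \<in> C" using Q by (auto simp: C_def perm_group_def)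
        fix g h assume "g \<in> C" "h \<in> C"
        then have gh: "g \<in> Q" "h \<in> Q" "(a ^^ (k * l)) \<circ> g = g \<circ> (a ^^ (k * l))"
          "(a ^^ (k * l)) \<circ> h = h \<circ> (a ^^ (k * l))" by (simp_all add: C_def)
        have "(a ^^ (k * l)) \<circ> (g \<circ> h) = ((a ^^ (k * l)) \<circ> g) \<circ> h" by (simp only: comp_assoc)
        also have "\<dots> = g \<circ> ((a ^^ (k * l)) \<circ> h)" unfolding gh(3) by (simp only: comp_assoc)
        also have "\<dots> = (g \<circ> h) \<circ> (a ^^ (k * l))" unfolding gh(4) by (simp only: comp_assoc)
        finally show "g \<circ> h \<in> C" using Qc gh by (simp add: C_def)
      next
        fix g assume g: "g \<in> C"
        then obtain h where h: "h \<in> Q" "g \<circ> h = id" "h \<circ> g = id" using Qi by (auto simp: C_def)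
        let ?A = "a ^^ (k * l)"
        have "h \<circ> (?A \<circ> g) \<circ> h = h \<circ> (g \<circ> ?A) \<circ> h" using g by (simp add: C_def)
        then have "h \<circ> ?A \<circ> (g \<circ> h) = (h \<circ> g) \<circ> ?A \<circ> h" by (simp only: comp_assoc)
        then have "h \<in> C" using h by (simp add: C_def)
        then show "\<exists>h\<in>C. g \<circ> h = id \<and> h \<circ> g = id" using h by blast
      qed
      then have "\<not> l dvd card C"
        by (rule perm_group_card[OF _ l(1) p lp]) (use pw in \<open>auto simp: C_def\<close>)
      moreover have "bij_betw (\<lambda>n. n \<circ> m0) C (F (k * l))"
      proof -
        let ?A = "a ^^ (k * l)" and ?B = "b ^^ (k * l)"
        have m0Q: "m0 \<in> Q" "?A \<circ> m0 = m0 \<circ> ?B" using m0 by (auto simp: F_def)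
        obtain m1 where m1: "m1 \<in> Q" "m0 \<circ> m1 = id" "m1 \<circ> m0 = id" using Qi m0Q by blast
        show ?thesis
        proof (rule bij_betw_byWitness[of _ "\<lambda>m. m \<circ> m1"])
          show "\<forall>n\<in>C. n \<circ> m0 \<circ> m1 = n" "\<forall>m\<in>F (k * l). m \<circ> m1 \<circ> m0 = m"
            using m1 by (simp_all add: comp_assoc)
          show "(\<lambda>n. n \<circ> m0) ` C \<subseteq> F (k * l)"
          proof safe
            fix n assume n: "n \<in> C"
            have "?A \<circ> (n \<circ> m0) = (?A \<circ> n) \<circ> m0" by (simp only: comp_assoc)
            also have "\<dots> = n \<circ> (?A \<circ> m0)" using n by (simp add: C_def comp_assoc)
            also have "\<dots> = (n \<circ> m0) \<circ> ?B" unfolding m0Q by (simp only: comp_assoc)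
            finally show "n \<circ> m0 \<in> F (k * l)" using n m0Q Qc by (simp add: F_def C_def)
          qed
          show "(\<lambda>m. m \<circ> m1) ` F (k * l) \<subseteq> C"
          proof safe
            fix m assume m: "m \<in> F (k * l)"
            have mQ: "m \<in> Q" "?A \<circ> m = m \<circ> ?B" using m by (auto simp: F_def)
            have "m1 \<circ> (?A \<circ> m0) \<circ> m1 = m1 \<circ> (m0 \<circ> ?B) \<circ> m1" using m0Q by simp
            then have "m1 \<circ> ?A \<circ> (m0 \<circ> m1) = (m1 \<circ> m0) \<circ> ?B \<circ> m1" by (simp only: comp_assoc)
            then have B: "?B \<circ> m1 = m1 \<circ> ?A" using m1 by simp
            have "?A \<circ> (m \<circ> m1) = (?A \<circ> m) \<circ> m1" by (simp only: comp_assoc)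
            also have "\<dots> = m \<circ> (?B \<circ> m1)" unfolding mQ by (simp only: comp_assoc)
            also have "\<dots> = (m \<circ> m1) \<circ> ?A" unfolding B by (simp only: comp_assoc)
            finally show "m \<circ> m1 \<in> C" using mQ m1 Qc by (simp add: C_def)
          qed
        qed
      qed
      ultimately have nd: "\<not> l dvd card (F (k * l))" by (metis bij_betw_same_card)
      have "\<exists>m\<in>F (k * l). (T ^^ k) m = m"
      proof (rule fixed_point_prime_order[OF l(1) _ _ _ nd])
        show "finite (F (k * l))" using Q by (simp add: F_def perm_group_def)
        show per: "((T ^^ k) ^^ l) m = m" if "m \<in> F (k * l)" for m
          using that FT[of m "k * l"] by (simp add: funpow_mult mult.commute)
        show "(T ^^ k) ` F (k * l) \<subseteq> F (k * l)"
        proof safe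
          fix m assume m: "m \<in> F (k * l)"
          have "(T ^^ (k * l)) ((T ^^ k) m) = (T ^^ k) ((T ^^ (k * l)) m)"
            by (simp only: funpow_add[symmetric] comp_apply[of "T ^^ _" "T ^^ _", symmetric] add.commute)
          then show "(T ^^ k) m \<in> F (k * l)" using m TQ unfolding FT by auto
        qed
      qed
      then obtain m where "m \<in> F (k * l)" "(T ^^ k) m = m" by blast
      then have "m \<in> F k" by (simp add: FT)
      then show ?thesis by blast
    qed
  qed
  obtain m where "m \<in> F 1" using main[of 1] by auto
  then show ?thesis by (auto simp: F_def)
qed

section \<open>Closed fields are henselian\<close>

context padic_qbar
begin

definition cl :: "qbar set \<Rightarrow> qbar set" where
  "cl L = {x. \<forall>r. \<exists>l\<in>L. vgt (x - l) r}"

lemma clI_near: "x \<in> cl L \<Longrightarrow> \<exists>l\<in>L. vgt (x - l) r \<and> vgt (x - l) s"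
proof -
  assume "x \<in> cl L"
  then obtain l where "l \<in> L" "vgt (x - l) (max r s)" unfolding cl_def by blast
  then show ?thesis using vgt_mono[of "x - l" "max r s"] by (intro bexI[of _ l]) auto
qed

lemma subset_cl: "L \<subseteq> cl L"
  unfolding cl_def by (auto intro!: bexI[of _ "_ :: qbar"])

lemma cl_subfield:
  assumes L: "is_subfield L"
  shows "is_subfield (cl L)"
proof -
  note D = is_subfieldD[OF L]
  have mult: "x * y \<in> cl L" if xy: "x \<in> cl L" "y \<in> cl L" for x y
    unfolding cl_def
  proof (intro CollectI allI)
    fix r
    \<comment> \<open>\<open>s\<close> and \<open>t\<close> bound the values of the factors from
      below. The precisions \<open>r - s\<close> and \<open>r - t\<close> come from
      \<open>x * y - k * l = x * (y - l) + (x - k) * l\<close>; the third condition on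
      \<open>l\<close> lets it inherit the bound \<open>t\<close>.\<close>
    obtain s where s: "vge x s" "s \<le> 0" by (cases "w x \<le> 0") (auto simp: vge_def)
    obtain t where t: "vge y t" "t \<le> 0" by (cases "w y \<le> 0") (auto simp: vge_def)
    obtain l where l: "l \<in> L" "vgt (y - l) (r - s)" "vgt (y - l) t" using clI_near[OF xy(2)] by blast
    obtain k where k: "k \<in> L" "vgt (x - k) (r - t)" using xy(1) unfolding cl_def by blast
    have "vge (y - (y - l)) t" by (rule vge_diff[OF t(1) vgt_imp_vge[OF l(3)]])
    then have lt: "vge l t" by simp
    have "vgt (x * (y - l)) (s + (r - s))" by (rule vgt_mult(1)[OF s(1) l(2)])
    moreover have "vgt ((x - k) * l) (t + (r - t))" by (rule vgt_mult(2)[OF k(2) lt])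
    ultimately have "vgt (x * (y - l) + (x - k) * l) r" by (intro vgt_add) simp_all
    then have "vgt (x * y - k * l) r" by (simp add: algebra_simps)
    then show "\<exists>l\<in>L. vgt (x * y - l) r" using D(4)[OF k(1) l(1)] by blast
  qed
  have sub: "x - y \<in> cl L" if xy: "x \<in> cl L" "y \<in> cl L" for x y
    unfolding cl_def
  proof (intro CollectI allI)
    fix r
    obtain k where k: "k \<in> L" "vgt (x - k) r" using xy(1) unfolding cl_def by blast
    obtain l where l: "l \<in> L" "vgt (y - l) r" using xy(2) unfolding cl_def by blast
    have "vgt ((x - k) - (y - l)) r" by (rule vgt_diff[OF k(2) l(2)])
    then have "vgt (x - y - (k - l)) r" by (simp add: algebra_simps)
    then show "\<exists>l\<in>L. vgt (x - y - l) r" using D(3)[OF k(1) l(1)] by blast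
  qed
  have inv: "inverse x \<in> cl L" if x: "x \<in> cl L" for x
  proof (cases "x = 0")
    case True
    then show ?thesis using subset_cl D(2) by auto
  next
    case False
    show ?thesis unfolding cl_def
    proof (intro CollectI allI)
      fix r
      \<comment> \<open>The first precision gives \<open>w l = w x\<close>; the second compensates
        for the denominator of \<open>1/x - 1/l = (l - x) / (x * l)\<close>, which has value
        \<open>2 * w x\<close>.\<close>
      obtain l where l: "l \<in> L" "vgt (x - l) (w x)" "vgt (x - l) (r + 2 * w x)" using clI_near[OF x] by blast
      have "vgt (- (x - l)) (w x)" using l(2) by (simp only: vgt_minus)
      then have l0: "l \<noteq> 0" "w l = w x" using w_dominant[OF False, of "- (x - l)"] by simp_all
      have "vge (inverse (x * l)) (- (2 * w x))" using l0 False by (simp add: vge_def w_inverse w_mult)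
      from vgt_mult(2)[OF l(3) this] have "vgt ((x - l) * inverse (x * l)) r" by simp
      then have "vgt (- ((x - l) * inverse (x * l))) r" by (simp only: vgt_minus)
      moreover have "- ((x - l) * inverse (x * l)) = inverse x - inverse l"
        using False l0 by (simp add: field_simps)
      ultimately have "vgt (inverse x - inverse l) r" by (simp only:)
      then show "\<exists>l\<in>L. vgt (inverse x - l) r" using D(5)[OF l(1)] by blast
    qed
  qed
  show ?thesis unfolding is_subfield_def using D(1) subset_cl mult sub inv by blast
qed

lemma vge_linear_prod:
  "(\<And>y. y \<in> S \<Longrightarrow> vge y 0) \<Longrightarrow> vge (coeff (\<Prod>y\<in>S. [:-y, 1:]) i) 0"
proof (induction S arbitrary: i rule: infinite_finite_induct)
  case (insert y S)
  have "vge (coeff (\<Prod>y\<in>S. [:-y, 1:]) i) 0" for i using insert by blast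
  moreover have "vge y 0" using insert.prems by blast
  ultimately show ?case unfolding prod.insert[OF insert(1,2)]
    by (cases i) (auto intro!: vge_diff vge_mult0)
qed (auto simp: coeff_1)

lemma vgt_prod_ex:
  assumes "finite S" "\<And>y. y \<in> S \<Longrightarrow> vge (f y) 0" "vgt (prod f S) 0"
  shows "\<exists>y\<in>S. vgt (f y) 0"
proof (rule ccontr)
  assume neg: "\<not> ?thesis"
  then have "f y \<noteq> 0 \<and> w (f y) = 0" if "y \<in> S" for y
    using assms(2)[OF that] that by (auto simp: vgt_def vge_def)
  then have "prod f S \<noteq> 0 \<and> w (prod f S) = 0" using assms(1) by (simp add: w_prod)
  then show False using assms(3) by (simp add: vgt_def)
qed

text \<open>For the orbit of \<open>x\<close> under the automorphisms over \<open>L\<close> and its subset \<open>M\<close> of elements of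
  minimal value, the elementary symmetric polynomials of degree \<open>card M\<close> in the \<open>k\<close>-th powers of
  the orbit elements are dominated by the \<open>k\<close>-th power of \<open>\<Prod>M\<close>. Hence their quotients converge to
  \<open>\<Prod>M\<close>, which therefore lies in the closed field \<open>L\<close> and is fixed by all automorphisms.\<close>

lemma aut_preserves_value:
  assumes L: "is_subfield L" "cl L \<subseteq> L" and \<sigma>: "\<sigma> \<in> aut L"
  shows "w (\<sigma> x) = w x"
proof (cases "x = 0")
  case True
  then show ?thesis using \<sigma> by (simp add: aut_def hom_simps)
next
  case x0: False
  note G = aut_group_aut[of L]
  note hm = aut_groupD(2)[OF G]
  define B where "B = orbit (aut L) x"
  have finB: "finite B" unfolding B_def by (rule finite_orbit[OF G])
  have xB: "x \<in> B" unfolding B_def by (rule orbit_self[OF G])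
  have cB: "\<tau> y \<in> B" if "\<tau> \<in> aut L" "y \<in> B" for \<tau> y
    using that unfolding B_def by (rule orbit_closed[OF G])
  have B0: "y \<noteq> 0" if "y \<in> B" for y
    using that x0 hm by (auto simp: B_def orbit_def hom_simps)
  define m where "m = Min (w ` B)"
  have m_le: "m \<le> w y" if "y \<in> B" for y unfolding m_def using finB that by simp
  define M where "M = {y \<in> B. w y = m}"
  have MB: "M \<subseteq> B" "finite M" using finB by (auto simp: M_def)
  have "m \<in> w ` B" unfolding m_def using finB xB by (intro Min_in) auto
  then obtain y0 where y0: "y0 \<in> M" by (auto simp: M_def)
  define r where "r = card M"
  define Sr where "Sr = {S. S \<subseteq> B \<and> card S = r}"
  have finSr: "finite Sr" using finB by (simp add: Sr_def)
  have MSr: "M \<in> Sr" using MB by (simp add: Sr_def r_def)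
  define v where "v S = (\<Sum>y\<in>S. w y)" for S
  define \<mu> where "\<mu> = \<Prod>M"
  have wprod: "\<Prod>S \<noteq> 0 \<and> w (\<Prod>S) = v S" if "S \<in> Sr" for S
  proof -
    have fS: "finite S" "\<And>y. y \<in> S \<Longrightarrow> y \<noteq> 0" using that finite_subset[OF _ finB] B0 by (auto simp: Sr_def)
    then show ?thesis using w_prod[of S "\<lambda>y. y"] by (auto simp: v_def)
  qed
  have vM: "v M = of_nat r * m" unfolding v_def r_def by (simp add: M_def)
  have vS: "v M < v S" if S: "S \<in> Sr" "S \<noteq> M" for S
  proof -
    have fS: "finite S" "S \<subseteq> B" "card S = r" using S finite_subset[OF _ finB] by (auto simp: Sr_def)
    have "\<not> S \<subseteq> M" using S(2) fS MB(2) card_subset_eq[of M S] by (auto simp: r_def)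
    then obtain z where z: "z \<in> S" "z \<notin> M" by blast
    then have "m < w z" using m_le[of z] fS(2) by (auto simp: M_def order_less_le)
    then have "(\<Sum>y\<in>S. m) < (\<Sum>y\<in>S. w y)"
      using fS z(1) m_le by (intro sum_strict_mono_ex1) auto
    then show ?thesis using fS(3) vM by (simp add: v_def[of S])
  qed
  \<comment> \<open>There are finitely many subsets, hence a uniform gap \<open>\<delta>\<close>;
    the precision of the approximation below grows like \<open>k * \<delta>\<close>.\<close>
  have "\<exists>\<delta>>0. \<forall>S\<in>Sr - {M}. v M + \<delta> \<le> v S"
  proof (cases "Sr - {M} = {}")
    case True
    then show ?thesis by (intro exI[of _ 1]) auto
  next
    case False
    define d where "d = Min ((\<lambda>S. v S - v M) ` (Sr - {M}))"
    have "d \<in> (\<lambda>S. v S - v M) ` (Sr - {M})" unfolding d_def using finSr False by (intro Min_in) auto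
    then obtain S where "S \<in> Sr" "S \<noteq> M" "d = v S - v M" by blast
    then have "d > 0" using vS[of S] by simp
    moreover have "d \<le> v S - v M" if "S \<in> Sr - {M}" for S
      unfolding d_def using finSr that by (intro Min_le) auto
    ultimately show ?thesis by (intro exI[of _ d]) (auto simp: algebra_simps)
  qed
  then obtain \<delta> where \<delta>: "\<delta> > 0" "\<And>S. S \<in> Sr \<Longrightarrow> S \<noteq> M \<Longrightarrow> v M + \<delta> \<le> v S" by blast
  define e where "e k = (\<Sum>S\<in>Sr. \<Prod>S ^ k)" for k
  define E where "E k = (\<Sum>S\<in>Sr - {M}. \<Prod>S ^ k)" for k
  have eE: "e k = \<mu> ^ k + E k" for k
    unfolding e_def E_def \<mu>_def by (rule sum.remove[OF finSr MSr])
  have \<mu>: "\<mu> \<noteq> 0" "w \<mu> = v M" using wprod[OF MSr] by (simp_all add: \<mu>_def)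
  have vE: "vge (E k) (of_nat k * (v M + \<delta>))" for k
    unfolding E_def
  proof (rule vge_sum)
    fix S assume S: "S \<in> Sr - {M}"
    then have "of_nat k * (v M + \<delta>) \<le> of_nat k * v S" using \<delta>(2)[of S] by (intro mult_left_mono) auto
    then show "vge (\<Prod>S ^ k) (of_nat k * (v M + \<delta>))"
      using wprod[of S] S by (simp add: vge_def w_power)
  qed
  have img: "(`) \<tau> S \<in> Sr" and prd: "\<Prod>((`) \<tau> S) = \<tau> (\<Prod>S)" if t: "\<tau> \<in> aut L" and S: "S \<in> Sr" for \<tau> S
  proof -
    have inj: "inj_on \<tau> S" by (rule inj_onI) (simp add: hom_simps[OF hm[OF t]])
    then show "(`) \<tau> S \<in> Sr" using S cB[OF t] by (auto simp: Sr_def card_image)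
    show "\<Prod>((`) \<tau> S) = \<tau> (\<Prod>S)" using inj by (simp add: prod.reindex hom_prod[OF hm[OF t]])
  qed
  have eL: "e k \<in> L" for k
  proof -
    have "\<tau> (e k) = e k" if t: "\<tau> \<in> aut L" for \<tau>
    proof -
      have ti: "inj \<tau>" by (rule injI) (simp add: hom_simps[OF hm[OF t]])
      have inj: "inj_on ((`) \<tau>) Sr" by (rule inj_onI) (simp add: inj_image_eq_iff[OF ti])
      have sub: "((`) \<tau>) ` Sr \<subseteq> Sr" using img[OF t] by blast
      have "((`) \<tau>) ` Sr = Sr" by (rule card_subset_eq[OF finSr sub]) (rule card_image[OF inj])
      then have bb: "bij_betw ((`) \<tau>) Sr Sr" using inj by (simp add: bij_betw_def)
      have "\<tau> (e k) = (\<Sum>S\<in>Sr. \<Prod>((`) \<tau> S) ^ k)"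
        unfolding e_def hom_sum[OF hm[OF t]] by (intro sum.cong refl) (simp add: prd[OF t] hom_simps[OF hm[OF t]])
      also have "\<dots> = e k" unfolding e_def by (rule sum.reindex_bij_betw[OF bb])
      finally show ?thesis .
    qed
    then have "e k \<in> fixed (aut L)" by (simp add: fixed_def)
    then show ?thesis by (simp add: fixed_aut[OF L(1)])
  qed
  have "\<mu> \<in> cl L" unfolding cl_def
  proof (intro CollectI allI)
    fix s
    \<comment> \<open>Rank one enters here: multiples of \<open>\<delta>\<close> exceed every bound
      \<open>s\<close>.\<close>
    obtain k0 :: nat where k0: "(s - v M) / \<delta> < of_nat k0" using reals_Archimedean2 by blast
    define k where "k = Suc k0"
    have ks: "s < v M + of_nat k * \<delta>"
    proof -
      have "s - v M < of_nat k0 * \<delta>" using k0 \<delta>(1) by (simp add: pos_divide_less_eq)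
      also have "\<dots> \<le> of_nat k * \<delta>" using \<delta>(1) by (simp add: k_def)
      finally show ?thesis by simp
    qed
    have "vgt (E k) (w (\<mu> ^ k))"
    proof (rule vge_imp_vgt[OF vE])
      have "w (\<mu> ^ k) = of_nat k * v M" using w_power[OF \<mu>(1)] \<mu>(2) by simp
      moreover have "of_nat k * \<delta> > 0" using \<delta>(1) by (simp add: k_def)
      ultimately show "w (\<mu> ^ k) < of_nat k * (v M + \<delta>)" by (simp add: distrib_left)
    qed
    then have ek: "e k \<noteq> 0" "w (e k) = of_nat k * v M"
      using w_dominant[of "\<mu> ^ k" "E k"] \<mu> by (simp_all add: eE w_power)
    have "vge (\<mu> * E k) (v M + of_nat k * (v M + \<delta>))" using \<mu> by (intro vge_mult vE) (simp add: vge_def)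
    moreover have "vge (E (Suc k)) (v M + of_nat k * (v M + \<delta>))"
    proof -
      have "v M + of_nat k * (v M + \<delta>) \<le> of_nat (Suc k) * (v M + \<delta>)" using \<delta>(1) by (simp add: algebra_simps)
      then show ?thesis using vE[of "Suc k"] by (auto simp: vge_def)
    qed
    ultimately have "vge (\<mu> * E k - E (Suc k)) (v M + of_nat k * (v M + \<delta>))" by (rule vge_diff)
    moreover have "\<mu> * E k - E (Suc k) = \<mu> * e k - e (Suc k)" by (simp add: eE algebra_simps)
    ultimately have "vge (\<mu> * e k - e (Suc k)) (v M + of_nat k * (v M + \<delta>))" by (simp only:)
    moreover have "vge (inverse (e k)) (- (of_nat k * v M))" using ek by (simp add: vge_def w_inverse)
    ultimately have "vge ((\<mu> * e k - e (Suc k)) * inverse (e k)) (v M + of_nat k * (v M + \<delta>) + - (of_nat k * v M))"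
      by (rule vge_mult)
    moreover have "(\<mu> * e k - e (Suc k)) * inverse (e k) = \<mu> - e (Suc k) / e k"
      using ek(1) by (simp add: field_simps)
    moreover have "v M + of_nat k * (v M + \<delta>) + - (of_nat k * v M) = v M + of_nat k * \<delta>"
      by (simp add: algebra_simps)
    ultimately have "vge (\<mu> - e (Suc k) / e k) (v M + of_nat k * \<delta>)" by (simp only:)
    then have "vgt (\<mu> - e (Suc k) / e k) s" using ks by (rule vge_imp_vgt)
    then show "\<exists>l\<in>L. vgt (\<mu> - l) s" using is_subfieldD(8)[OF L(1) eL eL] by blast
  qed
  then have \<mu>L: "\<mu> \<in> L" using L(2) by blast
  have stable: "\<tau> y0 \<in> M" if t: "\<tau> \<in> aut L" for \<tau>
  proof -
    have "\<tau> ` M = M"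
    proof (rule ccontr)
      assume ne: "\<tau> ` M \<noteq> M"
      have "v M < v (\<tau> ` M)" by (rule vS[OF img[OF t MSr] ne])
      also have "\<dots> = w (\<tau> \<mu>)" using wprod[OF img[OF t MSr]] prd[OF t MSr] by (simp add: \<mu>_def)
      also have "\<tau> \<mu> = \<mu>" using t \<mu>L by (simp add: aut_def)
      finally show False using \<mu> by simp
    qed
    then show ?thesis using y0 by blast
  qed
  \<comment> \<open>Automorphisms keep \<open>y0\<close> inside \<open>M\<close> and act
    transitively on the orbit, so all conjugates have the minimal value.\<close>
  have "y \<in> M" if y: "y \<in> B" for y
  proof -
    obtain \<tau>1 where t1: "\<tau>1 \<in> aut L" "y0 = \<tau>1 x" using y0 MB by (auto simp: B_def orbit_def)
    obtain \<tau>2 where t2: "\<tau>2 \<in> aut L" "y = \<tau>2 x" using y by (auto simp: B_def orbit_def)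
    have "\<tau>2 \<circ> finv \<tau>1 \<in> aut L" using t1 t2 aut_groupD[OF G] by blast
    from stable[OF this] show ?thesis using t1 t2 fhom_inv(3)[OF hm[OF t1(1)]] by simp
  qed
  then have "w (\<sigma> x) = m" "w x = m" using cB[OF \<sigma> xB] xB by (auto simp: M_def)
  then show ?thesis by simp
qed

section \<open>Hensel's Lemma over closed fields\<close>

lemma poly_taylor_vge:
  assumes "\<And>i. vge (coeff f i) 0" "vge x 0" "vge y 0"
  shows "\<exists>q. vge q 0 \<and> poly f (x + y) = poly f x + y * poly (pderiv f) x + y * y * q"
  using assms(1)
proof (induction f)
  case 0
  then show ?case by (intro exI[of _ 0]) simp
next
  case (pCons a f)
  have fc: "vge (coeff f i) 0" for i using pCons.prems[of "Suc i"] by simp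
  then obtain q where q: "vge q 0" "poly f (x + y) = poly f x + y * poly (pderiv f) x + y * y * q"
    using pCons.IH by blast
  have "vge (coeff (pderiv f) i) 0" for i
    unfolding coeff_pderiv using fc by (intro vge_mult0) (auto simp del: of_nat_Suc)
  then have d: "vge (poly (pderiv f) x) 0" using assms(2) by (rule poly_vge)
  show ?case
  proof (intro exI conjI)
    show "vge (poly (pderiv f) x + x * q + y * q) 0"
      using d q assms by (intro vge_add vge_mult0)
    show "poly (pCons a f) (x + y) = poly (pCons a f) x + y * poly (pderiv (pCons a f)) x +
        y * y * (poly (pderiv f) x + x * q + y * q)"
      using q(2) by (simp add: pderiv_pCons algebra_simps)
  qed
qed

lemma poly_cg:
  assumes "\<And>i. vge (coeff f i) 0" "vge x 0" "cg x y"
  shows "cg (poly f x) (poly f y)"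
  using assms(1)
proof (induction f)
  case (pCons a f)
  have fc: "vge (coeff f i) 0" for i using pCons.prems[of "Suc i"] by simp
  have "cg (x * poly f x) (y * poly f y)"
    using pCons.IH[OF fc] assms poly_vge[OF fc cg_vge[OF assms(3,2)]] by (intro cg_mult)
  then have "cg (a + x * poly f x) (a + y * poly f y)" by (intro cg_add) simp_all
  then show ?case by simp
qed simp

text \<open>The logarithmic derivative \<open>\<Sum> 1 / (b - a)\<close> over the roots \<open>a\<close> of \<open>f\<close> has negative
  value at a simple residual root \<open>b\<close>, so that some root is close to \<open>b\<close>.\<close>

lemma root_near_residual_root:
  assumes b: "vgt (poly f b) 0" "\<not> vgt (poly (pderiv f) b) 0"
  shows "\<exists>a. poly f a = 0 \<and> cg a b"
proof (cases "poly f b = 0")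
  case True
  then show ?thesis by (intro exI[of _ b]) simp
next
  case fb: False
  then have "f \<noteq> 0" by auto
  then obtain A where A: "f = smult (lead_coeff f) (\<Prod>a\<in>#A. [:-a, 1:])" by (rule splits)
  have root: "poly f a = 0" if "a \<in># A" for a
    using that by (subst A) (auto simp: poly_prod_mset_linear prod_mset_zero_iff)
  then have nz: "b - a \<noteq> 0" if "a \<in># A" for a using that fb by auto
  show ?thesis
  proof (rule ccontr)
    assume neg: "\<not> ?thesis"
    have inv: "vge (inverse (b - a)) 0" if "a \<in># A" for a
    proof -
      have "\<not> cg b a" using neg root[OF that] cg_sym[of b a] by blast
      then show ?thesis using nz[OF that] by (simp add: vge_def vgt_def w_inverse)
    qed
    have "\<exists>s. vge s 0 \<and> poly (pderiv (\<Prod>a\<in>#A. [:-a, 1:])) b = poly (\<Prod>a\<in>#A. [:-a, 1:]) b * s"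
      using inv nz
    proof (induction A)
      case empty
      then show ?case by (intro exI[of _ 0]) simp
    next
      case (add a A)
      then obtain s where s: "vge s 0"
        "poly (pderiv (\<Prod>a\<in>#A. [:-a, 1:])) b = poly (\<Prod>a\<in>#A. [:-a, 1:]) b * s" by auto
      let ?h = "\<Prod>a\<in>#A. [:-a, 1:]"
      have e: "(\<Prod>a\<in>#add_mset a A. [:-a, 1:]) = [:-a, 1:] * ?h" by simp
      have "b - a \<noteq> 0" "vge (inverse (b - a)) 0" using add.prems by auto
      then have "vge (s + inverse (b - a)) 0" using s(1) by (intro vge_add)
      moreover have "poly (pderiv ([:-a, 1:] * ?h)) b = poly ([:-a, 1:] * ?h) b * (s + inverse (b - a))"
        unfolding pderiv_mult using s(2) \<open>b - a \<noteq> 0\<close> by (simp add: pderiv_pCons field_simps)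
      ultimately show ?case unfolding e by blast
    qed
    then obtain s where s: "vge s 0"
      "poly (pderiv (\<Prod>a\<in>#A. [:-a, 1:])) b = poly (\<Prod>a\<in>#A. [:-a, 1:]) b * s" by blast
    have "poly (pderiv f) b = poly f b * s"
      by (subst (1 2) A) (simp add: pderiv_smult s(2))
    then show False using b s(1) by (simp add: vgt_mult0)
  qed
qed

text \<open>If \<open>a' = a + y\<close> with \<open>y \<noteq> 0\<close>, Taylor expansion gives
  \<open>poly (pderiv f) a = - (y * q)\<close>, which lies in the maximal ideal and contradicts
  simplicity at \<open>b\<close>.\<close>

lemma simple_root_unique:
  assumes f: "\<And>i. vge (coeff f i) 0" and b: "vge b 0" "\<not> vgt (poly (pderiv f) b) 0"
    and a: "poly f a = 0" "cg a b" and a': "poly f a' = 0" "cg a' b"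
  shows "a = a'"
proof (rule ccontr)
  assume ne: "a \<noteq> a'"
  define y where "y = a' - a"
  have y: "y \<noteq> 0" "vgt y 0" using ne cg_trans[OF a'(2) cg_sym[OF a(2)]] by (auto simp: y_def)
  have va: "vge a 0" by (rule cg_vge[OF cg_sym[OF a(2)] b(1)])
  obtain q where q: "vge q 0" "poly f (a + y) = poly f a + y * poly (pderiv f) a + y * y * q"
    using poly_taylor_vge[OF f va vgt_imp_vge[OF y(2)]] by blast
  have "y * (poly (pderiv f) a + y * q) = 0" using q(2) a(1) a'(1) by (simp add: y_def algebra_simps)
  then have "poly (pderiv f) a = - (y * q)" using y(1) by (simp add: eq_neg_iff_add_eq_0)
  then have da: "vgt (poly (pderiv f) a) 0" using y(2) q(1) by (simp add: vgt_mult0)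
  have "vge (coeff (pderiv f) i) 0" for i
    unfolding coeff_pderiv using f by (intro vge_mult0) (auto simp del: of_nat_Suc)
  then have "cg (poly (pderiv f) b) (poly (pderiv f) a)" using b(1) cg_sym[OF a(2)] by (rule poly_cg)
  from vgt_add[OF this da] show False using b(2) by simp
qed

text \<open>A root near \<open>b\<close> exists in the algebraic closure. Automorphisms over
  \<open>L\<close> preserve values, so they map it to a root near \<open>b\<close>, which by
  uniqueness is the same one.\<close>

lemma henselian_of_closed:
  assumes L: "is_subfield L" "cl L \<subseteq> L" and f: "coeffs_in L f" "\<And>i. vge (coeff f i) 0"
    and b: "b \<in> L" "vge b 0" "vgt (poly f b) 0" "\<not> vgt (poly (pderiv f) b) 0"
  shows "\<exists>a\<in>L. poly f a = 0 \<and> cg a b"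
proof -
  obtain a where a: "poly f a = 0" "cg a b" using root_near_residual_root[OF b(3,4)] by blast
  have "\<sigma> a = a" if s: "\<sigma> \<in> aut L" for \<sigma>
  proof (rule simple_root_unique[OF f(2) b(2,4) _ _ a])
    have h: "fhom \<sigma>" and fx: "\<And>x. x \<in> L \<Longrightarrow> \<sigma> x = x" using s by (auto simp: aut_def)
    have "map_poly \<sigma> f = f" using f(1)
      by (intro poly_eqI) (simp add: coeff_map_poly hom_simps[OF h] fx coeffs_in_def)
    then show "poly f (\<sigma> a) = 0" using hom_poly[OF h, of f a] a(1) by (simp add: hom_simps[OF h])
    have "\<sigma> a - b = \<sigma> (a - b)" by (simp add: hom_simps[OF h] fx[OF b(1)])
    then show "cg (\<sigma> a) b" using a(2) aut_preserves_value[OF L s, of "a - b"]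
      by (auto simp: vgt_def hom_simps[OF h])
  qed
  then have "a \<in> fixed (aut L)" by (simp add: fixed_def)
  then show ?thesis using a by (auto simp: fixed_aut[OF L(1)])
qed

end

section \<open>Radicals and maximal fields\<close>

definition emb :: "qbar \<Rightarrow> complex" where
  "emb = (SOME e. fhom e \<and> range e = {x. algebraic x})"

lemma emb: "fhom emb" "range emb = {x. algebraic x}"
proof -
  have "\<exists>e :: qbar \<Rightarrow> complex. fhom e \<and> range e = {x. algebraic x}" using qbar_embedding by metis
  then have "fhom emb \<and> range emb = {x. algebraic x}" unfolding emb_def by (rule someI_ex)
  then show "fhom emb" "range emb = {x. algebraic x}" by blast+
qed

text \<open>The positive real root makes the radicals compatible under powers
  (\<open>rt_mult\<close>), which arbitrarily chosen roots would not be.\<close>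

definition rt :: "rat \<Rightarrow> nat \<Rightarrow> qbar" where
  "rt c n = finv emb (of_real (root n (of_rat c)))"

lemma complex_of_real_of_rat: "complex_of_real (of_rat q) = of_rat q"
  by (cases q) (simp add: of_rat_rat)

lemma emb_rt:
  assumes "c > 0" "n > 0"
  shows "emb (rt c n) = of_real (root n (of_rat c))"
proof -
  let ?x = "complex_of_real (root n (of_rat c))"
  have xn: "?x ^ n = of_rat c" using assms by (simp add: complex_of_real_of_rat flip: of_real_power)
  have "algebraic ?x"
  proof (rule algebraicI')
    show "coeff (monom 1 n - [:of_rat c:]) i \<in> \<rat>" for i
      by (auto simp: coeff_pCons split: nat.splits)
    show "poly (monom 1 n - [:of_rat c:]) ?x = 0" using xn by (simp add: poly_monom)
    have "coeff (monom 1 n - [:of_rat c:]) n = (1 :: complex)" using assms(2) by (cases n) auto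
    then show "monom 1 n - [:of_rat c:] \<noteq> (0 :: complex poly)" by (metis coeff_0 zero_neq_one)
  qed
  then have "?x \<in> range emb" using emb(2) by simp
  then show ?thesis unfolding rt_def by (rule f_inv_into_f)
qed

lemma rt_power: "c > 0 \<Longrightarrow> n > 0 \<Longrightarrow> rt c n ^ n = of_rat c"
proof -
  assume c: "c > 0" "n > 0"
  have "emb (rt c n ^ n) = of_real (root n (of_rat c) ^ n)"
    by (simp only: hom_simps(9)[OF emb(1)] emb_rt[OF c] of_real_power)
  also have "\<dots> = of_rat c" using c by (simp add: complex_of_real_of_rat)
  also have "\<dots> = emb (of_rat c)" by (simp add: hom_of_rat[OF emb(1)])
  finally show ?thesis by (simp only: hom_simps(11)[OF emb(1)])
qed

lemma rt_mult: "c > 0 \<Longrightarrow> n > 0 \<Longrightarrow> m > 0 \<Longrightarrow> rt c (n * m) ^ m = rt c n"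
proof -
  assume c: "c > 0" "n > 0" "m > 0"
  have "emb (rt c (n * m) ^ m) = of_real (root (m * n) (of_rat c) ^ m)"
    using c by (simp add: hom_simps(9)[OF emb(1)] emb_rt mult.commute)
  also have "root (m * n) (of_rat c) ^ m = root n (real_of_rat c)"
    unfolding real_root_mult_exp using c by (intro real_root_pow_pos) (auto intro: real_root_gt_zero)
  also have "of_real (root n (real_of_rat c)) = emb (rt c n)" using emb_rt c by simp
  finally show ?thesis by (simp only: hom_simps(11)[OF emb(1)])
qed

lemma rt_nz: "c > 0 \<Longrightarrow> n > 0 \<Longrightarrow> rt c n \<noteq> 0"
  using rt_power[of c n] by (auto simp: zero_power)

lemma rats_subfield: "is_subfield (\<rat> :: qbar set)"
  by (auto simp: is_subfield_def)

lemma chain_Union_subfield: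
  assumes "C \<noteq> {}" "subset.chain {L. is_subfield L} C"
  shows "is_subfield (\<Union>C)"
  unfolding is_subfield_def
proof (intro conjI ballI)
  have C: "is_subfield G" if "G \<in> C" for G using assms(2) that by (auto simp: subset.chain_def)
  show "1 \<in> \<Union>C" using assms(1) C is_subfieldD(1) by blast
  show "inverse x \<in> \<Union>C" if "x \<in> \<Union>C" for x using that C is_subfieldD(5) by blast
  fix x y assume "x \<in> \<Union>C" "y \<in> \<Union>C"
  then obtain G where "G \<in> C" "x \<in> G" "y \<in> G" using assms(2) unfolding subset.chain_def by blast
  then show "x - y \<in> \<Union>C" "x * y \<in> \<Union>C" using is_subfieldD(3,4)[OF C] by blast+
qed

context padic_qbar
begin

lemma w_sum_distinct:
  assumes I: "finite I" "I \<noteq> {}" and t: "\<And>i. i \<in> I \<Longrightarrow> t i \<noteq> 0" and inj: "inj_on (\<lambda>i. w (t i)) I"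
  shows "\<exists>i\<in>I. w (sum t I) = w (t i) \<and> (\<forall>j\<in>I. w (t i) \<le> w (t j))"
proof -
  have "Min ((\<lambda>i. w (t i)) ` I) \<in> (\<lambda>i. w (t i)) ` I" using I by (intro Min_in) auto
  then obtain i where i: "i \<in> I" "w (t i) = Min ((\<lambda>i. w (t i)) ` I)" by auto
  have le: "w (t i) \<le> w (t j)" if "j \<in> I" for j unfolding i(2) using I that by (intro Min_le) auto
  have "vgt (sum t (I - {i})) (w (t i))"
  proof (rule vgt_sum)
    fix j assume j: "j \<in> I - {i}"
    then have "w (t i) \<noteq> w (t j)" using inj i(1) by (auto simp: inj_on_def)
    then show "vgt (t j) (w (t i))" using le[of j] j by (simp add: vgt_def)
  qed
  then have "w (t i + sum t (I - {i})) = w (t i)" by (rule w_dominant(2)[OF t[OF i(1)]])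
  then show ?thesis using i(1) le I(1) by (metis sum.remove)
qed

lemma padic_Ints: "padic_valuation p q \<in> \<int>"
  by (simp add: padic_valuation_def)

text \<open>A \<open>p\<close>-integral fraction in lowest terms has a denominator prime to
  \<open>p\<close>, so Fermat's congruence for numerator and denominator carries over to the
  quotient.\<close>

lemma rat_residue:
  assumes "vge (of_rat q) 0"
  shows "cg (of_rat q ^ p) (of_rat q)"
proof (cases "q = 0")
  case True
  then show ?thesis using p_pos by (simp add: zero_power)
next
  case False
  obtain a b where ab: "quotient_of q = (a, b)" by fastforce
  have b: "b > 0" "coprime a b" using quotient_of_denom_pos[OF ab] quotient_of_coprime[OF ab] by simp_all
  have q: "q = of_int a / of_int b" using quotient_of_div[OF ab] by simp
  have a: "a \<noteq> 0" using False q by auto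
  define A B x :: qbar where "A = of_int a" and "B = of_int b" and "x = of_rat q"
  have x: "x = A / B" by (simp add: x_def q of_rat_divide A_def B_def)
  have nz: "A \<noteq> 0" "B \<noteq> 0" "x \<noteq> 0" using a b False by (simp_all add: A_def B_def x_def)
  have vB: "w B = 0"
  proof (cases "int p dvd b")
    case True
    have "\<not> int p dvd a"
    proof
      assume "int p dvd a"
      then have "is_unit (int p)" using True by (rule coprime_common_divisor[OF b(2)])
      then show False using p_pos(2) by simp
    qed
    then have "w A = 0" unfolding A_def by (rule w_int_unit)
    moreover have "w B > 0" using True b p unfolding B_def
      by (simp add: w_int prime_multiplicity_gt_zero_iff)
    moreover have "w x \<ge> 0" using assms nz by (simp add: vge_def x_def)
    ultimately show ?thesis using w_divide[OF nz(1,2)] x by simp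
  next
    case False
    then show ?thesis unfolding B_def by (rule w_int_unit)
  qed
  have Bx: "B * x = A" using nz by (simp add: x)
  have "cg (B ^ p * x ^ p) A" using fermat_int[of a] by (simp add: Bx A_def flip: power_mult_distrib)
  moreover have "cg A (B ^ p * x)"
  proof -
    have "cg (B * x) (B ^ p * x)"
      using cg_sym[OF fermat_int[of b]] assms by (intro cg_mult) (auto simp: B_def x_def)
    then show ?thesis unfolding Bx .
  qed
  ultimately have "cg (B ^ p * x ^ p) (B ^ p * x)" by (rule cg_trans)
  then have "cg (x ^ p) x" by (rule cg_cancel) (use nz vB in \<open>auto simp: w_power\<close>)
  then show ?thesis by (simp add: x_def)
qed

end

locale radical_qbar = padic_qbar +
  fixes c :: rat
  assumes c_pos: "c > 0" and c_val: "padic_valuation p c = 1"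
begin

abbreviation d :: "nat \<Rightarrow> qbar" where "d n \<equiv> rt c n"

lemma w_c: "w (of_rat c) = 1"
  using w_rat[of c] c_pos c_val by simp

lemma d_nz: "n > 0 \<Longrightarrow> d n \<noteq> 0" using rt_nz[OF c_pos] .

lemma d_power: "n > 0 \<Longrightarrow> d n ^ n = of_rat c" using rt_power[OF c_pos] .

lemma d_mult: "n > 0 \<Longrightarrow> m > 0 \<Longrightarrow> d (n * m) ^ m = d n" using rt_mult[OF c_pos] .

lemma w_d: "n > 0 \<Longrightarrow> w (d n) = 1 / of_nat n"
  using w_power[OF d_nz, of n n] d_power[of n] w_c by (simp add: field_simps)

text \<open>This is the \<open>p\<close>-divisible hull of \<open>1/2 Z\<close>, in a form suited to
  clearing denominators.\<close>

definition Gam :: "rat set" where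
  "Gam = {r. \<exists>k. of_nat (p ^ k) * (2 * r) \<in> \<int>}"

text \<open>The last clause expresses that residues lie in \<open>F_p\<close>, the root set of
  \<open>X ^ p - X\<close>.\<close>

definition good :: "qbar set \<Rightarrow> bool" where
  "good L \<longleftrightarrow> is_subfield L \<and> (\<forall>k. d (2 * p ^ k) \<in> L) \<and>
    (\<forall>x\<in>L. x \<noteq> 0 \<longrightarrow> w x \<in> Gam) \<and> (\<forall>x\<in>L. vge x 0 \<longrightarrow> cg (x ^ p) x)"

definition base :: "nat \<Rightarrow> qbar set" where
  "base k = {poly h (d (2 * p ^ k)) |h. coeffs_in \<rat> h}"

lemma base_subfield: "is_subfield (base k)"
  unfolding base_def by (rule adjoin_subfield[OF rats_subfield algebraic_over_subfield[OF rats_subfield]])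

lemma base_d: "d (2 * p ^ k) \<in> base k"
  unfolding base_def by (intro CollectI exI[of _ "[:0, 1:]"])
    (auto simp: coeffs_in_def coeff_pCons split: nat.splits)

lemma base_Suc: "base k \<subseteq> base (Suc k)"
proof
  fix x assume "x \<in> base k"
  then obtain h where h: "coeffs_in \<rat> h" "x = poly h (d (2 * p ^ k))" by (auto simp: base_def)
  note B = base_subfield[of "Suc k"]
  have "coeffs_in (base (Suc k)) h"
    using h(1) is_subfield_of_rat[OF B] unfolding coeffs_in_def by (metis Rats_cases)
  moreover have "d (2 * p ^ k) \<in> base (Suc k)"
  proof -
    have "d (2 * p ^ k) = d (2 * p ^ Suc k) ^ p"
      using d_mult[of "2 * p ^ k" p] p_pos by (simp add: mult_ac)
    then show ?thesis using is_subfieldD(9)[OF B base_d] by simp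
  qed
  ultimately show "x \<in> base (Suc k)" unfolding h(2) by (rule poly_coeffs_in[OF B])
qed

lemma base_mono: "k \<le> l \<Longrightarrow> base k \<subseteq> base l"
  by (rule lift_Suc_mono_le[of base]) (use base_Suc in auto)

text \<open>Take the remainder modulo \<open>X ^ n - c\<close>. The bound on the degree is what
  later keeps the values of the monomials distinct.\<close>

lemma rat_poly_reduce:
  assumes "n > 0" "coeffs_in \<rat> h"
  obtains g :: "rat poly" where "degree g < n" "poly h (d n) = poly (map_poly of_rat g) (d n)"
proof -
  define of_r where "of_r = (of_rat :: rat \<Rightarrow> qbar)"
  have hr: "fhom of_r" by (simp add: of_r_def hom_on_def of_rat_add of_rat_mult)
  define f where "f x = (THE q. x = of_r q)" for x
  have f: "f (of_r q) = q" for q by (simp add: f_def of_r_def)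
  have f0: "f 0 = 0" using f[of 0] by (simp add: of_r_def)
  define h' where "h' = map_poly f h"
  have h: "map_poly of_r h' = h"
  proof (rule poly_eqI)
    fix i
    obtain q where "coeff h i = of_r q" using assms(2) unfolding coeffs_in_def of_r_def by (metis Rats_cases)
    then show "coeff (map_poly of_r h') i = coeff h i"
      by (simp add: h'_def coeff_map_poly f f0 hom_simps[OF hr])
  qed
  define m where "m = monom 1 n + [:- c:]"
  have dm: "degree m = n" using assms(1) unfolding m_def
    by (subst degree_add_eq_left) (simp_all add: degree_monom_eq)
  have m0: "poly (map_poly of_r m) (d n) = 0"
  proof -
    have "map_poly of_r (monom 1 n) = monom 1 n"
      by (rule poly_eqI) (simp add: coeff_map_poly hom_simps[OF hr])
    then show ?thesis using d_power[OF assms(1)]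
      by (simp add: m_def hom_map_poly[OF hr] poly_monom map_poly_pCons hom_simps[OF hr]) (simp add: of_r_def)
  qed
  show ?thesis
  proof (rule that[of "h' mod m"])
    have "m \<noteq> 0" using dm assms(1) by auto
    then show "degree (h' mod m) < n" using degree_mod_less'[of m h'] dm assms(1)
      by (cases "h' mod m = 0") auto
    have "map_poly of_r h' = map_poly of_r (h' div m) * map_poly of_r m + map_poly of_r (h' mod m)"
      by (simp flip: hom_map_poly(1,2)[OF hr])
    then have "poly (map_poly of_r h') (d n) = poly (map_poly of_r (h' mod m)) (d n)" using m0 by simp
    then show "poly h (d n) = poly (map_poly of_rat (h' mod m)) (d n)" unfolding h unfolding of_r_def .
  qed
qed

text \<open>Monomials with exponents \<open>i < n\<close> have values in the distinct classes
  \<open>i / n\<close> modulo 1. So the value of \<open>x\<close> is that of one monomial, and only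
  the constant term contributes to the residue: the extension is totally ramified.\<close>

lemma base_properties:
  assumes x: "x \<in> base k" "x \<noteq> 0"
  shows "w x \<in> Gam" "vge x 0 \<Longrightarrow> cg (x ^ p) x"
proof -
  define n where "n = 2 * p ^ k"
  have n: "n > 0" using p_pos by (simp add: n_def)
  obtain h where "coeffs_in \<rat> h" "x = poly h (d n)" using x(1) by (auto simp: base_def n_def)
  then obtain g :: "rat poly" where g: "degree g < n" "x = poly (map_poly of_rat g) (d n)"
    using rat_poly_reduce[OF n] by metis
  define I where "I = {i. coeff g i \<noteq> 0}"
  define t where "t i = of_rat (coeff g i) * d n ^ i" for i
  have I: "finite I" "I \<subseteq> {..degree g}" unfolding I_def by (auto intro: le_degree finite_subset[of _ "{..degree g}"])
  have "x = (\<Sum>i\<le>degree g. t i)" proof -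
    have "degree (map_poly (of_rat :: rat \<Rightarrow> qbar) g) = degree g" by (rule degree_map_poly) simp
    then show ?thesis unfolding g(2) poly_altdef t_def by (simp add: coeff_map_poly)
  qed
  also have "\<dots> = sum t I" using I by (intro sum.mono_neutral_right) (auto simp: I_def t_def)
  finally have xt: "x = sum t I" .
  have tnz: "t i \<noteq> 0" if "i \<in> I" for i using that d_nz[OF n] by (simp add: t_def I_def)
  have wt: "w (t i) = padic_valuation p (coeff g i) + of_nat i / of_nat n" if "i \<in> I" for i
    using that d_nz[OF n] by (simp add: t_def I_def w_mult w_power w_rat w_d[OF n])
  have small: "i = j" if ij: "i < n" "j < n" "of_nat i / of_nat n - of_nat j / of_nat n \<in> (\<int> :: rat set)" for i j
  proof -
    obtain z where z: "of_nat i / of_nat n - of_nat j / of_nat n = (of_int z :: rat)"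
      using ij(3) by (auto elim: Ints_cases)
    then have "(of_int (int i - int j) :: rat) = of_int (z * int n)" using n by (simp add: field_simps)
    then have e: "int i - int j = z * int n" by (simp only: of_int_eq_iff)
    then have "int n dvd int i - int j" by simp
    then have "int i - int j = 0 \<or> int n \<le> \<bar>int i - int j\<bar>"
      using dvd_imp_le_int[of "int i - int j" "int n"] by auto
    then show ?thesis using ij by linarith
  qed
  have In: "i < n" if "i \<in> I" for i using that I(2) g(1) by auto
  have inj: "inj_on (\<lambda>i. w (t i)) I"
  proof (rule inj_onI)
    fix i j assume ij: "i \<in> I" "j \<in> I" "w (t i) = w (t j)"
    have "of_nat i / of_nat n - of_nat j / of_nat n
        = padic_valuation p (coeff g j) - padic_valuation p (coeff g i)"
      using ij(3) wt[OF ij(1)] wt[OF ij(2)] by (simp add: algebra_simps)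
    also have "\<dots> \<in> \<int>" using padic_Ints by (intro Ints_diff)
    finally show "i = j" using small In ij by blast
  qed
  have "I \<noteq> {}" using x(2) xt by auto
  from w_sum_distinct[OF I(1) this tnz inj]
  obtain i where i: "i \<in> I" "w x = w (t i)" "\<And>j. j \<in> I \<Longrightarrow> w (t i) \<le> w (t j)" unfolding xt by blast
  have "of_nat (p ^ k) * (2 * w x) = of_nat n * padic_valuation p (coeff g i) + of_nat i"
    unfolding i(2) wt[OF i(1)] using n by (simp add: n_def field_simps)
  also have "\<dots> \<in> \<int>" using padic_Ints by auto
  finally show "w x \<in> Gam" by (auto simp: Gam_def)
  assume "vge x 0"
  then have wt0: "w (t j) \<ge> 0" if "j \<in> I" for j using i that x(2) by (auto simp: vge_def intro: order_trans)
  have pos: "vgt (t j) 0" if j: "j \<in> I" "j \<noteq> 0" for j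
  proof -
    have "w (t j) \<noteq> 0"
    proof
      assume "w (t j) = 0"
      then have "of_nat j / of_nat n - of_nat 0 / of_nat n = - padic_valuation p (coeff g j)"
        using wt[OF j(1)] by simp
      also have "\<dots> \<in> \<int>" using padic_Ints by simp
      finally show False using small[of j 0] In[OF j(1)] n j(2) by blast
    qed
    then show ?thesis using wt0[OF j(1)] by (simp add: vgt_def)
  qed
  define q0 where "q0 = coeff g 0"
  have "x - of_rat q0 = sum t (I - {0})"
  proof (cases "0 \<in> I")
    case True
    then show ?thesis unfolding xt using I(1) by (simp add: sum.remove t_def q0_def)
  next
    case False
    then have "q0 = 0" "I - {0} = I" by (auto simp: I_def q0_def)
    then show ?thesis by (simp add: xt)
  qed
  also have "vgt \<dots> 0" by (rule vgt_sum) (use pos in auto)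
  finally have xq: "cg x (of_rat q0)" .
  have "vge (of_rat q0) 0" by (rule cg_vge[OF xq \<open>vge x 0\<close>])
  then have "cg (of_rat q0 ^ p) (of_rat q0)" by (rule rat_residue)
  then show "cg (x ^ p) x" using cg_trans[OF cg_power[OF xq \<open>vge x 0\<close>] cg_trans[OF _ cg_sym[OF xq]]] by blast
qed

lemma good_base: "good (\<Union>k. base k)"
  unfolding good_def
proof (intro conjI allI ballI impI)
  have "subset.chain {L. is_subfield L} (range base)"
    unfolding subset_chain_def
  proof (intro conjI ballI)
    show "range base \<subseteq> {L. is_subfield L}" using base_subfield by blast
    fix A B assume "A \<in> range base" "B \<in> range base"
    then obtain k l where "A = base k" "B = base l" by blast
    then show "A \<subseteq> B \<or> B \<subseteq> A" using base_mono[of k l] base_mono[of l k] by (cases "k \<le> l") auto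
  qed
  then show "is_subfield (\<Union>k. base k)" by (intro chain_Union_subfield) auto
  show "d (2 * p ^ k) \<in> (\<Union>k. base k)" for k using base_d by blast
  show "w x \<in> Gam" if "x \<in> (\<Union>k. base k)" "x \<noteq> 0" for x using that base_properties(1) by blast
  show "cg (x ^ p) x" if "x \<in> (\<Union>k. base k)" "vge x 0" for x
    using that base_properties(2) p_pos by (cases "x = 0") (auto simp: zero_power)
qed

lemma maximal_good_exists: "\<exists>L. good L \<and> (\<forall>K. good K \<longrightarrow> L \<subseteq> K \<longrightarrow> K = L)"
proof -
  have "\<exists>M\<in>{L. good L}. \<forall>G\<in>{L. good L}. M \<subseteq> G \<longrightarrow> G = M"
  proof (rule subset_Zorn_nonempty)
    show "{L. good L} \<noteq> {}" using good_base by blast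
    fix C assume C: "C \<noteq> {}" "subset.chain {L. good L} C"
    have CG: "good G" if "G \<in> C" for G using C that by (auto simp: subset.chain_def)
    have "subset.chain {L. is_subfield L} C" using C(2) by (auto simp: subset.chain_def good_def)
    then have "is_subfield (\<Union>C)" by (rule chain_Union_subfield[OF C(1)])
    then show "\<Union>C \<in> {L. good L}" using C(1) CG unfolding good_def by blast
  qed
  then show ?thesis by blast
qed

text \<open>An approximation of \<open>x\<close> closer than \<open>w x\<close> has the same value,
  and one closer than 0 has the same residue.\<close>

lemma good_cl:
  assumes L: "good L"
  shows "good (cl L)"
  unfolding good_def
proof (intro conjI allI ballI impI)
  have sL: "is_subfield L" using L by (simp add: good_def)
  show "is_subfield (cl L)" by (rule cl_subfield[OF sL])
  show "d (2 * p ^ k) \<in> cl L" for k using L subset_cl[of L] unfolding good_def by blast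
  fix x assume x: "x \<in> cl L"
  show "w x \<in> Gam" if nz: "x \<noteq> 0"
  proof -
    obtain l where l: "l \<in> L" "vgt (x - l) (w x)" using x unfolding cl_def by blast
    then have "vgt (- (x - l)) (w x)" by (simp only: vgt_minus)
    from w_dominant[OF nz this] have "l \<noteq> 0" "w l = w x" by simp_all
    then show ?thesis using L l(1) unfolding good_def by metis
  qed
  show "cg (x ^ p) x" if v: "vge x 0"
  proof -
    obtain l where l: "l \<in> L" "cg x l" using x unfolding cl_def by blast
    have "cg (l ^ p) l" using L l(1) cg_vge[OF l(2) v] unfolding good_def by blast
    then show ?thesis using cg_trans[OF cg_power[OF l(2) v] cg_trans[OF _ cg_sym[OF l(2)]]] by blast
  qed
qed

end

section \<open>Frobenius lifts and generators of tame inertia\<close>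

lemma roots_of_unity:
  assumes "n > 0"
  shows "finite {z :: 'a::idom. z ^ n = 1}" "card {z :: 'a. z ^ n = 1} \<le> n"
proof -
  define h :: "'a poly" where "h = monom 1 n + [:-1:]"
  have dh: "degree h = n" using assms unfolding h_def
    by (subst degree_add_eq_left) (simp_all add: degree_monom_eq)
  then have "h \<noteq> 0" using assms by auto
  moreover have "{z. z ^ n = 1} = {z. poly h z = 0}" by (simp add: h_def poly_monom)
  ultimately show "finite {z :: 'a. z ^ n = 1}" "card {z :: 'a. z ^ n = 1} \<le> n"
    using poly_roots_finite[of h] card_poly_roots_bound[of h] dh by simp_all
qed

locale maximal_field = radical_qbar +
  fixes L :: "qbar set"
  assumes good_L: "good L" and maximal_L: "\<And>K. good K \<Longrightarrow> L \<subseteq> K \<Longrightarrow> K = L"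
begin

abbreviation G :: "(qbar \<Rightarrow> qbar) set" where "G \<equiv> aut L"

lemma L_subfield: "is_subfield L" and L_d: "d (2 * p ^ k) \<in> L"
  and L_Gam: "x \<in> L \<Longrightarrow> x \<noteq> 0 \<Longrightarrow> w x \<in> Gam"
  and L_residue: "x \<in> L \<Longrightarrow> vge x 0 \<Longrightarrow> cg (x ^ p) x"
  using good_L unfolding good_def by blast+

lemma L_closed: "cl L \<subseteq> L"
  using maximal_L[OF good_cl[OF good_L] subset_cl] by simp

lemma G_group: "aut_group G" by (rule aut_group_aut)

lemmas G_hom = aut_groupD(2)[OF G_group]
lemmas G_simps = hom_simps[OF G_hom]

lemma G_w: "\<sigma> \<in> G \<Longrightarrow> w (\<sigma> x) = w x"
  by (rule aut_preserves_value[OF L_subfield L_closed])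

lemma G_fixed: "fixed G = L" by (rule fixed_aut[OF L_subfield])

lemma G_L: "\<sigma> \<in> G \<Longrightarrow> x \<in> L \<Longrightarrow> \<sigma> x = x" by (simp add: aut_def)

lemma G_vgt: "\<sigma> \<in> G \<Longrightarrow> vgt (\<sigma> x) r \<longleftrightarrow> vgt x r"
  by (simp add: vgt_def G_w G_simps)

lemma G_cg: "\<sigma> \<in> G \<Longrightarrow> cg (\<sigma> x) (\<sigma> y) \<longleftrightarrow> cg x y"
  using G_vgt[of \<sigma> "x - y" 0] by (simp add: G_simps)

lemma G_root: "\<sigma> \<in> G \<Longrightarrow> z ^ n = 1 \<Longrightarrow> \<sigma> z ^ n = 1"
  using G_simps(9)[of \<sigma> z n] G_simps(1)[of \<sigma>] by simp

lemma G_mu: "\<sigma> \<in> G \<Longrightarrow> z \<in> mu \<Longrightarrow> \<sigma> z \<in> mu"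
  using G_root by (auto simp: mu_def)

lemma mu_vge: "z \<in> mu \<Longrightarrow> vge z 0" using mu_unit by (simp add: vge_def)

text \<open>The orbit polynomial of \<open>z\<close> has coefficients in \<open>L\<close>, with
  residues in \<open>F_p\<close>, so \<open>z ^ p\<close> is a residual root. It is congruent to a
  conjugate of \<open>z\<close>, and equal to it because both lie in \<open>mu\<close>.\<close>

lemma frobenius_on_root:
  assumes z: "z \<in> mu"
  shows "\<exists>\<sigma>\<in>G. \<sigma> z = z ^ p"
proof -
  let ?B = "orbit G z" and ?f = "orbit_poly G z"
  have Bmu: "y \<in> mu" if "y \<in> ?B" for y using that G_mu[OF _ z] by (auto simp: orbit_def)
  have fc: "vge (coeff ?f i) 0" for i unfolding orbit_poly_def using Bmu by (intro vge_linear_prod mu_vge)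
  have "coeff ?f i \<in> L" for i
    using orbit_poly_fixed[OF G_group, of z] unfolding G_fixed coeffs_in_def by blast
  then have "cg (poly ?f z ^ p) (poly ?f (z ^ p))"
    using fc L_residue mu_vge[OF z] by (intro frobenius_poly) auto
  moreover have "poly ?f z = 0" using orbit_poly_root[OF G_group] orbit_self[OF G_group] by simp
  ultimately have "vgt (poly ?f (z ^ p)) 0" using p_pos vgt_minus[of "poly ?f (z ^ p)" 0] by (simp add: zero_power)
  then have "vgt (\<Prod>y\<in>?B. z ^ p - y) 0" by (simp add: orbit_poly_value)
  then have "\<exists>y\<in>?B. cg (z ^ p) y"
    by (intro vgt_prod_ex finite_orbit[OF G_group] vge_diff mu_vge mu_power[OF z] Bmu)
  then obtain y where "y \<in> ?B" "cg (z ^ p) y" by blast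
  then have "y \<in> ?B" "z ^ p = y" using mu_inj[OF mu_power[OF z] Bmu] by blast+
  then show ?thesis by (auto simp: orbit_def)
qed

text \<open>Lagrange interpolation at the conjugates of \<open>z\<close> recovers \<open>x\<close> from the traces of
  \<open>x * z ^ j\<close>, which lie in \<open>L\<close>: adjoining roots of unity of order prime to \<open>p\<close> does not
  enlarge the value group.\<close>

lemma value_in_Gam:
  assumes z: "z \<in> mu" and x: "x \<noteq> 0" "\<And>\<sigma>. \<sigma> \<in> G \<Longrightarrow> \<sigma> z = z \<Longrightarrow> \<sigma> x = x"
  shows "w x \<in> Gam"
proof -
  let ?B = "orbit G z"
  have finB: "finite ?B" and zB: "z \<in> ?B" by (rule finite_orbit[OF G_group], rule orbit_self[OF G_group])
  have Bmu: "y \<in> mu" if "y \<in> ?B" for y using that G_mu[OF _ z] by (auto simp: orbit_def)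
  \<comment> \<open>\<open>f\<close> sends the conjugate \<open>\<sigma> z\<close> to
    \<open>\<sigma> x\<close>, which is well defined since the stabilizer of \<open>z\<close> fixes
    \<open>x\<close>.\<close>
  define f where "f y = (SOME \<sigma>. \<sigma> \<in> G \<and> \<sigma> z = y) x" for y
  have f: "f (\<sigma> z) = \<sigma> x" if s: "\<sigma> \<in> G" for \<sigma>
  proof -
    define \<tau> where "\<tau> = (SOME \<tau>. \<tau> \<in> G \<and> \<tau> z = \<sigma> z)"
    have t: "\<tau> \<in> G \<and> \<tau> z = \<sigma> z" unfolding \<tau>_def by (rule someI[of _ \<sigma>]) (use s in simp)
    note si = fhom_inv[OF G_hom[OF s]]
    have "finv \<sigma> \<circ> \<tau> \<in> G" using aut_groupD[OF G_group] s t by blast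
    moreover have "(finv \<sigma> \<circ> \<tau>) z = z" using t by (simp add: si)
    ultimately have "(finv \<sigma> \<circ> \<tau>) x = x" by (rule x(2))
    then have "\<tau> x = \<sigma> x" using si(2)[of "\<tau> x"] by simp
    then show ?thesis unfolding f_def \<tau>_def .
  qed
  define s where "s j = (\<Sum>y\<in>?B. f y * y ^ j)" for j
  have sL: "s j \<in> L" for j
  proof -
    have "\<tau> (s j) = s j" if t: "\<tau> \<in> G" for \<tau>
    proof -
      have "\<tau> (s j) = (\<Sum>y\<in>?B. f (\<tau> y) * (\<tau> y) ^ j)"
        unfolding s_def hom_sum[OF G_hom[OF t]]
      proof (intro sum.cong refl)
        fix y assume "y \<in> ?B"
        then obtain \<sigma> where s: "\<sigma> \<in> G" "y = \<sigma> z" by (auto simp: orbit_def)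
        have "\<tau> \<circ> \<sigma> \<in> G" by (rule aut_groupD(4)[OF G_group t s(1)])
        from f[OF this] show "\<tau> (f y * y ^ j) = f (\<tau> y) * \<tau> y ^ j" using s f by (simp add: G_simps[OF t])
      qed
      also have "\<dots> = s j" unfolding s_def
        by (rule sum.reindex_bij_betw[OF stable_bij[OF G_hom[OF t] finB]]) (rule orbit_closed[OF G_group t])
      finally show ?thesis .
    qed
    then have "s j \<in> fixed G" by (simp add: fixed_def)
    then show ?thesis by (simp add: G_fixed)
  qed
  have fx: "f y \<noteq> 0" "w (f y) = w x" if "y \<in> ?B" for y
    using that f x(1) by (auto simp: orbit_def G_w G_simps)
  \<comment> \<open>The Lagrange numerator: it vanishes at the other conjugates, and its value at
    \<open>z\<close> is a unit because the conjugates are incongruent.\<close>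
  define g where "g = (\<Prod>y\<in>?B - {z}. [:-y, 1:])"
  have gc: "vge (coeff g i) 0" for i unfolding g_def using Bmu by (intro vge_linear_prod mu_vge) auto
  have gy: "poly g y = (\<Prod>u\<in>?B - {z}. y - u)" for y by (simp add: g_def poly_prod)
  have gz: "poly g z \<noteq> 0" "w (poly g z) = 0"
  proof -
    have *: "z - u \<noteq> 0 \<and> w (z - u) = 0" if "u \<in> ?B - {z}" for u
    proof -
      have "\<not> cg z u" using mu_inj[OF z Bmu] that by auto
      moreover have "vge (z - u) 0" using that Bmu z by (intro vge_diff mu_vge) auto
      ultimately show ?thesis by (auto simp: vgt_def vge_def)
    qed
    then show "poly g z \<noteq> 0" "w (poly g z) = 0" unfolding gy
      using finB * w_prod[of "?B - {z}" "\<lambda>u. z - u"] by (simp_all add: prod_zero_iff)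
  qed
  have "(\<Sum>j\<le>degree g. coeff g j * s j) = (\<Sum>y\<in>?B. f y * poly g y)"
    unfolding s_def poly_altdef sum_distrib_left
    by (subst sum.swap) (simp add: mult_ac)
  also have "\<dots> = f z * poly g z + (\<Sum>y\<in>?B - {z}. f y * poly g y)" by (rule sum.remove[OF finB zB])
  also have "(\<Sum>y\<in>?B - {z}. f y * poly g y) = 0"
    unfolding gy using finB by (intro sum.neutral) (auto simp: prod_zero_iff)
  finally have e: "(\<Sum>j\<le>degree g. coeff g j * s j) = f z * poly g z" by simp
  \<comment> \<open>Some trace has value at most \<open>w x\<close>, while all of them have value at
    least \<open>w x\<close>.\<close>
  have "\<exists>j. \<not> vgt (s j) (w x)"
  proof (rule ccontr)
    assume "\<not> ?thesis"
    then have "vgt (\<Sum>j\<le>degree g. coeff g j * s j) (w x)" using gc by (intro vgt_sum vgt_mult0(1)) auto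
    then show False unfolding e using gz fx[OF zB] by (simp add: vgt_def w_mult)
  qed
  then obtain j where j: "\<not> vgt (s j) (w x)" by blast
  have "vge (f y * y ^ j) (w x + 0)" if "y \<in> ?B" for y
    using that fx Bmu by (intro vge_mult vge_power mu_vge) (auto simp: vge_def)
  then have "vge (s j) (w x)" unfolding s_def by (intro vge_sum) simp
  then have "s j \<noteq> 0" "w (s j) = w x" using j by (auto simp: vgt_def vge_def)
  then show ?thesis using L_Gam[OF sL, of j] by simp
qed

lemma Gam_denominator:
  assumes "of_nat m / of_nat n \<in> Gam" "n > 0" "\<not> p dvd n"
  shows "n dvd 2 * m"
proof -
  obtain k where "of_nat (p ^ k) * (2 * (of_nat m / of_nat n)) \<in> (\<int> :: rat set)"
    using assms(1) by (auto simp: Gam_def)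
  then obtain a :: int where "of_nat (p ^ k) * (2 * (of_nat m / of_nat n)) = (of_int a :: rat)"
    by (auto elim: Ints_cases)
  then have "(of_int (int (p ^ k * (2 * m))) :: rat) = of_int (a * int n)" using assms(2) by (simp add: field_simps)
  then have "int (p ^ k * (2 * m)) = a * int n" by (simp only: of_int_eq_iff)
  then have "int n dvd int (p ^ k * (2 * m))" by simp
  then have "n dvd p ^ k * (2 * m)" by (simp only: int_dvd_int_iff)
  moreover have "coprime n (p ^ k)"
    using prime_imp_coprime[OF p assms(3)] by (simp add: coprime_commute)
  ultimately show ?thesis by (simp only: coprime_dvd_mult_right_iff)
qed

text \<open>The product of the conjugates of \<open>d (2 * n)\<close> over \<open>L(z)\<close> has
  value \<open>card U / (2 * n)\<close>, which must lie in \<open>Gam\<close>; hence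
  \<open>n\<close> divides \<open>card U\<close>. As \<open>U\<close> consists of
  \<open>n\<close>-th roots of unity, it contains them all.\<close>

lemma stabilizer_transitive:
  assumes n: "n > 0" "\<not> p dvd 2 * n" and z: "\<And>k. z ^ k = 1 \<longleftrightarrow> 2 * n dvd k"
    "\<And>u. u ^ (2 * n) = 1 \<Longrightarrow> \<exists>k. u = z ^ k" and u: "u ^ n = 1"
  shows "\<exists>\<tau>\<in>G. \<tau> z = z \<and> \<tau> (d (2 * n)) = u * d (2 * n)"
proof -
  have n2: "2 * n > 0" using n by simp
  let ?d = "d (2 * n)"
  have d0: "?d \<noteq> 0" by (rule d_nz[OF n2])
  have "z ^ (2 * n) = 1" using z(1) by simp
  then have zmu: "z \<in> mu" using n n2 unfolding mu_def by blast
  define I where "I = aut (insert z L)"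
  have Ig: "aut_group I" unfolding I_def by (rule aut_group_aut)
  have IG: "\<tau> \<in> G \<and> \<tau> z = z" if "\<tau> \<in> I" for \<tau> using that by (simp add: I_def aut_def)
  have GI: "\<tau> \<in> I" if "\<tau> \<in> G" "\<tau> z = z" for \<tau> using that by (simp add: I_def aut_def)
  \<comment> \<open>\<open>d (2 * n) ^ n\<close> is \<open>d 2\<close>, so the conjugates of
    \<open>d (2 * n)\<close> differ by \<open>n\<close>-th roots of unity.\<close>
  have dL: "?d ^ n \<in> L" using d_mult[of 2 n] n(1) L_d[of 0] by simp
  define U where "U = {v. v * ?d \<in> orbit I ?d}"
  have Un: "v ^ n = 1" if "v \<in> U" for v
  proof -
    obtain \<tau> where t: "\<tau> \<in> G" "v * ?d = \<tau> ?d" using \<open>v \<in> U\<close> IG by (auto simp: U_def orbit_def)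
    have "(v * ?d) ^ n = ?d ^ n" unfolding t(2) using G_L[OF t(1) dL] by (simp add: G_simps[OF t(1)])
    then show ?thesis using d0 by (simp add: power_mult_distrib)
  qed
  have finR: "finite {v :: qbar. v ^ n = 1}" "card {v :: qbar. v ^ n = 1} \<le> n"
    using roots_of_unity[OF n(1)] by blast+
  have finU: "finite U" by (rule finite_subset[OF _ finR(1)]) (use Un in auto)
  have U1: "1 \<in> U" using orbit_self[OF Ig, of ?d] by (simp add: U_def)
  have fixU: "\<tau> v = v" if "\<tau> \<in> I" "v \<in> U" for \<tau> v
  proof -
    have "v ^ (2 * n) = 1" using Un[OF that(2)] by (simp add: power_mult mult.commute[of 2])
    then obtain k where "v = z ^ k" using z(2) by blast
    then show ?thesis using IG[OF that(1)] by (simp add: G_simps)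
  qed
  define x where "x = (\<Prod>v\<in>U. v * ?d)"
  have xo: "x = \<Prod>(orbit I ?d)"
  proof -
    have "bij_betw (\<lambda>v. v * ?d) U (orbit I ?d)"
      unfolding U_def using d0 by (intro bij_betw_byWitness[of _ "\<lambda>y. y / ?d"]) auto
    from prod.reindex_bij_betw[OF this, of "\<lambda>y. y"] show ?thesis by (simp add: x_def)
  qed
  have x0: "x \<noteq> 0" unfolding x_def using finU d0 root_of_unity_unit Un n(1) by (auto simp: prod_zero_iff)
  have wx: "w x = of_nat (card U) / of_nat (2 * n)"
  proof -
    have "w (v * ?d) = 1 / of_nat (2 * n)" if "v \<in> U" for v
      using root_of_unity_unit[OF Un[OF that] n(1)] d0 w_d[OF n2] by (simp add: w_mult)
    moreover have "v * ?d \<noteq> 0" if "v \<in> U" for v using root_of_unity_unit[OF Un[OF that] n(1)] d0 by simp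
    ultimately show ?thesis unfolding x_def using finU by (simp add: w_prod)
  qed
  have "x \<in> fixed I" unfolding xo
    by (rule stable_prod_fixed[OF Ig finite_orbit[OF Ig]]) (rule orbit_closed[OF Ig])
  then have "w x \<in> Gam" using GI by (intro value_in_Gam[OF zmu x0]) (auto simp: fixed_def)
  then have "2 * n dvd 2 * card U" unfolding wx using n2 n(2) by (rule Gam_denominator)
  then have "n dvd card U" by simp
  moreover have "card U > 0" using U1 finU by (auto simp: card_gt_0_iff)
  ultimately have "n \<le> card U" by (simp add: dvd_imp_le)
  then have "card U = card {v :: qbar. v ^ n = 1}"
    using finR card_mono[of "{v :: qbar. v ^ n = 1}" U] Un by (auto intro!: le_antisym)
  then have "U = {v. v ^ n = 1}" using Un finR by (intro card_subset_eq) auto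
  then have "u * ?d \<in> orbit I ?d" using u by (auto simp: U_def)
  then obtain \<tau> where "\<tau> \<in> I" "u * ?d = \<tau> ?d" by (auto simp: orbit_def)
  then show ?thesis using IG by metis
qed

text \<open>The levels form a chain under divisibility that is cofinal among the integers prime to
  \<open>p\<close>, which supplies the decreasing sequence of conditions for the compactness
  argument.\<close>

definition lev :: "nat \<Rightarrow> nat" where
  "lev k = (\<Prod>j | j \<in> {1..k} \<and> \<not> p dvd j. j)"

lemma lev_pos: "lev k > 0"
  unfolding lev_def by (intro prod_pos) auto

lemma not_dvd_2: "\<not> p dvd n \<Longrightarrow> \<not> p dvd 2 * n"
proof -
  assume "\<not> p dvd n"
  moreover have "\<not> p dvd 2"
  proof
    assume "p dvd 2"
    then have "p \<le> 2" by (rule dvd_imp_le) simp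
    then have "p = 2" using p_pos(2) by simp
    then show False using odd_p by simp
  qed
  ultimately show ?thesis using p by (simp add: prime_dvd_mult_iff)
qed

lemma lev_coprime: "\<not> p dvd lev k" "\<not> p dvd 2 * lev k"
proof -
  show 1: "\<not> p dvd lev k" unfolding lev_def using p by (subst prime_dvd_prod_iff) auto
  then show "\<not> p dvd 2 * lev k" by (rule not_dvd_2)
qed

lemma lev_dvd: "n > 0 \<Longrightarrow> \<not> p dvd n \<Longrightarrow> n \<le> k \<Longrightarrow> n dvd lev k"
  unfolding lev_def by (rule dvd_prodI) auto

lemma lev_Suc: "lev k dvd lev (Suc k)"
  unfolding lev_def by (rule prod_dvd_prod_subset) auto

lemma rt_lev_power:
  assumes "m > 0" "n > 0" "m dvd n"
  shows "d (2 * m) = d (2 * n) ^ (n div m)"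
proof -
  obtain q where q: "n = m * q" using assms(3) by (rule dvdE)
  then show ?thesis using d_mult[of "2 * m" q] assms by (simp add: mult.assoc)
qed

text \<open>Each condition concerns finitely many elements of \<open>qbar\<close>, and the conditions at level \<open>k\<close>
  get stronger with \<open>k\<close>, so that compactness of the Galois group yields one automorphism for all.\<close>

lemma tau_exists:
  "\<exists>\<tau>\<in>G. (\<forall>z\<in>mu. \<tau> z = z) \<and>
     (\<forall>n>0. \<not> p dvd n \<longrightarrow> (\<exists>\<xi>. (\<forall>i. \<xi> ^ i = 1 \<longleftrightarrow> n dvd i) \<and> \<tau> (d (2 * n)) = \<xi> * d (2 * n)))"
proof -
  define R where "R n \<tau> \<longleftrightarrow> (\<exists>\<xi>. (\<forall>i. \<xi> ^ i = 1 \<longleftrightarrow> n dvd i) \<and> \<tau> (d (2 * n)) = \<xi> * d (2 * n))"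
    for n and \<tau> :: "qbar \<Rightarrow> qbar"
  define P where "P k \<tau> \<longleftrightarrow> (\<forall>z. z ^ (2 * lev k) = 1 \<longrightarrow> \<tau> z = z) \<and> R (lev k) \<tau>" for k \<tau>
  have R_dvd: "R m \<tau>" if R: "R n \<tau>" and t: "\<tau> \<in> G" and mn: "m > 0" "n > 0" "m dvd n" for m n \<tau>
  proof -
    obtain \<xi> where x: "\<And>i. \<xi> ^ i = 1 \<longleftrightarrow> n dvd i" "\<tau> (d (2 * n)) = \<xi> * d (2 * n)"
      using R by (auto simp: R_def)
    define q where "q = n div m"
    have q: "n = m * q" "q > 0" using mn by (auto simp: q_def elim!: dvdE)
    have "\<tau> (d (2 * m)) = \<xi> ^ q * d (2 * m)"
      unfolding rt_lev_power[OF mn] q_def[symmetric] by (simp add: G_simps[OF t] x(2) power_mult_distrib)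
    moreover have "(\<xi> ^ q) ^ i = 1 \<longleftrightarrow> m dvd i" for i
    proof -
      have "(\<xi> ^ q) ^ i = 1 \<longleftrightarrow> m * q dvd q * i" by (simp only: power_mult[symmetric] x(1) q(1))
      then show ?thesis using q(2) by (simp add: mult.commute)
    qed
    ultimately show ?thesis unfolding R_def by blast
  qed
  have "\<exists>\<tau>\<in>G. \<forall>k. P k \<tau>"
  proof (rule aut_compact)
    fix k \<tau> assume t: "\<tau> \<in> G" and P: "P (Suc k) \<tau>"
    have "z ^ (2 * lev (Suc k)) = 1" if "z ^ (2 * lev k) = 1" for z :: qbar
    proof -
      obtain q where "lev (Suc k) = lev k * q" using lev_Suc[of k] by (rule dvdE)
      then have "z ^ (2 * lev (Suc k)) = (z ^ (2 * lev k)) ^ q" by (simp add: mult.assoc flip: power_mult)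
      then show ?thesis using that by simp
    qed
    then show "P k \<tau>" using P R_dvd[OF _ t lev_pos lev_pos lev_Suc] unfolding P_def by blast
  next
    fix k
    let ?F = "insert (d (2 * lev k)) {z. z ^ (2 * lev k) = 1}"
    have "finite ?F" using roots_of_unity(1)[of "2 * lev k"] lev_pos[of k] by simp
    moreover have "P k \<tau>" if "\<forall>x\<in>?F. \<sigma> x = \<tau> x" "P k \<sigma>" for \<sigma> \<tau>
      using that unfolding P_def R_def by simp
    ultimately show "\<exists>F. finite F \<and> (\<forall>\<sigma> \<tau>. (\<forall>x\<in>F. \<sigma> x = \<tau> x) \<longrightarrow> P k \<sigma> \<longrightarrow> P k \<tau>)" by blast
    have n2: "2 * lev k > 0" using lev_pos[of k] by simp
    obtain z :: qbar where z: "\<And>i. z ^ i = 1 \<longleftrightarrow> 2 * lev k dvd i" "\<And>u. u ^ (2 * lev k) = 1 \<Longrightarrow> \<exists>i. u = z ^ i"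
      using primitive_root_exists[OF n2] by metis
    \<comment> \<open>\<open>z\<close> has order \<open>2 * lev k\<close>, so its square has the
      exact order \<open>lev k\<close> demanded of the factor.\<close>
    have x: "(z ^ 2) ^ i = 1 \<longleftrightarrow> lev k dvd i" for i by (simp add: z(1) flip: power_mult)
    obtain \<tau> where t: "\<tau> \<in> G" "\<tau> z = z" "\<tau> (d (2 * lev k)) = z ^ 2 * d (2 * lev k)"
      using stabilizer_transitive[OF lev_pos lev_coprime(2) z, of "z ^ 2"] x[of "lev k"] by auto
    have "\<tau> u = u" if u: "u ^ (2 * lev k) = 1" for u
    proof -
      obtain i where "u = z ^ i" using z(2)[OF u] by blast
      then show ?thesis using t by (simp add: G_simps[OF t(1)])
    qed
    then have "P k \<tau>" unfolding P_def R_def using t(3) x by blast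
    then show "\<exists>\<tau>\<in>G. P k \<tau>" using t(1) by blast
  qed
  then obtain \<tau> where t: "\<tau> \<in> G" "\<And>k. P k \<tau>" by blast
  have "\<tau> z = z" if z: "z \<in> mu" for z
  proof -
    obtain n where n: "n > 0" "\<not> p dvd n" "z ^ n = 1" using z unfolding mu_def by blast
    obtain q where "lev n = n * q" using lev_dvd[OF n(1,2), of n] by (auto elim: dvdE)
    then have "z ^ (2 * lev n) = (z ^ n) ^ (2 * q)" by (simp add: mult_ac flip: power_mult)
    then show ?thesis using n(3) t(2)[of n] unfolding P_def by simp
  qed
  moreover have "R n \<tau>" if "n > 0" "\<not> p dvd n" for n
    using R_dvd[OF _ t(1) that(1) lev_pos lev_dvd[OF that, of n]] t(2)[of n] unfolding P_def by blast
  ultimately show ?thesis using t(1) unfolding R_def by blast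
qed

text \<open>At each level a lift of Frobenius on roots of unity multiplies the radical by some root
  of unity \<open>u\<close>. An automorphism that fixes the roots of unity and multiplies the
  radical by \<open>inverse u\<close> repairs this, and compactness combines the levels.\<close>

lemma phi_exists:
  "\<exists>\<phi>\<in>G. (\<forall>z\<in>mu. \<phi> z = z ^ p) \<and> (\<forall>n>0. \<not> p dvd n \<longrightarrow> \<phi> (d (2 * n)) = d (2 * n))"
proof -
  define P where "P k \<phi> \<longleftrightarrow> (\<forall>z. z ^ (2 * lev k) = 1 \<longrightarrow> \<phi> z = z ^ p) \<and> \<phi> (d (2 * lev k)) = d (2 * lev k)"
    for k and \<phi> :: "qbar \<Rightarrow> qbar"
  have R_dvd: "\<phi> (d (2 * m)) = d (2 * m)" if R: "\<phi> (d (2 * n)) = d (2 * n)" and t: "\<phi> \<in> G"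
    and mn: "m > 0" "n > 0" "m dvd n" for m n \<phi>
    unfolding rt_lev_power[OF mn] by (simp add: G_simps[OF t] R)
  have "\<exists>\<phi>\<in>G. \<forall>k. P k \<phi>"
  proof (rule aut_compact)
    fix k \<phi> assume t: "\<phi> \<in> G" and P: "P (Suc k) \<phi>"
    have "z ^ (2 * lev (Suc k)) = 1" if "z ^ (2 * lev k) = 1" for z :: qbar
    proof -
      obtain q where "lev (Suc k) = lev k * q" using lev_Suc[of k] by (rule dvdE)
      then have "z ^ (2 * lev (Suc k)) = (z ^ (2 * lev k)) ^ q" by (simp add: mult.assoc flip: power_mult)
      then show ?thesis using that by simp
    qed
    then show "P k \<phi>" using P R_dvd[OF _ t lev_pos lev_pos lev_Suc] unfolding P_def by blast
  next
    fix k
    let ?d = "d (2 * lev k)"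
    let ?F = "insert ?d {z. z ^ (2 * lev k) = 1}"
    have n2: "2 * lev k > 0" using lev_pos[of k] by simp
    have "finite ?F" using roots_of_unity(1)[of "2 * lev k"] n2 by simp
    moreover have "P k \<tau>" if "\<forall>x\<in>?F. \<sigma> x = \<tau> x" "P k \<sigma>" for \<sigma> \<tau>
      using that unfolding P_def by simp
    ultimately show "\<exists>F. finite F \<and> (\<forall>\<sigma> \<tau>. (\<forall>x\<in>F. \<sigma> x = \<tau> x) \<longrightarrow> P k \<sigma> \<longrightarrow> P k \<tau>)" by blast
    obtain z :: qbar where z: "\<And>i. z ^ i = 1 \<longleftrightarrow> 2 * lev k dvd i" "\<And>u. u ^ (2 * lev k) = 1 \<Longrightarrow> \<exists>i. u = z ^ i"
      using primitive_root_exists[OF n2] by metis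
    have "z ^ (2 * lev k) = 1" using z(1) by simp
    then have "z \<in> mu" using n2 lev_coprime(2)[of k] unfolding mu_def by blast
    then obtain \<sigma> where s: "\<sigma> \<in> G" "\<sigma> z = z ^ p" using frobenius_on_root by blast
    have d0: "?d \<noteq> 0" by (rule d_nz[OF n2])
    define u where "u = \<sigma> ?d / ?d"
    have dL: "?d ^ lev k \<in> L" using d_mult[of 2 "lev k"] lev_pos[of k] L_d[of 0] by simp
    have "\<sigma> ?d ^ lev k = ?d ^ lev k" using G_L[OF s(1) dL] by (simp add: G_simps[OF s(1)])
    then have un: "u ^ lev k = 1" using d0 by (simp add: u_def power_divide)
    then have "inverse u ^ lev k = 1" by (simp add: power_inverse)
    from stabilizer_transitive[OF lev_pos lev_coprime(2) z this]
    obtain \<tau> where t: "\<tau> \<in> G" "\<tau> z = z" "\<tau> ?d = inverse u * ?d" by blast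
    have fixz: "\<tau> v = v" if v: "v ^ (2 * lev k) = 1" for v
    proof -
      obtain i where "v = z ^ i" using z(2)[OF v] by blast
      then show ?thesis using t by (simp add: G_simps[OF t(1)])
    qed
    have u0: "u \<noteq> 0" using root_of_unity_unit[OF un lev_pos] by blast
    have "u ^ (2 * lev k) = 1" using un by (simp add: power_mult mult.commute[of 2])
    then have "\<tau> (u * ?d) = ?d" using fixz t(3) u0 by (simp add: G_simps[OF t(1)])
    moreover have "\<sigma> ?d = u * ?d" using d0 by (simp add: u_def)
    ultimately have "(\<tau> \<circ> \<sigma>) ?d = ?d" by simp
    moreover have "(\<tau> \<circ> \<sigma>) v = v ^ p" if v: "v ^ (2 * lev k) = 1" for v
    proof -
      obtain i where i: "v = z ^ i" using z(2)[OF v] by blast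
      have "\<sigma> v = v ^ p" unfolding i by (simp add: G_simps[OF s(1)] s(2) mult.commute flip: power_mult)
      then show ?thesis using fixz[OF v] by (simp add: G_simps[OF t(1)])
    qed
    ultimately have "P k (\<tau> \<circ> \<sigma>)" unfolding P_def by blast
    then show "\<exists>\<phi>\<in>G. P k \<phi>" using aut_groupD(4)[OF G_group t(1) s(1)] by blast
  qed
  then obtain \<phi> where t: "\<phi> \<in> G" "\<And>k. P k \<phi>" by blast
  have "\<phi> z = z ^ p" if z: "z \<in> mu" for z
  proof -
    obtain n where n: "n > 0" "\<not> p dvd n" "z ^ n = 1" using z unfolding mu_def by blast
    obtain q where "lev n = n * q" using lev_dvd[OF n(1,2), of n] by (auto elim: dvdE)
    then have "z ^ (2 * lev n) = (z ^ n) ^ (2 * q)" by (simp add: mult_ac flip: power_mult)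
    then show ?thesis using n(3) t(2)[of n] unfolding P_def by simp
  qed
  moreover have "\<phi> (d (2 * n)) = d (2 * n)" if "n > 0" "\<not> p dvd n" for n
    using R_dvd[OF _ t(1) that(1) lev_pos lev_dvd[OF that, of n]] t(2)[of n] unfolding P_def by blast
  ultimately show ?thesis using t(1) by blast
qed

end

section \<open>Wild automorphisms\<close>

lemma hom_powi: "fhom f \<Longrightarrow> f (x powi k) = f x powi k"
  by (simp add: power_int_def hom_simps)

lemma prime_power_decompose:
  fixes n :: nat
  assumes "prime p" "n > 0"
  obtains s m where "n = p ^ s * m" "m > 0" "\<not> p dvd m"
proof -
  have "\<not> is_unit p" using assms(1) by auto
  then obtain m where "n = p ^ multiplicity p n * m" "\<not> p dvd m"
    using multiplicity_decompose'[of n p] assms(2) by auto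
  then show ?thesis using that[of "multiplicity p n" m] assms(2) by (cases "m = 0") auto
qed

lemma funpow_fixed: "(f ^^ n) x = x \<Longrightarrow> (f ^^ (n * k)) x = x"
  by (induction k) (auto simp: funpow_add)

lemma funpow_coprime_fixed:
  assumes "(f ^^ a) x = x" "(f ^^ b) x = x" "coprime a b" "a > 0"
  shows "f x = x"
proof -
  have g1: "gcd a b = 1" using assms(3) by (rule coprime_imp_gcd_eq_1)
  have "a \<noteq> 0" using assms(4) by simp
  from bezout_nat[OF this, of b] obtain u v where uv: "a * u = b * v + 1" unfolding g1 by blast
  have "f x = f ((f ^^ (b * v)) x)" using funpow_fixed[OF assms(2), of v] by simp
  also have "\<dots> = (f ^^ (a * u)) x" unfolding uv by simp
  also have "\<dots> = x" by (rule funpow_fixed[OF assms(1)])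
  finally show ?thesis .
qed

text \<open>By the pigeonhole principle \<open>y\<close> has a period at most \<open>card B\<close>.
  The factorial is a common exponent for all \<open>\<sigma>\<close> and \<open>y\<close>, from
  which the power of \<open>p\<close> can be split off.\<close>

lemma stable_funpow_fact:
  assumes "fhom \<sigma>" "finite B" "\<And>y. y \<in> B \<Longrightarrow> \<sigma> y \<in> B" "y \<in> B"
  shows "(\<sigma> ^^ fact (card B)) y = y"
proof -
  have inB: "(\<sigma> ^^ i) y \<in> B" for i using assms(3,4) by (induction i) auto
  have "\<not> inj_on (\<lambda>i. (\<sigma> ^^ i) y) {..card B}"
  proof
    assume "inj_on (\<lambda>i. (\<sigma> ^^ i) y) {..card B}"
    then have "card {..card B} \<le> card B" using inB by (intro card_inj_on_le[OF _ _ assms(2)]) auto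
    then show False by simp
  qed
  then obtain i j where ij: "i < j" "j \<le> card B" "(\<sigma> ^^ i) y = (\<sigma> ^^ j) y"
  proof -
    obtain i j where ij: "i \<le> card B" "j \<le> card B" "i \<noteq> j" "(\<sigma> ^^ i) y = (\<sigma> ^^ j) y"
      using \<open>\<not> inj_on _ _\<close> unfolding inj_on_def by auto
    show ?thesis
    proof (cases "i < j")
      case True
      then show ?thesis using that[of i j] ij by simp
    next
      case False
      then show ?thesis using that[of j i] ij by simp
    qed
  qed
  have "(\<sigma> ^^ i) ((\<sigma> ^^ (j - i)) y) = (\<sigma> ^^ (i + (j - i))) y" by (simp only: funpow_add comp_apply)
  also have "\<dots> = (\<sigma> ^^ i) y" using ij by simp
  finally have e: "(\<sigma> ^^ i) ((\<sigma> ^^ (j - i)) y) = (\<sigma> ^^ i) y" .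
  have "inj \<sigma>" by (rule injI) (simp add: hom_simps[OF assms(1)])
  then have "inj (\<sigma> ^^ i)" by (induction i) (auto intro: inj_compose)
  then have "(\<sigma> ^^ (j - i)) y = y" using e by (auto dest: injD)
  moreover have "j - i dvd fact (card B)" using ij by (intro dvd_fact) auto
  then obtain k where "fact (card B) = (j - i) * k" by (rule dvdE)
  ultimately show ?thesis using funpow_fixed[of "j - i" \<sigma> y k] by simp
qed

text \<open>Being the identity outside of \<open>B\<close> makes restriction commute with
  composition and iteration of maps that preserve \<open>B\<close>.\<close>

definition restr :: "'a set \<Rightarrow> ('a \<Rightarrow> 'a) \<Rightarrow> 'a \<Rightarrow> 'a" where
  "restr B g x = (if x \<in> B then g x else x)"

lemma restr_comp: "(\<And>x. x \<in> B \<Longrightarrow> h x \<in> B) \<Longrightarrow> restr B (g \<circ> h) = restr B g \<circ> restr B h"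
  by (auto simp: restr_def fun_eq_iff)

lemma restr_id: "restr B id = id"
  by (auto simp: restr_def fun_eq_iff)

lemma restr_funpow: "(\<And>x. x \<in> B \<Longrightarrow> g x \<in> B) \<Longrightarrow> restr B (g ^^ n) = restr B g ^^ n"
proof (induction n)
  case (Suc n)
  have "(g ^^ n) x \<in> B" if "x \<in> B" for x using that Suc.prems by (induction n) auto
  then have "restr B (g \<circ> g ^^ n) = restr B g \<circ> restr B (g ^^ n)" by (rule restr_comp)
  also have "restr B (g ^^ n) = restr B g ^^ n" using Suc by blast
  finally show ?case by (simp only: funpow.simps)
qed (simp add: restr_id[unfolded id_def] id_def)

lemma restr_eq_iff: "restr B g = restr B h \<longleftrightarrow> (\<forall>x\<in>B. g x = h x)"
  by (auto simp: restr_def fun_eq_iff)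

lemma finite_restr:
  assumes "finite B" "\<And>g x. g \<in> S \<Longrightarrow> x \<in> B \<Longrightarrow> g x \<in> B"
  shows "finite (restr B ` S)"
proof (rule finite_imageD)
  have "(\<lambda>f. restrict f B) ` (restr B ` S) \<subseteq> PiE B (\<lambda>_. B)"
    using assms(2) by (auto simp: restr_def)
  then show "finite ((\<lambda>f. restrict f B) ` (restr B ` S))"
    by (rule finite_subset) (simp add: assms(1) finite_PiE)
  show "inj_on (\<lambda>f. restrict f B) (restr B ` S)"
  proof (rule inj_onI)
    fix f g assume fg: "f \<in> restr B ` S" "g \<in> restr B ` S" "restrict f B = restrict g B"
    show "f = g"
    proof
      fix x
      show "f x = g x"
      proof (cases "x \<in> B")
        case True
        then show ?thesis using fun_cong[OF fg(3), of x] by simp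
      next
        case False
        then show ?thesis using fg(1,2) by (auto simp: restr_def)
      qed
    qed
  qed
qed

context maximal_field
begin

lemma G_pow: "\<sigma> \<in> G \<Longrightarrow> \<sigma> ^^ n \<in> G" by (rule aut_groupD(5)[OF G_group])

lemma w_powi: "x \<noteq> 0 \<Longrightarrow> w (x powi k) = of_int k * w x"
  by (simp add: power_int_def w_power w_inverse)

text \<open>With \<open>w x = a / (p ^ s * b)\<close>, the power \<open>x ^ p ^ s\<close> has value
  \<open>a / b\<close>, which is also the value of \<open>d (2 * b)\<close> to the power
  \<open>2 * a\<close>. The quotient \<open>y\<close> is a unit and has a representative in
  \<open>mu\<close>.\<close>

lemma unit_decomposition:
  assumes x: "x \<noteq> 0"
  obtains s b a y z where "b > 0" "\<not> p dvd b" "z \<in> mu" "y \<noteq> 0" "w y = 0" "cg y z"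
    "x ^ p ^ s = y * d (2 * b) powi (2 * a)" "of_nat (p ^ s * b) * w x = of_int a"
proof -
  obtain a b0 where ab: "quotient_of (w x) = (a, b0)" by fastforce
  have b0: "b0 > 0" using quotient_of_denom_pos[OF ab] .
  have wx: "w x = of_int a / of_int b0" using quotient_of_div[OF ab] .
  have "nat b0 > 0" using b0 by simp
  then obtain s b where sb: "nat b0 = p ^ s * b" "b > 0" "\<not> p dvd b"
    by (rule prime_power_decompose[OF p])
  have "b0 = int (p ^ s * b)" using b0 sb(1) by linarith
  then have b0': "(of_int b0 :: rat) = of_nat (p ^ s * b)" by simp
  have pos: "(of_nat (p ^ s) :: rat) > 0" "(of_nat b :: rat) > 0" using p_pos sb(2) by simp_all
  have wx': "of_nat (p ^ s * b) * w x = of_int a" unfolding wx b0' using pos by simp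
  define e where "e = d (2 * b) powi (2 * a)"
  have d0: "d (2 * b) \<noteq> 0" using sb(2) by (intro d_nz) simp
  then have e0: "e \<noteq> 0" by (simp add: e_def)
  have we: "w e = of_int a / of_nat b"
    unfolding e_def using w_powi[OF d0, of "2 * a"] w_d[of "2 * b"] sb(2) by simp
  define y where "y = x ^ p ^ s / e"
  have y0: "y \<noteq> 0" using x e0 by (simp add: y_def)
  have "w (x ^ p ^ s) = of_int a / of_nat b"
    using w_power[OF x, of "p ^ s"] wx' pos by (simp add: field_simps)
  then have wy: "w y = 0" using w_divide[of "x ^ p ^ s" e] x e0 we by (simp add: y_def)
  obtain z where z: "z \<in> mu" "cg y z" using unit_cg_mu[OF y0 wy] by blast
  have "x ^ p ^ s = y * d (2 * b) powi (2 * a)" using e0 by (simp add: y_def e_def[symmetric])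
  then show ?thesis using that sb z y0 wy wx' by blast
qed

definition wild :: "(qbar \<Rightarrow> qbar) set" where
  "wild = {\<sigma> \<in> G. \<forall>x. x \<noteq> 0 \<longrightarrow> vgt (\<sigma> x - x) (w x)}"

lemma vgt_ratio: "x \<noteq> 0 \<Longrightarrow> vgt (y - x) (w x) \<longleftrightarrow> cg (y / x) 1"
proof -
  assume x: "x \<noteq> 0"
  have e: "y / x - 1 = (y - x) / x" using x by (simp add: field_simps)
  show ?thesis unfolding e using x by (cases "y = x") (auto simp: vgt_def w_divide)
qed

lemma wild_mu: "\<sigma> \<in> wild \<Longrightarrow> z \<in> mu \<Longrightarrow> \<sigma> z = z"
  using mu_inj[OF G_mu, of \<sigma> z z] mu_unit[of z] by (auto simp: wild_def)

text \<open>\<open>\<sigma>\<close> multiplies the radical by a root of unity in \<open>mu\<close>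
  congruent to 1, that is, by 1.\<close>

lemma wild_d:
  assumes s: "\<sigma> \<in> wild" and n: "n > 0" "\<not> p dvd n"
  shows "\<sigma> (d (2 * n)) = d (2 * n)"
proof -
  have n2: "2 * n > 0" "\<not> p dvd 2 * n" using n not_dvd_2 by simp_all
  have sG: "\<sigma> \<in> G" using s by (simp add: wild_def)
  have d0: "d (2 * n) \<noteq> 0" by (rule d_nz[OF n2(1)])
  define u where "u = \<sigma> (d (2 * n)) / d (2 * n)"
  have "\<sigma> (d (2 * n)) ^ (2 * n) = \<sigma> (of_rat c)"
    using d_power[OF n2(1)] by (simp flip: G_simps(9)[OF sG])
  then have "u ^ (2 * n) = 1"
    using d_power[OF n2(1)] c_pos by (simp add: u_def power_divide hom_of_rat[OF G_hom[OF sG]])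
  then have "u \<in> mu" using n2 unfolding mu_def by blast
  moreover have "cg u 1" using s d0 unfolding wild_def u_def by (simp flip: vgt_ratio)
  ultimately have "u = 1" by (rule mu_cg_1)
  then show ?thesis using d0 by (simp add: u_def)
qed

lemma wildI:
  assumes s: "\<sigma> \<in> G" and mu: "\<And>z. z \<in> mu \<Longrightarrow> \<sigma> z = z"
    and d: "\<And>n. n > 0 \<Longrightarrow> \<not> p dvd n \<Longrightarrow> \<sigma> (d (2 * n)) = d (2 * n)"
  shows "\<sigma> \<in> wild"
proof -
  have "vgt (\<sigma> x - x) (w x)" if x: "x \<noteq> 0" for x
  proof -
    obtain t b a y z where y: "b > 0" "\<not> p dvd b" "z \<in> mu" "y \<noteq> 0" "w y = 0" "cg y z"
      "x ^ p ^ t = y * d (2 * b) powi (2 * a)" "of_nat (p ^ t * b) * w x = of_int a"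
      by (rule unit_decomposition[OF x])
    define u where "u = \<sigma> x / x"
    have d0: "d (2 * b) \<noteq> 0" using y(1) by (intro d_nz) simp
    define e where "e = d (2 * b) powi (2 * a)"
    have e: "e \<noteq> 0" "\<sigma> e = e"
      using d0 by (simp_all only: e_def hom_powi[OF G_hom[OF s]] d[OF y(1,2)] power_int_eq_0_iff) simp
    have "\<sigma> x ^ p ^ t = \<sigma> (x ^ p ^ t)" by (simp only: G_simps(9)[OF s])
    also have "\<dots> = \<sigma> y * e" unfolding y(7) e_def[symmetric] by (simp only: G_simps(4)[OF s] e(2))
    finally have "u ^ p ^ t = (\<sigma> y * e) / (y * e)" unfolding u_def power_divide y(7) e_def[symmetric] by simp
    then have "u ^ p ^ t = \<sigma> y / y" using e(1) by simp
    moreover have "cg (\<sigma> y) y"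
    proof -
      have "cg (\<sigma> y) z" using G_cg[OF s, of y z] y(6) mu[OF y(3)] by simp
      then show ?thesis using cg_sym[OF y(6)] by (rule cg_trans)
    qed
    then have "cg (\<sigma> y / y) 1" using vgt_ratio[OF y(4), of "\<sigma> y"] y(5) by simp
    ultimately have "cg (u ^ p ^ t) 1" by (simp only:)
    moreover have "\<sigma> x \<noteq> 0" using x by (simp add: G_simps(10)[OF s])
    then have "w u = 0" unfolding u_def using w_divide[of "\<sigma> x" x] x G_w[OF s, of x] by simp
    then have "vge u 0" by (simp add: vge_def)
    ultimately have "cg u 1" using cg_1_of_power_p[of u t] by blast
    then show ?thesis using vgt_ratio[OF x, of "\<sigma> x"] by (simp add: u_def)
  qed
  then show ?thesis using s by (simp add: wild_def)
qed

lemma wild_group: "aut_group wild"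
proof -
  have "wild = aut (L \<union> mu \<union> {d (2 * n) |n. n > 0 \<and> \<not> p dvd n})"
  proof
    show "wild \<subseteq> aut (L \<union> mu \<union> {d (2 * n) |n. n > 0 \<and> \<not> p dvd n})"
    proof
      fix \<sigma> assume s: "\<sigma> \<in> wild"
      then have "\<sigma> \<in> G" by (simp add: wild_def)
      then show "\<sigma> \<in> aut (L \<union> mu \<union> {d (2 * n) |n. n > 0 \<and> \<not> p dvd n})"
        using wild_mu[OF s] wild_d[OF s] unfolding aut_def by blast
    qed
    show "aut (L \<union> mu \<union> {d (2 * n) |n. n > 0 \<and> \<not> p dvd n}) \<subseteq> wild"
      by (rule subsetI, rule wildI) (auto simp: aut_def)
  qed
  then show ?thesis by (simp add: aut_group_aut)
qed

lemma wild_G: "\<sigma> \<in> wild \<Longrightarrow> \<sigma> \<in> G" by (simp add: wild_def)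

text \<open>If \<open>\<sigma>\<close> is wild and \<open>\<sigma> ^^ m\<close> fixes \<open>x\<close> with \<open>m\<close> prime to \<open>p\<close>, then the conjugates of
  \<open>\<sigma> x - x\<close> sum to 0, but each of them is close to \<open>\<sigma> x - x\<close>.\<close>

lemma wild_coprime_fixed:
  assumes s: "\<sigma> \<in> wild" and m: "\<not> p dvd m" "(\<sigma> ^^ m) x = x"
  shows "\<sigma> x = x"
proof (rule ccontr)
  assume ne: "\<sigma> x \<noteq> x"
  define y where "y = \<sigma> x - x"
  have y0: "y \<noteq> 0" using ne by (simp add: y_def)
  have pw: "\<sigma> ^^ i \<in> wild" for i by (rule aut_groupD(5)[OF wild_group s])
  have "(\<sigma> ^^ i) y = (\<sigma> ^^ Suc i) x - (\<sigma> ^^ i) x" for i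
    unfolding y_def G_simps(6)[OF wild_G[OF pw[of i]]] by (simp add: funpow_swap1)
  then have "(\<Sum>i<m. (\<sigma> ^^ i) y) = (\<sigma> ^^ m) x - (\<sigma> ^^ 0) x"
    using sum_lessThan_telescope[of "\<lambda>i. (\<sigma> ^^ i) x" m] by simp
  then have "(\<Sum>i<m. (\<sigma> ^^ i) y) = 0" using m(2) by simp
  moreover have "vgt (\<Sum>i<m. (\<sigma> ^^ i) y - y) (w y)"
    using pw y0 by (intro vgt_sum) (auto simp: wild_def)
  ultimately have "vgt (- (of_nat m * y)) (w y)" by (simp add: sum_subtractf)
  then have "vgt (of_nat m * y) (w y)" by (simp only: vgt_minus)
  moreover have "m \<noteq> 0" using m(1) by (metis dvd_0_right)
  ultimately show False using y0 w_nat_unit[OF m(1)] by (simp add: vgt_def w_mult)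
qed

text \<open>Write \<open>fact (card B)\<close> as \<open>p ^ k * m\<close> with \<open>m\<close>
  prime to \<open>p\<close>: the wild automorphism \<open>\<sigma> ^^ (p ^ k)\<close> has an
  \<open>m\<close>-th iterate trivial on \<open>B\<close>, hence is trivial there itself. So the
  wild group acts on \<open>B\<close> as a \<open>p\<close>-group.\<close>

lemma wild_p_power:
  assumes s: "\<sigma> \<in> wild" and B: "finite B" "\<And>\<tau> y. \<tau> \<in> G \<Longrightarrow> y \<in> B \<Longrightarrow> \<tau> y \<in> B"
  shows "\<exists>k. \<forall>y\<in>B. (\<sigma> ^^ (p ^ k)) y = y"
proof -
  have "(fact (card B) :: nat) > 0" by simp
  then obtain k m where km: "fact (card B) = p ^ k * m" "m > 0" "\<not> p dvd m"
    by (rule prime_power_decompose[OF p])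
  have pk: "\<sigma> ^^ (p ^ k) \<in> wild" by (rule aut_groupD(5)[OF wild_group s])
  have "(\<sigma> ^^ (p ^ k)) y = y" if y: "y \<in> B" for y
  proof (rule wild_coprime_fixed[OF pk km(3)])
    have "(\<sigma> ^^ fact (card B)) y = y"
      using stable_funpow_fact[OF G_hom[OF wild_G[OF s]] B(1) B(2)[OF wild_G[OF s]] y] .
    then show "((\<sigma> ^^ (p ^ k)) ^^ m) y = y" unfolding km(1) by (simp add: funpow_mult)
  qed
  then show ?thesis by blast
qed

text \<open>By maximality of \<open>L\<close>, every Frobenius lift together with every sufficiently ramified
  automorphism has fixed field \<open>L\<close>.\<close>

lemma generating_pair:
  assumes f: "\<phi> \<in> G" "\<And>z. z \<in> mu \<Longrightarrow> \<phi> z = z ^ p"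
    and t: "\<tau> \<in> G" "\<And>z. z \<in> mu \<Longrightarrow> \<tau> z = z"
      "\<And>n. n > 0 \<Longrightarrow> \<not> p dvd n \<Longrightarrow>
        \<exists>\<xi>. (\<forall>i. \<xi> ^ i = 1 \<longleftrightarrow> n dvd i) \<and> \<tau> (d (2 * n)) = \<xi> * d (2 * n)"
    and x: "\<phi> x = x" "\<tau> x = x"
  shows "x \<in> L"
proof -
  define K where "K = {x. \<phi> x = x \<and> \<tau> x = x}"
  have K: "is_subfield K" unfolding is_subfield_def K_def by (simp add: G_simps[OF f(1)] G_simps[OF t(1)])
  have LK: "L \<subseteq> K" using G_L[OF f(1)] G_L[OF t(1)] by (auto simp: K_def)
  have "good K" unfolding good_def
  proof (intro conjI allI ballI impI)
    show "is_subfield K" by (rule K)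
    show "d (2 * p ^ k) \<in> K" for k using L_d LK by blast
    fix x assume xK: "x \<in> K"
    show "cg (x ^ p) x" if v: "vge x 0"
    proof (cases "vgt x 0")
      case True
      have "vgt (x ^ p) 0" using True p_pos by (cases "x = 0") (auto simp: vgt_def w_power zero_power)
      then show ?thesis using True by (rule vgt_diff)
    next
      case False
      then have "x \<noteq> 0" "w x = 0" using v by (auto simp: vgt_def vge_def)
      then obtain z where z: "z \<in> mu" "cg x z" using unit_cg_mu by blast
      \<comment> \<open>\<open>\<phi>\<close> fixes \<open>x\<close>, so \<open>x\<close> is
        congruent to \<open>z\<close> and to \<open>\<phi> z\<close>.\<close>
      have "cg x (z ^ p)" using G_cg[OF f(1), of x z] z f(2)[OF z(1)] xK by (simp add: K_def)
      then show ?thesis using cg_trans[OF cg_power[OF z(2) v] cg_sym] by blast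
    qed
    show "w x \<in> Gam" if x0: "x \<noteq> 0"
    proof -
      obtain s b a y z where y: "b > 0" "\<not> p dvd b" "z \<in> mu" "y \<noteq> 0" "w y = 0" "cg y z"
        "x ^ p ^ s = y * d (2 * b) powi (2 * a)" and wx: "of_nat (p ^ s * b) * w x = of_int a"
        by (rule unit_decomposition[OF x0])
      obtain \<xi> where xi: "\<And>i. \<xi> ^ i = 1 \<longleftrightarrow> b dvd i" "\<tau> (d (2 * b)) = \<xi> * d (2 * b)"
        using t(3)[OF y(1,2)] by blast
      have d0: "d (2 * b) \<noteq> 0" using y(1) by (intro d_nz) simp
      have xb: "\<xi> ^ b = 1" using xi(1) by simp
      then have xmu: "\<xi> \<in> mu" using y(1,2) unfolding mu_def by blast
      \<comment> \<open>\<open>\<tau>\<close> multiplies the radical part of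
        \<open>x ^ p ^ s\<close> by \<open>v\<close> and moves the unit part only within its residue
        class. As \<open>x\<close> is fixed, \<open>v\<close> is congruent to 1, hence equal to
        1.\<close>
      define v where "v = \<xi> powi (2 * a)"
      have vmu: "v \<in> mu" unfolding v_def power_int_def using mu_power[OF xmu] mu_power[OF mu_inverse[OF xmu]] by simp
      have "x ^ p ^ s = \<tau> (x ^ p ^ s)" using xK by (simp add: G_simps[OF t(1)] K_def)
      also have "\<dots> = \<tau> y * (v * d (2 * b) powi (2 * a))"
        unfolding y(7) v_def by (simp add: G_simps[OF t(1)] hom_powi[OF G_hom[OF t(1)]] xi(2) power_int_mult_distrib)
      finally have yv: "y = \<tau> y * v" using d0 unfolding y(7) by simp
      have "cg (\<tau> y) z" using G_cg[OF t(1), of y z] y(6) t(2)[OF y(3)] by simp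
      then have "cg (\<tau> y) y" using cg_sym[OF y(6)] by (rule cg_trans)
      then have "cg (v * \<tau> y) (v * y)" using mu_vge[OF vmu] cg_vge[of y "\<tau> y"] y(5) by (intro cg_mult) (auto simp: vge_def)
      then have "cg y (v * y)" using yv by (simp add: mult.commute)
      then have "cg (v * y) y" by (rule cg_sym)
      then have "cg (y * v) (y * 1)" by (simp add: mult.commute)
      then have "cg v 1" by (rule cg_cancel[OF _ y(4,5)])
      then have "v = 1" by (rule mu_cg_1[OF vmu])
      then have "\<xi> ^ nat \<bar>2 * a\<bar> = 1"      proof (cases "2 * a \<ge> 0")
        case True
        then show ?thesis using \<open>v = 1\<close> unfolding v_def power_int_def by simp
      next
        case False
        then have "inverse \<xi> ^ nat (- (2 * a)) = 1" using \<open>v = 1\<close> unfolding v_def power_int_def by simp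
        then have "inverse (\<xi> ^ nat (- (2 * a))) = inverse 1" by (simp only: power_inverse inverse_1)
        then have "\<xi> ^ nat (- (2 * a)) = 1" by (simp only: inverse_eq_iff_eq)
        then show ?thesis using False by (simp only: abs_of_neg linorder_not_le)
      qed
      \<comment> \<open>The exact order \<open>b\<close> of \<open>\<xi>\<close> removes
        \<open>b\<close> from the denominator of \<open>2 * w x\<close>, where only a power of
        \<open>p\<close> remains.\<close>
      then have "b dvd nat \<bar>2 * a\<bar>" by (simp only: xi(1))
      then have "int b dvd 2 * a" by (simp only: int_dvd_int_iff[symmetric] nat_abs_dvd_iff int_nat_eq) simp
      then obtain q where q: "2 * a = int b * q" by (rule dvdE)
      have "of_nat b * (of_nat (p ^ s) * (2 * w x)) = (of_int (2 * a) :: rat)" using wx by (simp add: mult_ac)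
      also have "\<dots> = of_nat b * of_int q" unfolding q by simp
      finally have "of_nat (p ^ s) * (2 * w x) = of_int q" using y(1) by simp
      then have "of_nat (p ^ s) * (2 * w x) \<in> \<int>" by simp
      then show ?thesis unfolding Gam_def by blast
    qed
  qed
  then have "K = L" using LK by (rule maximal_L)
  then show ?thesis using x by (auto simp: K_def)
qed

end

section \<open>Tameness\<close>

lemma finv_restr:
  assumes "bij g" "finite B" "\<And>x. x \<in> B \<Longrightarrow> g x \<in> B"
  shows "bij (restr B g)" "finv (restr B g) = restr B (finv g)" "x \<in> B \<Longrightarrow> finv g x \<in> B"
proof -
  have inj: "inj g" and gi: "g (finv g x) = x" "finv g (g x) = x" for x
    using assms(1) by (simp_all add: bij_is_inj bij_is_surj surj_f_inv_f)
  have "g ` B = B" using assms(2,3) inj by (intro card_subset_eq) (auto simp: card_image inj_on_subset[OF inj])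
  then have iB: "finv g x \<in> B" if "x \<in> B" for x using that gi(2) by (metis imageE)
  then show "x \<in> B \<Longrightarrow> finv g x \<in> B" .
  have 1: "restr B g \<circ> restr B (finv g) = id" and 2: "restr B (finv g) \<circ> restr B g = id"
    using assms(3) iB gi by (auto simp: restr_def fun_eq_iff)
  show "bij (restr B g)" using o_bij[OF 2 1] .
  show "finv (restr B g) = restr B (finv g)" by (rule inv_unique_comp[OF 1 2])
qed

lemma pow_mod_fixed:
  fixes z :: "'a::monoid_mult"
  assumes "z ^ (q ^ m) = z"
  shows "z ^ (q ^ j) = z ^ (q ^ (j mod m))"
proof -
  have *: "z ^ (q ^ (m * k + r)) = z ^ (q ^ r)" for k r
  proof (induction k)
    case (Suc k)
    have "z ^ (q ^ (m * Suc k + r)) = (z ^ (q ^ m)) ^ (q ^ (m * k + r))"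
      by (simp add: power_add mult_ac flip: power_mult)
    then show ?case using Suc assms by simp
  qed simp
  show ?thesis using *[of "j div m" "j mod m"] by simp
qed

context maximal_field
begin

lemma tau_pow_d:
  assumes "\<tau> \<in> G" "\<And>z. z \<in> mu \<Longrightarrow> \<tau> z = z" "\<xi> \<in> mu" "\<tau> e = \<xi> * e"
  shows "(\<tau> ^^ k) e = \<xi> ^ k * e"
  using assms(2-4) by (induction k) (simp_all add: G_simps[OF assms(1)] mult_ac)

text \<open>The conjugate of \<open>\<tau>\<close> under a Frobenius lift \<open>\<phi>\<close> agrees with \<open>\<tau> ^^ p\<close> up to a wild
  automorphism. On a finite set this defect is removed by replacing \<open>\<phi>\<close> by another Frobenius
  lift; then the group generated by the two contains no wild automorphism acting nontrivially there.\<close>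

lemma frobenius_lift_relation:
  assumes f: "\<phi> \<in> G" "\<And>z. z \<in> mu \<Longrightarrow> \<phi> z = z ^ p"
      "\<And>n. n > 0 \<Longrightarrow> \<not> p dvd n \<Longrightarrow> \<phi> (d (2 * n)) = d (2 * n)"
    and t: "\<tau> \<in> G" "\<And>z. z \<in> mu \<Longrightarrow> \<tau> z = z"
      "\<And>n. n > 0 \<Longrightarrow> \<not> p dvd n \<Longrightarrow>
        \<exists>\<xi>. (\<forall>i. \<xi> ^ i = 1 \<longleftrightarrow> n dvd i) \<and> \<tau> (d (2 * n)) = \<xi> * d (2 * n)"
    and B: "finite B" "\<And>\<sigma> y. \<sigma> \<in> G \<Longrightarrow> y \<in> B \<Longrightarrow> \<sigma> y \<in> B"
    and N: "N > 0" "\<not> p dvd N" "\<And>y. y \<in> B \<Longrightarrow> (\<tau> ^^ N) y = y"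
  shows "\<exists>m\<in>wild. \<forall>y\<in>B. m (\<phi> (\<tau> y)) = (\<tau> ^^ p) (m (\<phi> y))"
proof -
  note fi = fhom_inv[OF G_hom[OF f(1)]]
  \<comment> \<open>In terms of this conjugate of \<open>\<tau>\<close>, the equation sought is
    \<open>m \<circ> \<sigma> = (\<tau> ^^ p) \<circ> m\<close> on \<open>B\<close>.\<close>
  define \<sigma> where "\<sigma> = \<phi> \<circ> \<tau> \<circ> finv \<phi>"
  have invG: "finv g \<in> G" if "g \<in> G" for g using that by (rule aut_groupD(3)[OF G_group])
  have sG: "\<sigma> \<in> G" unfolding \<sigma>_def using f(1) t(1) invG by (intro aut_groupD(4)[OF G_group])
  note si = fhom_inv[OF G_hom[OF sG]]
  have s_mu: "\<sigma> z = z" if z: "z \<in> mu" for z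
    using t(2)[OF G_mu[OF invG[OF f(1)] z]] by (simp add: \<sigma>_def fi)
  have s_pow: "\<sigma> ^^ k = \<phi> \<circ> (\<tau> ^^ k) \<circ> finv \<phi>" for k
  proof (induction k)
    case 0
    then show ?case by (simp add: fun_eq_iff fi)
  next
    case (Suc k)
    then show ?case by (simp add: \<sigma>_def fun_eq_iff fi)
  qed
  have BG: "g y \<in> B" if "g \<in> G" "y \<in> B" for g y using that by (rule B(2))
  note rs = finv_restr[OF fhom_bij[OF G_hom] B(1) BG]
  define Q where "Q = restr B ` wild"
  have wG: "m \<in> G" if "m \<in> wild" for m using that by (rule wild_G)
  have Q: "perm_group Q" unfolding perm_group_def
  proof (intro conjI ballI)
    show "finite Q" unfolding Q_def using BG wG by (intro finite_restr[OF B(1)]) blast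
    show "id \<in> Q" unfolding Q_def using aut_groupD(1)[OF wild_group] restr_id by (metis image_eqI)
    fix g h assume "g \<in> Q" "h \<in> Q"
    then obtain m m' where "m \<in> wild" "g = restr B m" "m' \<in> wild" "h = restr B m'" by (auto simp: Q_def)
    moreover from this have "restr B (m \<circ> m') = g \<circ> h" "m \<circ> m' \<in> wild"
      using restr_comp[of B m' m] BG[OF wG] aut_groupD(4)[OF wild_group, of m m'] by auto
    ultimately show "g \<circ> h \<in> Q" unfolding Q_def by (metis image_eqI)
  next
    fix g assume "g \<in> Q"
    then obtain m where m: "m \<in> wild" "g = restr B m" by (auto simp: Q_def)
    have mi: "finv m \<in> wild" by (rule aut_groupD(3)[OF wild_group m(1)])
    note fm = fhom_inv[OF G_hom[OF wG[OF m(1)]]]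
    have "m \<circ> finv m = id" "finv m \<circ> m = id" by (simp_all add: fun_eq_iff fm)
    then have "g \<circ> restr B (finv m) = id" "restr B (finv m) \<circ> g = id"
      using restr_comp[of B "finv m" m] restr_comp[of B m "finv m"] BG[OF wG[OF mi]] BG[OF wG[OF m(1)]]
      by (simp_all add: m(2) restr_id)
    then show "\<exists>h\<in>Q. g \<circ> h = id \<and> h \<circ> g = id" using mi by (auto simp: Q_def)
  qed
  have pw: "\<exists>k. g ^^ (p ^ k) = id" if "g \<in> Q" for g
  proof -
    obtain m where m: "m \<in> wild" "g = restr B m" using \<open>g \<in> Q\<close> by (auto simp: Q_def)
    obtain k where "\<forall>y\<in>B. (m ^^ (p ^ k)) y = y" using wild_p_power[OF m(1) B(1)] B(2) by blast
    then have "restr B (m ^^ (p ^ k)) = restr B id" by (simp add: restr_eq_iff)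
    then have "g ^^ (p ^ k) = id" using restr_funpow[of B m] BG[OF wG[OF m(1)]] by (simp add: m(2) restr_id)
    then show ?thesis ..
  qed
  define a b where "a = restr B (\<tau> ^^ p)" and "b = restr B \<sigma>"
  have tpG: "\<tau> ^^ p \<in> G" using t(1) by (rule G_pow)
  have aN: "a ^^ N = id"
  proof -
    have "((\<tau> ^^ p) ^^ N) y = y" if "y \<in> B" for y
      using funpow_fixed[OF N(3)[OF that], of p] by (simp add: funpow_mult mult.commute)
    then have "restr B ((\<tau> ^^ p) ^^ N) = restr B id" by (simp add: restr_eq_iff)
    then show ?thesis unfolding a_def using restr_funpow[of B "\<tau> ^^ p"] BG[OF tpG] by (simp add: restr_id)
  qed
  have bN: "b ^^ N = id"
  proof -
    have "(\<sigma> ^^ N) y = y" if "y \<in> B" for y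
      using N(3)[OF BG[OF invG[OF f(1)] that]] by (simp add: s_pow fi)
    then have "restr B (\<sigma> ^^ N) = restr B id" by (simp add: restr_eq_iff)
    then show ?thesis unfolding b_def using restr_funpow[of B \<sigma>] BG[OF sG] by (simp add: restr_id)
  qed
  \<comment> \<open>\<open>\<sigma>\<close> and \<open>\<tau> ^^ p\<close> both fix
    \<open>mu\<close> and multiply \<open>d (2 * n)\<close> by \<open>\<xi> ^ p\<close>, so
    \<open>\<tau> ^^ p\<close> after a wild \<open>m\<close> after the inverse of
    \<open>\<sigma>\<close> is again wild.\<close>
  have norm: "a \<circ> g \<circ> finv b \<in> Q" if "g \<in> Q" for g
  proof -
    obtain m where m: "m \<in> wild" "g = restr B m" using \<open>g \<in> Q\<close> by (auto simp: Q_def)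
    define h where "h = (\<tau> ^^ p) \<circ> m \<circ> finv \<sigma>"
    have hG: "h \<in> G" unfolding h_def using tpG wG[OF m(1)] invG[OF sG] by (intro aut_groupD(4)[OF G_group])
    have "h \<in> wild"
    proof (rule wildI[OF hG])
      fix z assume z: "z \<in> mu"
      have "finv \<sigma> z = z" using si(3)[of z] s_mu[OF z] by simp
      moreover have "(\<tau> ^^ k) z = z" for k using t(2)[OF z] by (induction k) auto
      ultimately show "h z = z" using wild_mu[OF m(1) z] by (simp add: h_def)
    next
      fix n assume n: "n > 0" "\<not> p dvd n"
      obtain \<xi> where x: "\<And>i. \<xi> ^ i = 1 \<longleftrightarrow> n dvd i" "\<tau> (d (2 * n)) = \<xi> * d (2 * n)"
        using t(3)[OF n] by blast
      have "\<xi> ^ n = 1" using x(1) by simp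
      then have xmu: "\<xi> \<in> mu" using n unfolding mu_def by blast
      have x0: "\<xi> ^ p \<noteq> 0" using mu_unit(1)[OF xmu] by simp
      have ximu: "inverse (\<xi> ^ p) \<in> mu" by (rule mu_inverse[OF mu_power[OF xmu]])
      let ?d = "d (2 * n)"
      have fd: "finv \<phi> ?d = ?d" using fi(3)[of ?d] f(3)[OF n] by simp
      have "\<sigma> ?d = \<xi> ^ p * ?d"
        unfolding \<sigma>_def using f(2)[OF xmu] f(3)[OF n] by (simp add: fd x(2) G_simps[OF f(1)])
      then have "\<sigma> (inverse (\<xi> ^ p) * ?d) = ?d" using x0 s_mu[OF ximu] by (simp add: G_simps(4)[OF sG])
      then have "finv \<sigma> ?d = inverse (\<xi> ^ p) * ?d" using si(3)[of "inverse (\<xi> ^ p) * ?d"] by simp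
      moreover have "m (inverse (\<xi> ^ p) * ?d) = inverse (\<xi> ^ p) * ?d"
        using wild_mu[OF m(1) ximu] wild_d[OF m(1) n] by (simp add: G_simps(4)[OF wG[OF m(1)]])
      moreover have "(\<tau> ^^ p) (inverse (\<xi> ^ p) * ?d) = ?d"
      proof -
        have "(\<tau> ^^ k) u = u" if "u \<in> mu" for k u using t(2)[OF that] by (induction k) auto
        then show ?thesis using tau_pow_d[OF t(1,2) xmu x(2), of p] x0 ximu
          by (simp add: G_simps(4)[OF tpG])
      qed
      ultimately show "h ?d = ?d" by (simp add: h_def)
    qed
    moreover have "a \<circ> g \<circ> finv b = restr B h"
    proof -
      have "finv b = restr B (finv \<sigma>)" unfolding b_def by (rule rs(2)[OF sG sG])
      moreover have "restr B h = restr B ((\<tau> ^^ p) \<circ> m) \<circ> restr B (finv \<sigma>)"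
        unfolding h_def using BG[OF invG[OF sG]] by (intro restr_comp)
      moreover have "restr B ((\<tau> ^^ p) \<circ> m) = restr B (\<tau> ^^ p) \<circ> restr B m"
        using BG[OF wG[OF m(1)]] by (intro restr_comp)
      ultimately show ?thesis by (simp only: a_def m(2))
    qed
    ultimately show ?thesis by (auto simp: Q_def)
  qed
  have ba: "bij a" unfolding a_def by (rule rs(1)[OF tpG tpG])
  have bb: "bij b" unfolding b_def by (rule rs(1)[OF sG sG])
  from coprime_conjugation[OF Q p pw ba bb N(1,2) aN bN norm]
  obtain g where "g \<in> Q" and g: "a \<circ> g = g \<circ> b" by blast
  then obtain m where m: "m \<in> wild" "g = restr B m" by (auto simp: Q_def)
  have "m (\<phi> (\<tau> y)) = (\<tau> ^^ p) (m (\<phi> y))" if y: "y \<in> B" for y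
  proof -
    have fy: "\<phi> y \<in> B" by (rule BG[OF f(1) y])
    have "(a \<circ> g) (\<phi> y) = (g \<circ> b) (\<phi> y)" unfolding g ..
    then have "(\<tau> ^^ p) (m (\<phi> y)) = m (\<sigma> (\<phi> y))"
      using fy BG[OF wG[OF m(1)] fy] BG[OF sG fy] by (simp add: a_def b_def m(2) restr_def)
    then show ?thesis by (simp add: \<sigma>_def fi)
  qed
  then show ?thesis using m(1) by blast
qed

text \<open>On a finite set \<open>B\<close> around \<open>x\<close>, \<open>\<sigma>\<close> acts
  as \<open>\<tau> ^^ i\<close> after \<open>\<psi> ^^ j\<close>. Two auxiliary points
  \<open>z\<close> and \<open>u\<close> of \<open>B\<close>, fixed by all wild automorphisms, force
  \<open>j\<close> and \<open>i\<close> to be multiples of exponents for which \<open>\<psi>\<close>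
  and \<open>\<tau>\<close> act trivially on \<open>x\<close>.\<close>

lemma wild_trivial:
  assumes s: "\<sigma> \<in> wild"
  shows "\<sigma> x = x"
proof -
  have sG: "\<sigma> \<in> G" by (rule wild_G[OF s])
  obtain \<phi> where f: "\<phi> \<in> G" "\<And>z. z \<in> mu \<Longrightarrow> \<phi> z = z ^ p"
    "\<And>n. n > 0 \<Longrightarrow> \<not> p dvd n \<Longrightarrow> \<phi> (d (2 * n)) = d (2 * n)"
    using phi_exists by blast
  obtain \<tau>0 where t0: "\<tau>0 \<in> G" "\<And>z. z \<in> mu \<Longrightarrow> \<tau>0 z = z"
    "\<And>n. n > 0 \<Longrightarrow> \<not> p dvd n \<Longrightarrow>
      \<exists>\<xi>. (\<forall>i. \<xi> ^ i = 1 \<longleftrightarrow> n dvd i) \<and> \<tau>0 (d (2 * n)) = \<xi> * d (2 * n)"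
    using tau_exists by blast
  define B0 where "B0 = orbit G x"
  have orb: "finite (orbit G y)" "y \<in> orbit G y" for y
    by (rule finite_orbit[OF G_group], rule orbit_self[OF G_group])
  have orbG: "g y \<in> orbit G v" if "g \<in> G" "y \<in> orbit G v" for g y v
    using that by (rule orbit_closed[OF G_group])
  \<comment> \<open>A common exponent of all automorphisms on the orbit of \<open>x\<close>; its
    part \<open>n'\<close> prime to \<open>p\<close> will be shown to divide
    \<open>i\<close>.\<close>
  define M :: nat where "M = fact (card B0)"
  have "M > 0" by (simp add: M_def)
  then obtain s' n' where n': "M = p ^ s' * n'" "n' > 0" "\<not> p dvd n'"
    by (rule prime_power_decompose[OF p])
  have MB0: "(g ^^ M) y = y" if "g \<in> G" "y \<in> B0" for g y
    unfolding M_def using that orb(1)[of x] orbG[of g _ x]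
    by (intro stable_funpow_fact[OF G_hom]) (auto simp: B0_def)
  have pM: "p ^ M > 1" using p_pos(2) \<open>M > 0\<close> by (intro one_less_power)
  \<comment> \<open>A root of unity of exact order \<open>p ^ M - 1\<close> has \<open>M\<close>
    distinct Frobenius iterates, so it detects \<open>j\<close> modulo \<open>M\<close>.\<close>
  define N where "N = p ^ M - 1"
  have N0: "N > 0" "Suc N = p ^ M" using pM by (simp_all add: N_def)
  have Np: "\<not> p dvd N"
  proof
    assume "p dvd N"
    moreover have "p dvd Suc N" unfolding N0(2) using \<open>M > 0\<close> by simp
    ultimately have "p dvd Suc N - N" by (intro dvd_diff_nat)
    then show False using p_pos(2) by simp
  qed
  obtain z :: qbar where z: "\<And>k. z ^ k = 1 \<longleftrightarrow> N dvd k"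
    using primitive_root_exists[OF N0(1)] by metis
  have "z ^ N = 1" using z by simp
  then have zmu: "z \<in> mu" using N0(1) Np unfolding mu_def by blast
  define u where "u = d (2 * n')"
  define B where "B = B0 \<union> orbit G z \<union> orbit G u"
  have B: "finite B" "\<And>g y. g \<in> G \<Longrightarrow> y \<in> B \<Longrightarrow> g y \<in> B"
    using orb(1) orbG by (auto simp: B_def B0_def)
  have inB: "x \<in> B" "z \<in> B" "u \<in> B" "B0 \<subseteq> B" using orb(2) by (auto simp: B_def B0_def)
  define M' :: nat where "M' = fact (card B)"
  have "M' > 0" by (simp add: M'_def)
  then obtain e N' where N': "M' = p ^ e * N'" "N' > 0" "\<not> p dvd N'"
    by (rule prime_power_decompose[OF p])
  have M'B: "(g ^^ M') y = y" if "g \<in> G" "y \<in> B" for g y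
    unfolding M'_def using that B by (intro stable_funpow_fact[OF G_hom]) auto
  \<comment> \<open>On \<open>B\<close> this power has order prime to \<open>p\<close>. It still
    moves the radicals by roots of unity of exact order \<open>n\<close>, because
    \<open>p ^ e\<close> is invertible modulo every \<open>n\<close> prime to
    \<open>p\<close>.\<close>
  define \<tau> where "\<tau> = \<tau>0 ^^ (p ^ e)"
  have tG: "\<tau> \<in> G" unfolding \<tau>_def by (rule G_pow[OF t0(1)])
  have t_mu: "\<tau> v = v" if "v \<in> mu" for v
  proof -
    have "(\<tau>0 ^^ k) v = v" for k using t0(2)[OF that] by (induction k) auto
    then show ?thesis by (simp add: \<tau>_def)
  qed
  have t_d: "\<exists>\<xi>. (\<forall>i. \<xi> ^ i = 1 \<longleftrightarrow> n dvd i) \<and> \<tau> (d (2 * n)) = \<xi> * d (2 * n)"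
    if n: "n > 0" "\<not> p dvd n" for n
  proof -
    obtain \<xi> where x: "\<And>i. \<xi> ^ i = 1 \<longleftrightarrow> n dvd i" "\<tau>0 (d (2 * n)) = \<xi> * d (2 * n)"
      using t0(3)[OF n] by blast
    have "\<xi> ^ n = 1" using x(1) by simp
    then have "\<xi> \<in> mu" using n unfolding mu_def by blast
    then have "\<tau> (d (2 * n)) = \<xi> ^ (p ^ e) * d (2 * n)"
      unfolding \<tau>_def using tau_pow_d[OF t0(1,2) _ x(2)] by blast
    moreover have "(\<xi> ^ (p ^ e)) ^ i = 1 \<longleftrightarrow> n dvd i" for i
    proof -
      have "coprime p n" by (rule prime_imp_coprime[OF p n(2)])
      then have "coprime n (p ^ e)" by (simp add: coprime_commute)
      then show ?thesis by (simp only: power_mult[symmetric] x(1) coprime_dvd_mult_right_iff)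
    qed
    ultimately show ?thesis by blast
  qed
  have tN: "(\<tau> ^^ N') y = y" if "y \<in> B" for y
    using M'B[OF t0(1) that] unfolding \<tau>_def N'(1) by (simp add: funpow_mult)
  obtain m where m: "m \<in> wild" "\<And>y. y \<in> B \<Longrightarrow> m (\<phi> (\<tau> y)) = (\<tau> ^^ p) (m (\<phi> y))"
  proof -
    have "\<exists>m\<in>wild. \<forall>y\<in>B. m (\<phi> (\<tau> y)) = (\<tau> ^^ p) (m (\<phi> y))"
      by (rule frobenius_lift_relation[of \<phi> \<tau> B N']) (fact f tG t_mu t_d B N'(2,3) tN)+
    then show ?thesis using that by blast
  qed
  define \<psi> where "\<psi> = m \<circ> \<phi>"
  have qG: "\<psi> \<in> G" unfolding \<psi>_def by (rule aut_groupD(4)[OF G_group wild_G[OF m(1)] f(1)])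
  have q_mu: "\<psi> v = v ^ p" if "v \<in> mu" for v
    using f(2)[OF that] wild_mu[OF m(1) mu_power[OF that]] by (simp add: \<psi>_def)
  have q_d: "\<psi> (d (2 * n)) = d (2 * n)" if "n > 0" "\<not> p dvd n" for n
    using f(3)[OF that] wild_d[OF m(1) that] by (simp add: \<psi>_def)
  have rel: "\<psi> (\<tau> y) = (\<tau> ^^ p) (\<psi> y)" if "y \<in> B" for y using m(2)[OF that] by (simp add: \<psi>_def)
  have pB: "(g ^^ k) y \<in> B" if "g \<in> G" "y \<in> B" for g k y using B(2)[OF G_pow[OF that(1)] that(2)] .
  have rel1: "\<psi> ((\<tau> ^^ i) y) = (\<tau> ^^ (p * i)) (\<psi> y)" if y: "y \<in> B" for i y
  proof (induction i)
    case (Suc i)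
    have "\<psi> ((\<tau> ^^ Suc i) y) = (\<tau> ^^ p) (\<psi> ((\<tau> ^^ i) y))" using rel[OF pB[OF tG y]] by simp
    also have "\<dots> = (\<tau> ^^ (p + p * i)) (\<psi> y)" unfolding Suc by (simp add: funpow_add)
    finally show ?case by simp
  qed simp
  have rel2: "\<exists>k. \<forall>y\<in>B. (\<psi> ^^ j) ((\<tau> ^^ i) y) = (\<tau> ^^ k) ((\<psi> ^^ j) y)" for i j
  proof (induction j)
    case 0
    then show ?case by (intro exI[of _ i]) simp
  next
    case (Suc j)
    then obtain k where k: "\<And>y. y \<in> B \<Longrightarrow> (\<psi> ^^ j) ((\<tau> ^^ i) y) = (\<tau> ^^ k) ((\<psi> ^^ j) y)" by blast
    have "(\<psi> ^^ Suc j) ((\<tau> ^^ i) y) = (\<tau> ^^ (p * k)) ((\<psi> ^^ Suc j) y)" if y: "y \<in> B" for y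
      using k[OF y] rel1[OF pB[OF qG y]] by simp
    then show ?case by blast
  qed
  \<comment> \<open>Membership constrains the action on \<open>B\<close> alone, where
    \<open>rel\<close> moves powers of \<open>\<tau>\<close> past \<open>\<psi>\<close>; this makes
    \<open>H\<close> closed under composition.\<close>
  define H where "H = {h \<in> G. \<exists>i j. \<forall>y\<in>B. h y = (\<tau> ^^ i) ((\<psi> ^^ j) y)}"
  have Hc: "g \<circ> h \<in> H" if gh: "g \<in> H" "h \<in> H" for g h
  proof -
    obtain i j where g: "g \<in> G" "\<And>y. y \<in> B \<Longrightarrow> g y = (\<tau> ^^ i) ((\<psi> ^^ j) y)" using gh(1) by (auto simp: H_def)
    obtain k l where h: "h \<in> G" "\<And>y. y \<in> B \<Longrightarrow> h y = (\<tau> ^^ k) ((\<psi> ^^ l) y)" using gh(2) by (auto simp: H_def)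
    obtain r where r: "\<And>y. y \<in> B \<Longrightarrow> (\<psi> ^^ j) ((\<tau> ^^ k) y) = (\<tau> ^^ r) ((\<psi> ^^ j) y)" using rel2 by blast
    have "(g \<circ> h) y = (\<tau> ^^ (i + r)) ((\<psi> ^^ (j + l)) y)" if y: "y \<in> B" for y
      using g(2)[OF B(2)[OF h(1) y]] h(2)[OF y] r[OF pB[OF qG y]] by (simp add: funpow_add)
    then show ?thesis unfolding H_def using aut_groupD(4)[OF G_group g(1) h(1)] by blast
  qed
  have Hid: "id \<in> H" unfolding H_def using aut_groupD(1)[OF G_group]
    by (intro CollectI conjI exI[of _ 0]) simp_all
  have Hp: "h ^^ k \<in> H" if "h \<in> H" for h k using that by (induction k) (simp_all only: funpow.simps Hid Hc)
  have Hi: "finv h \<in> H" if h: "h \<in> H" for h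
  proof -
    have hG: "h \<in> G" using h by (simp add: H_def)
    note hi = fhom_inv[OF G_hom[OF hG]]
    \<comment> \<open>\<open>M'\<close> is a common exponent on \<open>B\<close>, so inverses are
      powers there.\<close>
    have "finv h y = (h ^^ (M' - 1)) y" if y: "y \<in> B" for y
    proof -
      have "h ((h ^^ (M' - 1)) y) = y" using M'B[OF hG y] \<open>M' > 0\<close> by (cases M') auto
      then show ?thesis using hi(3)[of "(h ^^ (M' - 1)) y"] by simp
    qed
    moreover obtain i j where "\<And>y. y \<in> B \<Longrightarrow> (h ^^ (M' - 1)) y = (\<tau> ^^ i) ((\<psi> ^^ j) y)"
      using Hp[OF h, of "M' - 1"] by (auto simp: H_def)
    ultimately show ?thesis unfolding H_def using aut_groupD(3)[OF G_group hG] by auto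
  qed
  have Hg: "aut_group H" unfolding aut_group_def using Hid Hi Hc G_hom by (auto simp: H_def)
  have "\<tau> \<in> H" unfolding H_def using tG
    by (intro CollectI conjI exI[of _ 1] exI[of _ 0]) simp_all
  moreover have "\<psi> \<in> H" unfolding H_def using qG
    by (intro CollectI conjI exI[of _ 0] exI[of _ 1]) simp_all
  ultimately have fixL: "fixed H \<subseteq> L"
    using generating_pair[of \<psi> \<tau>, OF qG q_mu tG t_mu t_d] unfolding fixed_def by blast
  have s_fix: "\<sigma> \<in> aut (fixed H)" using sG fixL by (auto simp: aut_def)
  \<comment> \<open>\<open>aut_fixed_orbit\<close> controls one element at a time. It is applied to
    \<open>x + t * z + t ^ 2 * u\<close> for all \<open>t\<close>; since \<open>H\<close> has
    finitely many restrictions to \<open>B\<close>, one \<open>h\<close> serves infinitely many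
    \<open>t\<close>, and a quadratic polynomial with infinitely many roots is zero.\<close>
  have "\<exists>h\<in>H. \<sigma> x = h x \<and> \<sigma> z = h z \<and> \<sigma> u = h u"
  proof -
    define y where "y t = x + of_nat t * (z + of_nat t * u)" for t :: nat
    have "\<exists>h\<in>H. \<sigma> (y t) = h (y t)" for t
      using aut_fixed_orbit[OF Hg s_fix, of "y t"] by (auto simp: orbit_def)
    then obtain h where h: "\<And>t. h t \<in> H" "\<And>t. \<sigma> (y t) = h t (y t)" by metis
    have hG: "h t \<in> G" for t using h(1)[of t] by (simp add: H_def)
    have "finite (restr B ` H)" using B by (intro finite_restr) (auto simp: H_def)
    then have "finite (range (\<lambda>t. restr B (h t)))" using h(1) by (elim finite_subset[rotated]) auto
    then obtain t0 where t0: "infinite {t. restr B (h t) = restr B (h t0)}"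
      using pigeonhole_infinite[of UNIV "\<lambda>t. restr B (h t)"] by auto
    define g where "g = h t0"
    define q where "q = [:\<sigma> x - g x, \<sigma> z - g z, \<sigma> u - g u:]"
    have root: "poly q (of_nat t) = 0" if t: "restr B (h t) = restr B (h t0)" for t
    proof -
      have "h t x = g x" "h t z = g z" "h t u = g u" using t inB by (simp_all add: restr_eq_iff g_def)
      then have "\<sigma> x + of_nat t * (\<sigma> z + of_nat t * \<sigma> u) = g x + of_nat t * (g z + of_nat t * g u)"
        using h(2)[of t] by (simp add: y_def G_simps[OF sG] G_simps[OF hG])
      then show ?thesis by (simp add: q_def algebra_simps)
    qed
    have "infinite ((of_nat :: nat \<Rightarrow> qbar) ` {t. restr B (h t) = restr B (h t0)})"
      using t0 by (simp add: finite_image_iff inj_on_def)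
    moreover have "(of_nat :: nat \<Rightarrow> qbar) ` {t. restr B (h t) = restr B (h t0)} \<subseteq> {v. poly q v = 0}"
      using root by auto
    ultimately have "infinite {v. poly q v = 0}" using finite_subset by blast
    then have "q = 0" using poly_roots_finite by blast
    then have "\<sigma> x = g x \<and> \<sigma> z = g z \<and> \<sigma> u = g u" by (simp add: q_def)
    then show ?thesis using h(1) g_def by blast
  qed
  then obtain h where h: "h \<in> H" "\<sigma> x = h x" "\<sigma> z = h z" "\<sigma> u = h u" by blast
  obtain i j where ij: "\<And>y. y \<in> B \<Longrightarrow> h y = (\<tau> ^^ i) ((\<psi> ^^ j) y)" using h(1) by (auto simp: H_def)
  have q_pow: "(\<psi> ^^ k) z = z ^ (p ^ k)" for k
    by (induction k) (simp_all add: G_simps(9)[OF qG] q_mu[OF zmu] power_mult mult.commute flip: power_mult)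
  have t_pow: "(\<tau> ^^ k) v = v" if "v \<in> mu" for k v using t_mu[OF that] by (induction k) auto
  have "z ^ (p ^ j) = z"
    using ij[OF inB(2)] h(3) wild_mu[OF s zmu] q_pow[of j] t_pow[OF mu_power[OF zmu]] by simp
  moreover have "z ^ (p ^ M) = z" unfolding N0(2)[symmetric] using z by simp
  ultimately have zr: "z ^ (p ^ (j mod M)) = z" using pow_mod_fixed[of z p M j] by simp
  have z0: "z \<noteq> 0" by (rule mu_unit(1)[OF zmu])
  have pr: "p ^ (j mod M) > 0" using p_pos(1) by simp
  have "z * z ^ (p ^ (j mod M) - 1) = z * 1" using zr pr by (simp flip: power_Suc)
  \<comment> \<open>As \<open>p ^ (j mod M) - 1 < N\<close>, this divisibility leaves only
    \<open>j mod M = 0\<close>.\<close>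
  then have "N dvd p ^ (j mod M) - 1" using z0 z by simp
  moreover have "p ^ (j mod M) - 1 < N"
  proof -
    have "p ^ (j mod M) < p ^ M" using \<open>M > 0\<close> p_pos(2) by (intro power_strict_increasing) auto
    then show ?thesis using pr unfolding N_def by linarith
  qed
  ultimately have "p ^ (j mod M) - 1 = 0" by (meson dvd_imp_le linorder_not_le neq0_conv)
  then have "p ^ (j mod M) = 1" using pr by linarith
  then have "j mod M = 0" using p_pos(2) by simp
  then obtain k where k: "j = M * k" by (auto simp: mod_eq_0_iff_dvd elim: dvdE)
  have xB0: "x \<in> B0" using orb(2) by (simp add: B0_def)
  have qx: "(\<psi> ^^ j) x = x" unfolding k by (rule funpow_fixed[OF MB0[OF qG xB0]])
  obtain \<xi> where xi: "\<And>i. \<xi> ^ i = 1 \<longleftrightarrow> n' dvd i" "\<tau> u = \<xi> * u"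
    using t_d[OF n'(2,3)] unfolding u_def by blast
  have "\<xi> ^ n' = 1" using xi(1) by simp
  then have xmu: "\<xi> \<in> mu" using n'(2,3) unfolding mu_def by blast
  have qu: "(\<psi> ^^ k) u = u" for k unfolding u_def using q_d[OF n'(2,3)] by (induction k) auto
  have u0: "u \<noteq> 0" unfolding u_def using n'(2) by (intro d_nz) simp
  have "\<sigma> u = u" unfolding u_def by (rule wild_d[OF s n'(2,3)])
  then have "\<xi> ^ i * u = u"
    using ij[OF inB(3)] h(4) qu tau_pow_d[OF tG t_mu xmu xi(2), of i] by simp
  then have "\<xi> ^ i = 1" using u0 by simp
  then have "n' dvd i" by (simp only: xi(1))
  then obtain l where l: "i = n' * l" by (rule dvdE)
  \<comment> \<open>The period of \<open>x\<close> under \<open>\<tau> ^^ n'\<close> divides a power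
    of \<open>p\<close>, by the choice of \<open>n'\<close>, and also \<open>N'\<close>, which is
    prime to \<open>p\<close>.\<close>
  have "(\<tau> ^^ n') x = x"
  proof (rule funpow_coprime_fixed)
    show "((\<tau> ^^ n') ^^ (p ^ s')) x = x"
      using MB0[OF tG xB0] unfolding n'(1) by (simp add: funpow_mult mult.commute)
    show "((\<tau> ^^ n') ^^ N') x = x"
      using funpow_fixed[OF tN[OF inB(1)], of n'] by (simp add: funpow_mult mult.commute)
    have "coprime p N'" by (rule prime_imp_coprime[OF p N'(3)])
    then show "coprime (p ^ s') N'" by simp
    show "p ^ s' > 0" using p_pos(1) by simp
  qed
  then have "(\<tau> ^^ i) x = x" unfolding l by (rule funpow_fixed)
  then show ?thesis using h(2) ij[OF inB(1)] qx by simp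
qed

end

section \<open>Transfer to the complex numbers\<close>

lemma ring_of_type_algebra_simps:
  "carrier ring_of_type_algebra = UNIV" "monoid.mult ring_of_type_algebra x y = x * y"
  "one ring_of_type_algebra = 1" "ring.zero ring_of_type_algebra = 0" "add ring_of_type_algebra x y = x + y"
  for x y :: "'a::ring_1"
  by (simp_all add: ring_of_type_algebra_def)

lemma subring_of_type:
  assumes "is_subring (A :: 'a::field set)"
  shows "subring A (ring_of_type_algebra :: 'a ring)"
proof -
  interpret R: field "ring_of_type_algebra :: 'a ring" by (rule field_from_type_algebra)
  note D = is_subringD[OF assms]
  have minus: "\<ominus>\<^bsub>ring_of_type_algebra\<^esub> x = - x" for x :: 'a
    by (rule R.minus_equality) (simp_all add: ring_of_type_algebra_simps)
  show ?thesis
    by (rule R.subringI) (simp_all add: ring_of_type_algebra_simps minus D)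
qed

lemma subfield_of_type:
  assumes "is_subfield (A :: 'a::field set)"
  shows "subfield A (ring_of_type_algebra :: 'a ring)"
proof -
  interpret R: field "ring_of_type_algebra :: 'a ring" by (rule field_from_type_algebra)
  note D = is_subfieldD[OF assms]
  have "is_subring A" using assms by (simp add: is_subring_def is_subfield_def)
  then have "subring A (ring_of_type_algebra :: 'a ring)" by (rule subring_of_type)
  then show ?thesis
  proof (rule R.subfieldI')
    fix k :: 'a assume k: "k \<in> A - {\<zero>\<^bsub>ring_of_type_algebra\<^esub>}"
    then have "k \<noteq> 0" by (simp add: ring_of_type_algebra_simps)
    then have "inv\<^bsub>ring_of_type_algebra\<^esub> k = inverse k"
      by (intro R.comm_inv_char) (simp_all add: ring_of_type_algebra_simps)
    then show "inv\<^bsub>ring_of_type_algebra\<^esub> k \<in> A" using k D by simp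
  qed
qed

primrec numeral_term :: "nat \<Rightarrow> vf_term" where
  "numeral_term 0 = TZero"
| "numeral_term (Suc n) = TAdd TOne (numeral_term n)"

lemma numeral_term: "term_value e (numeral_term n) = of_nat n" "term_vars (numeral_term n) = {}"
  by (induction n) simp_all

context maximal_field
begin

text \<open>On the range of \<open>emb\<close>, the algebraic numbers, this is \<open>w\<close>;
  other complex numbers get irrelevant values.\<close>

definition v :: "complex \<Rightarrow> rat" where "v x = w (finv emb x)"
abbreviation "LC \<equiv> emb ` L"

lemma emb_simps: "finv emb (emb x) = x" "emb (x + y) = emb x + emb y" "emb (x * y) = emb x * emb y"
  "emb (x - y) = emb x - emb y" "emb (- x) = - emb x" "emb 0 = 0" "emb 1 = 1" "emb (inverse x) = inverse (emb x)"
  "emb x = 0 \<longleftrightarrow> x = 0" "emb x = emb y \<longleftrightarrow> x = y" "emb (x ^ n) = emb x ^ n" "emb (of_nat n) = of_nat n"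
  "emb (of_int k) = of_int k"
  using hom_simps[OF emb(1)] by (simp_all add: inj_def)

lemma v_emb: "v (emb x) = w x" by (simp add: v_def emb_simps)

lemma subfield_image: "is_subfield A \<Longrightarrow> is_subfield (emb ` A)"
  unfolding is_subfield_def
  by (auto simp flip: emb_simps(3,4,8)) (metis emb_simps(7) imageI)

lemma valued_image: "is_subfield A \<Longrightarrow> valued_field (emb ` A) v"
  unfolding valued_field_def
proof (intro conjI ballI impI)
  assume A: "is_subfield A"
  show "subfield (emb ` A) ring_of_type_algebra" by (rule subfield_of_type[OF subfield_image[OF A]])
  fix x y assume "x \<in> emb ` A - {0}" "y \<in> emb ` A - {0}"
  then obtain x' y' where x: "x = emb x'" "x' \<noteq> 0" and y: "y = emb y'" "y' \<noteq> 0" by (auto simp: emb_simps)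
  show "v (x * y) = v x + v y" using w_mult[OF x(2) y(2)] by (simp add: x(1) y(1) v_emb flip: emb_simps(3))
  assume "x + y \<noteq> 0"
  then have "x' + y' \<noteq> 0" by (auto simp: x(1) y(1) emb_simps simp flip: emb_simps(2))
  then show "min (v x) (v y) \<le> v (x + y)"
    using w_add[OF x(2) y(2)] by (simp add: x(1) y(1) v_emb flip: emb_simps(2))
qed

lemma ring_LC: "valuation_ring LC v = emb ` {x \<in> L. vge x 0}"
  and ideal_LC: "valuation_ideal LC v = emb ` {x \<in> L. vgt x 0}"
  unfolding valuation_ring_def valuation_ideal_def by (auto simp: v_emb emb_simps vge_def vgt_def)

lemma poly_preimage:
  assumes "\<And>i. coeff f i \<in> emb ` A"
  obtains g where "f = map_poly emb g" "\<And>i. coeff g i \<in> A"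
proof
  have *: "finv emb (coeff f i) \<in> A \<and> emb (finv emb (coeff f i)) = coeff f i" for i
    using assms[of i] by (auto simp: emb_simps)
  have z: "finv emb 0 = 0" using emb_simps(1)[of 0] by (simp add: emb_simps)
  show "f = map_poly emb (map_poly (finv emb) f)"
    by (rule poly_eqI) (simp add: coeff_map_poly z emb_simps *)
  show "coeff (map_poly (finv emb) f) i \<in> A" for i using * by (simp add: coeff_map_poly z)
qed

lemma map_poly_pderiv: "pderiv (map_poly emb g) = map_poly emb (pderiv g)"
  by (rule poly_eqI) (simp add: coeff_pderiv coeff_map_poly emb_simps del: of_nat_Suc)

lemma henselian_LC: "henselian LC v"
  unfolding henselian_def
proof (intro conjI allI impI)
  show "valued_field LC v" by (rule valued_image[OF L_subfield])
  fix f b assume *: "(\<forall>i. coeff f i \<in> valuation_ring LC v) \<and> b \<in> valuation_ring LC v \<and>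
    poly f b \<in> valuation_ideal LC v \<and> poly (pderiv f) b \<notin> valuation_ideal LC v"
  then have "coeff f i \<in> emb ` {x \<in> L. vge x 0}" for i by (simp add: ring_LC)
  then obtain g where g: "f = map_poly emb g" "\<And>i. coeff g i \<in> {x \<in> L. vge x 0}"
    by (rule poly_preimage) blast
  obtain b' where b': "b = emb b'" "b' \<in> L" "vge b' 0" using * by (auto simp: ring_LC)
  have gL: "coeffs_in L g" using g(2) by (simp add: coeffs_in_def)
  have "coeffs_in L (pderiv g)" unfolding coeffs_in_def coeff_pderiv
    using g(2) is_subfield_of_int[OF L_subfield, of "int (Suc _)"]
    by (intro allI is_subfieldD(4)[OF L_subfield]) (auto simp del: of_nat_Suc)
  then have dL: "poly (pderiv g) b' \<in> L" using b'(2) by (rule poly_coeffs_in[OF L_subfield])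
  have "emb (poly g b') \<in> emb ` {x \<in> L. vgt x 0}" using * by (simp add: g(1) b'(1) hom_poly[OF emb(1)] ideal_LC)
  then have fb: "vgt (poly g b') 0" by (auto simp: emb_simps)
  have "emb (poly (pderiv g) b') \<notin> emb ` {x \<in> L. vgt x 0}"
    using * by (simp add: g(1) b'(1) hom_poly[OF emb(1)] ideal_LC map_poly_pderiv)
  then have "\<not> vgt (poly (pderiv g) b') 0" using dL by auto
  with henselian_of_closed[OF L_subfield L_closed gL _ b'(2,3) fb] g(2)
  obtain a where a: "a \<in> L" "poly g a = 0" "cg a b'" by auto
  have "vge a 0" by (rule cg_vge[OF cg_sym[OF a(3)] b'(3)])
  then have "emb a \<in> valuation_ring LC v" using a(1) by (simp add: ring_LC)
  moreover have "poly f (emb a) = 0" using a(2) by (simp add: g(1) emb_simps flip: hom_poly[OF emb(1)])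
  moreover have "emb a - b \<in> valuation_ideal LC v" unfolding ideal_LC b'(1)
    using a b'(2) is_subfieldD(3)[OF L_subfield] by (intro image_eqI[of _ _ "a - b'"]) (simp_all add: emb_simps)
  ultimately show "\<exists>a\<in>valuation_ring LC v. poly f a = 0 \<and> a - b \<in> valuation_ideal LC v" by blast
qed

lemma closure_LC: "algebraic_closure_in LC = range emb"
proof
  show "algebraic_closure_in LC \<subseteq> range emb"
  proof
    fix x assume "x \<in> algebraic_closure_in LC"
    then obtain f where f: "f \<noteq> 0" "\<And>i. coeff f i \<in> LC" "poly f x = 0"
      by (auto simp: algebraic_closure_in_def)
    obtain g where g: "f = map_poly emb g" using poly_preimage[OF f(2)] by blast
    have "g \<noteq> 0" using f(1) g by auto
    then show "x \<in> range emb" using hom_root_in_range[OF emb(1), of g x] f(3) g by auto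
  qed
  show "range emb \<subseteq> algebraic_closure_in LC"
  proof
    fix x assume "x \<in> range emb"
    then have "algebraic x" using emb(2) by auto
    then obtain f where f: "\<And>i. coeff f i \<in> \<int>" "f \<noteq> 0" "poly f x = 0" unfolding algebraic_def by blast
    have "coeff f i \<in> LC" for i
      using f(1)[of i] is_subfield_of_int[OF subfield_image[OF L_subfield]] by (auto elim: Ints_cases)
    then show "x \<in> algebraic_closure_in LC" using f by (auto simp: algebraic_closure_in_def)
  qed
qed

text \<open>The orbit polynomial has simple roots, so its derivative vanishes at none of them and a
  common factor can have no root.\<close>

lemma separable_LC: "separable_over LC (emb y)"
proof -
  define f where "f = map_poly emb (orbit_poly G y)"
  have f0: "f \<noteq> 0" using orbit_poly_nz hom_map_poly(5)[OF emb(1)] by (simp add: f_def)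
  have "coeff f i \<in> LC" for i
    using orbit_poly_fixed[OF G_group, of y] by (simp add: f_def coeff_map_poly emb_simps G_fixed coeffs_in_def)
  moreover have "poly f (emb y) = 0"
    using orbit_poly_root[OF G_group, of y y] orbit_self[OF G_group, of y]
    by (simp add: f_def emb_simps flip: hom_poly[OF emb(1)])
  moreover have "coprime f (pderiv f)"
  proof (rule coprimeI)
    fix q assume q: "q dvd f" "q dvd pderiv f"
    have q0: "q \<noteq> 0" using q(1) f0 by auto
    have "degree q = 0"
    proof (rule ccontr)
      assume "degree q \<noteq> 0"
      then obtain a where a: "poly q a = 0" using alg_closed_imp_poly_has_root[of q] by auto
      then have fa: "poly f a = 0" "poly (pderiv f) a = 0" using q by (auto elim!: dvdE)
      have "orbit_poly G y \<noteq> 0" by (rule orbit_poly_nz)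
      from hom_root_in_range[OF emb(1) this] fa(1)
      obtain u where u: "poly (orbit_poly G y) u = 0" "a = emb u" unfolding f_def by blast
      let ?B = "orbit G y"
      have uB: "u \<in> ?B" using u(1) orbit_poly_root[OF G_group] by blast
      define h where "h = (\<Prod>b\<in>?B - {u}. [:-b, 1:])"
      have oh: "orbit_poly G y = [:-u, 1:] * h" unfolding orbit_poly_def h_def
        by (rule prod.remove[OF finite_orbit[OF G_group] uB])
      have "poly (pderiv (orbit_poly G y)) u = poly h u"
        unfolding oh pderiv_mult by (simp add: pderiv_pCons)
      also have "\<dots> \<noteq> 0" unfolding h_def poly_prod using finite_orbit[OF G_group, of y] by (simp add: prod_zero_iff)
      finally have "poly (pderiv f) a \<noteq> 0"
        unfolding u(2) f_def map_poly_pderiv by (simp add: emb_simps flip: hom_poly[OF emb(1)])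
      then show False using fa(2) by simp
    qed
    then show "is_unit q" using q0 by (simp add: is_unit_iff_degree)
  qed
  ultimately show ?thesis unfolding separable_over_def using f0 by blast
qed

text \<open>An element of the ramification group, pulled back along \<open>emb\<close>, is a wild
  automorphism of \<open>qbar\<close> and hence the identity.\<close>

lemma ramification_LC: "ramification_field (range emb) LC v = range emb"
proof -
  have "\<sigma> (emb y) = emb y" if s: "\<sigma> \<in> ramification_group (range emb) LC v" for \<sigma> y
  proof -
    have iso: "\<sigma> \<in> ring_iso (subring_struct (range emb)) (subring_struct (range emb))"
      and fx: "\<And>x. x \<in> LC \<Longrightarrow> \<sigma> x = x"
      and ram: "\<And>x. x \<in> range emb - {0} \<Longrightarrow> \<sigma> x - x = 0 \<or> v x < v (\<sigma> x - x)"
      using s unfolding ramification_group_def automorphisms_over_def by blast+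
    have hom: "\<sigma> \<in> ring_hom (subring_struct (range emb)) (subring_struct (range emb))"
      using iso by (simp add: ring_iso_def)
    define \<tau> where "\<tau> x = finv emb (\<sigma> (emb x))" for x
    have t: "emb (\<tau> x) = \<sigma> (emb x)" for x
      using ring_hom_closed[OF hom, of "emb x"] unfolding \<tau>_def by (auto simp: emb_simps)
    have "fhom \<tau>" unfolding hom_on_def
    proof (intro conjI ballI)
      have "emb (\<tau> 1) = emb 1" using ring_hom_one[OF hom] by (simp add: t emb_simps ring_of_type_algebra_simps)
      then show "\<tau> 1 = 1" by (rule emb_simps(10)[THEN iffD1])
      fix x y
      have "emb (\<tau> (x + y)) = emb (\<tau> x + \<tau> y)"
        using ring_hom_add[OF hom, of "emb x" "emb y"] by (simp add: t emb_simps ring_of_type_algebra_simps)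
      then show "\<tau> (x + y) = \<tau> x + \<tau> y" by (rule emb_simps(10)[THEN iffD1])
      have "emb (\<tau> (x * y)) = emb (\<tau> x * \<tau> y)"
        using ring_hom_mult[OF hom, of "emb x" "emb y"] by (simp add: t emb_simps ring_of_type_algebra_simps)
      then show "\<tau> (x * y) = \<tau> x * \<tau> y" by (rule emb_simps(10)[THEN iffD1])
    qed
    moreover have "\<tau> x = x" if "x \<in> L" for x using fx[of "emb x"] that by (simp add: \<tau>_def emb_simps)
    ultimately have "\<tau> \<in> G" by (simp add: aut_def)
    moreover have "vgt (\<tau> x - x) (w x)" if "x \<noteq> 0" for x
    proof -
      have "\<sigma> (emb x) - emb x = emb (\<tau> x - x)" by (simp only: t emb_simps(4))
      moreover have "emb x \<in> range emb - {0}" using that by (simp add: emb_simps(9))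
      ultimately have "emb (\<tau> x - x) = 0 \<or> w x < w (\<tau> x - x)" using ram[of "emb x"] by (simp only: v_emb)
      then show ?thesis unfolding vgt_def by (simp only: emb_simps(9))
    qed
    ultimately have "\<tau> \<in> wild" by (simp add: wild_def)
    then have "\<tau> y = y" by (rule wild_trivial)
    then show ?thesis using t[of y] by simp
  qed
  then show ?thesis using separable_LC unfolding ramification_field_def by blast
qed

lemma tame_LC: "tame_field LC v"
  unfolding tame_field_def closure_LC
proof (intro conjI exI[of _ v])
  show "henselian LC v" by (rule henselian_LC)
  show "valued_field (range emb) v" by (rule valued_image[OF is_subfield_UNIV])
  show "extends_valuation (range emb) v LC v" by (auto simp: extends_valuation_def)
  show "ramification_field (range emb) LC v = range emb" by (rule ramification_LC)
qed

lemma padic_LC: "extends_padic p v"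
  unfolding extends_padic_def
proof (intro allI impI)
  fix q :: rat assume "q \<noteq> 0"
  then show "v (of_rat q) = padic_valuation p q"
    using v_emb[of "of_rat q"] w_rat by (simp add: hom_of_rat[OF emb(1)])
qed

lemma value_group_LC:
  "value_group LC v = p_divisible_hull p (range (\<lambda>k::int. of_int k * (1 / 2 * padic_valuation p (of_nat p))))"
proof -
  have pp: "padic_valuation p (of_nat p) = 1" using w_rat[of "of_nat p"] w_p p_pos by simp
  have "value_group LC v = Gam"
  proof
    show "value_group LC v \<subseteq> Gam"
    proof
      fix r assume "r \<in> value_group LC v"
      then obtain y where y: "y \<in> LC" "y \<noteq> 0" "r = v y" by (auto simp: value_group_def)
      then obtain x where x: "x \<in> L" "y = emb x" by blast
      then have "x \<noteq> 0" using y(2) emb_simps(9) by blast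
      then show "r \<in> Gam" using L_Gam[OF x(1)] y(3) x(2) by (simp add: v_emb)
    qed
    show "Gam \<subseteq> value_group LC v"
    proof
      fix r assume "r \<in> Gam"
      then obtain k a where a: "of_nat (p ^ k) * (2 * r) = (of_int a :: rat)" by (auto simp: Gam_def elim: Ints_cases)
      have n: "2 * p ^ k > 0" using p_pos by simp
      \<comment> \<open>The radical has value \<open>1 / (2 * p ^ k)\<close>, so its integer powers
        realize every element of \<open>Gam\<close>.\<close>
      define x where "x = d (2 * p ^ k) powi a"
      define q :: rat where "q = of_nat (2 * p ^ k)"
      have "q * r = of_int a" using a by (simp add: q_def)
      moreover have "q \<noteq> 0" using n by (simp add: q_def)
      ultimately have "of_int a * (1 / q) = r" by (simp add: field_simps)
      then have "w x = r" unfolding x_def w_powi[OF d_nz[OF n]] w_d[OF n] q_def .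
      moreover have "x \<noteq> 0" using d_nz[OF n] by (simp add: x_def)
      moreover have "x \<in> L" unfolding x_def power_int_def
        using L_d is_subfieldD[OF L_subfield] by simp
      ultimately have "emb x \<in> LC - {0}" "v (emb x) = r" by (simp_all add: emb_simps v_emb)
      then show "r \<in> value_group LC v" unfolding value_group_def by blast
    qed
  qed
  also have "Gam = p_divisible_hull p (range (\<lambda>k::int. of_int k * (1 / 2 * padic_valuation p (of_nat p))))"
    unfolding Gam_def p_divisible_hull_def pp
  proof (intro Collect_cong ex_cong1)
    fix r :: rat and k
    have "of_nat (p ^ k) * (2 * r) \<in> \<int> \<longleftrightarrow> (\<exists>a. of_nat (p ^ k) * (2 * r) = of_int a)"
      by (auto elim: Ints_cases)
    also have "\<dots> \<longleftrightarrow> (\<exists>a. of_nat (p ^ k) * r = of_int a * (1 / 2 * 1))"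
      by (intro ex_cong1) (auto simp: field_simps)
    also have "\<dots> \<longleftrightarrow> of_nat (p ^ k) * r \<in> range (\<lambda>a::int. of_int a * (1 / 2 * 1))" by auto
    finally show "(of_nat (p ^ k) * (2 * r) \<in> \<int>) = (of_nat (p ^ k) * r \<in> range (\<lambda>a::int. of_int a * (1 / 2 * 1)))" .
  qed
  finally show ?thesis .
qed

lemma cg_int: "cg (of_int a) (of_int b) \<longleftrightarrow> int p dvd a - b"
proof
  assume c: "cg (of_int a) (of_int b)"
  show "int p dvd a - b"
  proof (rule ccontr)
    assume "\<not> ?thesis"
    then have "w (of_int (a - b)) = 0" "a \<noteq> b" using w_int_unit[of "a - b"] by auto
    then show False using c by (simp add: vgt_def)
  qed
next
  assume "int p dvd a - b"
  then show "cg (of_int a) (of_int b)" using vge_p_mult[of "a - b"] by simp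
qed

text \<open>\<open>h\<close> takes the representative of a residue in \<open>0..p-1\<close>. It is a
  surjective ring homomorphism whose kernel is the valuation ideal, so the homomorphism theorem
  applies.\<close>

lemma residue_LC: "residue_field LC v \<simeq> residue_ring (int p)"
proof -
  let ?S = "residue_ring (int p)" and ?V = "valuation_ring LC v"
  have p1: "int p > 1" using p_pos by simp
  interpret S: residues "int p" ?S by unfold_locales (use p1 in simp_all)
  have "is_subring ?V" unfolding is_subring_def ring_LC
  proof (intro conjI ballI)
    show "1 \<in> emb ` {x \<in> L. vge x 0}"
      using is_subfieldD(1)[OF L_subfield] by (intro image_eqI[of _ _ 1]) (simp_all add: emb_simps)
    fix x y assume "x \<in> emb ` {x \<in> L. vge x 0}" "y \<in> emb ` {x \<in> L. vge x 0}"
    then obtain x' y' where xy: "x = emb x'" "x' \<in> L" "vge x' 0" "y = emb y'" "y' \<in> L" "vge y' 0" by blast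
    show "x - y \<in> emb ` {x \<in> L. vge x 0}"
      using xy is_subfieldD(3)[OF L_subfield] vge_diff by (intro image_eqI[of _ _ "x' - y'"]) (simp_all add: emb_simps)
    show "x * y \<in> emb ` {x \<in> L. vge x 0}"
      using xy is_subfieldD(4)[OF L_subfield] vge_mult0 by (intro image_eqI[of _ _ "x' * y'"]) (simp_all add: emb_simps)
  qed
  then have V: "ring (subring_struct ?V)"
    by (rule ring.subring_is_ring[OF ring_from_type_algebra subring_of_type])
  define h where "h x = (THE k. k \<in> {0..int p - 1} \<and> cg (finv emb x) (of_int k))" for x
  have h: "h (emb x) = k" if "k \<in> {0..int p - 1}" "cg x (of_int k)" for x k
    unfolding h_def emb_simps
  proof (rule the_equality)
    fix l assume l: "l \<in> {0..int p - 1} \<and> cg x (of_int l)"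
    have "cg (of_int l) (of_int k)" using cg_trans[OF cg_sym that(2)] l by blast
    then have "int p dvd l - k" by (simp only: cg_int)
    then have "l - k = 0 \<or> int p \<le> \<bar>l - k\<bar>" using dvd_imp_le_int[of "l - k" "int p"] by auto
    then show "l = k" using l that(1) by auto
  qed (use that in simp)
  have ex: "\<exists>k\<in>{0..int p - 1}. cg x (of_int k) \<and> h (emb x) = k" if x: "x \<in> L" "vge x 0" for x
  proof -
    obtain k where k: "k < p" "cg x (of_nat k)" using residue_prime_field[OF x(2) L_residue[OF x]] by blast
    then have "int k \<in> {0..int p - 1}" "cg x (of_int (int k))" by simp_all
    then show ?thesis using h by blast
  qed
  have modp: "k mod int p \<in> {0..int p - 1}" "cg x (of_int k) \<Longrightarrow> cg x (of_int (k mod int p))" for k x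
  proof -
    show "k mod int p \<in> {0..int p - 1}" using p1 by simp
    assume "cg x (of_int k)"
    moreover have "cg (of_int k) (of_int (k mod int p))" by (simp only: cg_int) (simp add: minus_mod_eq_mult_div)
    ultimately show "cg x (of_int (k mod int p))" by (rule cg_trans)
  qed
  have "ring_hom_ring (subring_struct ?V) ?S h"
  proof (rule ring_hom_ringI[OF V S.ring_axioms])
    fix x assume "x \<in> carrier (subring_struct ?V)"
    then obtain x' where x': "x = emb x'" "x' \<in> L" "vge x' 0" by (auto simp: ring_LC)
    then show "h x \<in> carrier ?S" using ex[OF x'(2,3)] by (auto simp: S.res_carrier_eq)
    fix y assume "y \<in> carrier (subring_struct ?V)"
    then obtain y' where y': "y = emb y'" "y' \<in> L" "vge y' 0" by (auto simp: ring_LC)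
    obtain k where k: "cg x' (of_int k)" "h (emb x') = k" using ex[OF x'(2,3)] by blast
    obtain l where l: "cg y' (of_int l)" "h (emb y') = l" using ex[OF y'(2,3)] by blast
    have "cg (x' * y') (of_int (k * l))" using cg_mult[OF k(1) l(1) x'(3)] by simp
    then have "h (emb (x' * y')) = (k * l) mod int p" by (intro h modp)
    then show "h (x \<otimes>\<^bsub>subring_struct ?V\<^esub> y) = h x \<otimes>\<^bsub>?S\<^esub> h y"
      by (simp add: ring_of_type_algebra_simps S.res_mult_eq k(2) l(2) x'(1) y'(1) emb_simps)
    have "cg (x' + y') (of_int (k + l))" using cg_add[OF k(1) l(1)] by simp
    then have "h (emb (x' + y')) = (k + l) mod int p" by (intro h modp)
    then show "h (x \<oplus>\<^bsub>subring_struct ?V\<^esub> y) = h x \<oplus>\<^bsub>?S\<^esub> h y"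
      by (simp add: ring_of_type_algebra_simps S.res_add_eq k(2) l(2) x'(1) y'(1) emb_simps)
  next
    have "h (emb 1) = 1" using p1 by (intro h) simp_all
    then show "h \<one>\<^bsub>subring_struct ?V\<^esub> = \<one>\<^bsub>?S\<^esub>"
      by (simp add: ring_of_type_algebra_simps S.res_one_eq emb_simps)
  qed
  then interpret rh: ring_hom_ring "subring_struct ?V" ?S h .
  have surj: "h ` carrier (subring_struct ?V) = carrier ?S"
  proof
    show "h ` carrier (subring_struct ?V) \<subseteq> carrier ?S" using rh.hom_closed by blast
    show "carrier ?S \<subseteq> h ` carrier (subring_struct ?V)"
    proof
      fix k assume "k \<in> carrier ?S"
      then have "h (emb (of_int k)) = k" by (intro h) (simp_all add: S.res_carrier_eq)
      moreover have "emb (of_int k) \<in> ?V" using is_subfield_of_int[OF L_subfield] by (simp add: ring_LC)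
      ultimately show "k \<in> h ` carrier (subring_struct ?V)"        by (intro image_eqI[of _ _ "emb (of_int k)"]) simp_all
    qed
  qed
  have ker: "a_kernel (subring_struct ?V) ?S h = valuation_ideal LC v"
  proof -
    have "h (emb x) = 0 \<longleftrightarrow> vgt x 0" if x: "x \<in> L" "vge x 0" for x
    proof
      assume "h (emb x) = 0"
      moreover obtain k where "cg x (of_int k)" "h (emb x) = k" using ex[OF x] by blast
      ultimately show "vgt x 0" by simp
    next
      assume "vgt x 0"
      then show "h (emb x) = 0" using p1 by (intro h) simp_all
    qed
    moreover have "carrier (subring_struct ?V) = emb ` {x \<in> L. vge x 0}" by (simp add: ring_LC)
    ultimately show ?thesis unfolding a_kernel_def' ideal_LC S.res_zero_eq using vgt_imp_vge by auto
  qed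
  show ?thesis unfolding residue_field_def using rh.FactRing_iso[OF surj] unfolding ker .
qed

section \<open>Squares that separate the two fields\<close>

lemma sqrt_c_LC: "\<exists>x\<in>LC. x * x = of_rat c"
proof (rule bexI[of _ "emb (d 2)"])
  have "d 2 * d 2 = of_rat c" using d_power[of 2] by (simp add: power2_eq_square)
  then have "emb (d 2 * d 2) = of_rat c" by (simp add: hom_of_rat[OF emb(1)])
  then show "emb (d 2) * emb (d 2) = of_rat c" by (simp add: emb_simps)
  show "emb (d 2) \<in> LC" using L_d[of 0] by simp
qed

text \<open>\<open>y\<close> has a residue in the prime field, and the square of that residue is the
  residue of \<open>u\<close>.\<close>

lemma square_LC:
  assumes "y \<in> LC" "y * y = of_nat u" "\<not> p dvd u"
  shows "\<exists>k::nat. (k * k) mod p = u mod p"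
proof -
  obtain x where x: "x \<in> L" "y = emb x" using assms(1) by blast
  have "emb (x * x) = emb (of_nat u)" using assms(2) x(2) by (simp only: emb_simps)
  then have xx: "x * x = of_nat u" by (simp only: emb_simps(10))
  have "w (x * x) = 0" using xx w_nat_unit[OF assms(3)] by simp
  moreover have "u \<noteq> 0" using assms(3) by (metis dvd_0_right)
  then have "x \<noteq> 0" using xx by auto
  ultimately have "vge x 0" by (simp add: vge_def w_mult)
  then obtain k where k: "cg x (of_nat k)" using residue_prime_field[OF _ L_residue[OF x(1)]] by blast
  have "cg (x * x) (of_nat k * of_nat k)" using k \<open>vge x 0\<close> by (intro cg_mult) simp_all
  then have "cg (of_int (int u)) (of_int (int (k * k)))" by (simp add: xx)
  then have "int p dvd int u - int (k * k)" by (simp only: cg_int)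
  then have "int u mod int p = int (k * k) mod int p" by (simp only: mod_eq_dvd_iff)
  then have "int (u mod p) = int (k * k mod p)" by (simp only: zmod_int)
  then show ?thesis by (metis of_nat_eq_iff)
qed

lemma LC_field: "is_subfield LC" by (rule subfield_image[OF L_subfield])

end

lemma padic_valuation_nat:
  assumes "n > 0"
  shows "padic_valuation p (of_nat n) = of_nat (multiplicity p n)"
proof -
  have "quotient_of (of_nat n) = (int n, 1)" using quotient_of_int[of "int n"] by simp
  moreover have "multiplicity (int p) (int n) = multiplicity p n"
    by (simp add: multiplicity_def flip: of_nat_power)
  ultimately show ?thesis by (simp add: padic_valuation_def)
qed

text \<open>If every residue were a square, squaring would be a surjective and hence injective map
  on residues, but 1 and \<open>p - 1\<close> have the same square.\<close>

lemma nonresidue_exists: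
  fixes p :: nat
  assumes "p > 2"
  shows "\<exists>u<p. \<forall>k::nat. (k * k) mod p \<noteq> u mod p"
proof (rule ccontr)
  assume neg: "\<not> ?thesis"
  define f where "f k = (k * k) mod p" for k :: nat
  have "f (p - 1) = f 1"
  proof -
    have "(p - 1) * (p - 1) = p * (p - 2) + 1" using assms by (cases p; cases "p - 1") (auto simp: algebra_simps)
    then have "f (p - 1) = (1 + p * (p - 2)) mod p" by (simp only: f_def add.commute)
    also have "\<dots> = f 1" by (simp only: mod_mult_self2 f_def mult_1)
    finally show ?thesis .
  qed
  moreover have "f ` {..<p} = {..<p}"
  proof
    show "f ` {..<p} \<subseteq> {..<p}" using assms by (auto simp: f_def)
    show "{..<p} \<subseteq> f ` {..<p}"
    proof
      fix u assume u: "u \<in> {..<p}"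
      then obtain k where "(k * k) mod p = u mod p" using neg by auto
      then have "f (k mod p) = u" using u by (simp add: f_def mod_mult_eq)
      then show "u \<in> f ` {..<p}" using assms by (intro image_eqI[of _ _ "k mod p"]) simp_all
    qed
  qed
  then have "inj_on f {..<p}" by (intro eq_card_imp_inj_on) simp_all
  ultimately show False using assms inj_onD[of f "{..<p}" "p - 1" 1] by simp
qed

theorem theorem1p5:
  fixes p :: nat
  assumes "prime p" and "odd p"
  shows "\<exists>(L :: complex set) (v :: complex \<Rightarrow> rat) (L' :: complex set) (v' :: complex \<Rightarrow> rat).
           tame_field L v \<and> tame_field L' v' \<and>
           (\<forall>x\<in>L. algebraic x) \<and> (\<forall>x\<in>L'. algebraic x) \<and>
           extends_padic p v \<and> extends_padic p v' \<and>
           residue_field L v \<simeq> residue_ring (int p) \<and>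
           residue_field L' v' \<simeq> residue_ring (int p) \<and>
           value_group L v =
             p_divisible_hull p (range (\<lambda>k::int. of_int k * (1 / 2 * padic_valuation p (of_nat p)))) \<and>
           value_group L' v' =
             p_divisible_hull p (range (\<lambda>k::int. of_int k * (1 / 2 * padic_valuation p (of_nat p)))) \<and>
           \<not> elementarily_equivalent L v L' v'"
proof -
  obtain w :: "qbar \<Rightarrow> rat" where w: "\<And>x y. x \<noteq> 0 \<Longrightarrow> y \<noteq> 0 \<Longrightarrow> w (x * y) = w x + w y"
    "\<And>x y. x \<noteq> 0 \<Longrightarrow> y \<noteq> 0 \<Longrightarrow> x + y \<noteq> 0 \<Longrightarrow> min (w x) (w y) \<le> w (x + y)"
    "\<And>q. q \<noteq> 0 \<Longrightarrow> w (of_rat q) = padic_valuation p q"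
    using padic_extension_exists[OF assms(1) algebraic_qbar] by blast
  interpret padic_qbar p w by unfold_locales (use assms w in auto)
  have p2: "p > 2" using p_pos odd_p by (cases "p = 2") auto
  \<comment> \<open>One predicate collects what is needed of both fields, since they come from two
    interpretations of the locale, with \<open>c = p\<close> and \<open>c = p * u\<close>.\<close>
  define P where "P c L v \<longleftrightarrow> tame_field L v \<and> (\<forall>x\<in>L. algebraic x) \<and> extends_padic p v \<and>
      residue_field L v \<simeq> residue_ring (int p) \<and> value_group L v =
        p_divisible_hull p (range (\<lambda>k::int. of_int k * (1 / 2 * padic_valuation p (of_nat p)))) \<and>
      is_subfield L \<and> (\<exists>x\<in>L. x * x = of_rat c) \<and>
      (\<forall>y\<in>L. \<forall>u. y * y = of_nat u \<longrightarrow> \<not> p dvd u \<longrightarrow> (\<exists>k::nat. (k * k) mod p = u mod p))"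
    for c and L :: "complex set" and v :: "complex \<Rightarrow> rat"
  have ex: "\<exists>L v. P c L v" if c: "c > 0" "padic_valuation p c = 1" for c
  proof -
    interpret radical_qbar p w c by unfold_locales (use c in auto)
    obtain L where L: "good L" "\<And>K. good K \<Longrightarrow> L \<subseteq> K \<Longrightarrow> K = L" using maximal_good_exists by blast
    interpret maximal_field p w c L by unfold_locales (use L in auto)
    have "\<forall>x\<in>emb ` L. algebraic x" using emb(2) by blast
    then have "P c (emb ` L) v" unfolding P_def
      using tame_LC padic_LC residue_LC value_group_LC LC_field sqrt_c_LC square_LC by blast
    then show ?thesis by blast
  qed
  obtain u where u: "u < p" "\<And>k::nat. (k * k) mod p \<noteq> u mod p" using nonresidue_exists[OF p2] by blast
  have u0: "u > 0" using u(2)[of 0] by (cases u) auto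
  have pu: "\<not> p dvd u" using u(1) u0 by (auto dest: dvd_imp_le)
  have "padic_valuation p (of_nat p) = 1"
    using padic_valuation_nat[of p p] p_pos assms(1) by simp
  then obtain L v where L: "P (of_nat p) L v" using ex[of "of_nat p"] p_pos by auto
  have "multiplicity p (p * u) = 1"
    using assms(1) u0 pu by (simp add: prime_elem_multiplicity_mult_distrib not_dvd_imp_multiplicity_0)
  then have "padic_valuation p (of_nat (p * u)) = 1"
    using padic_valuation_nat[of "p * u" p] p_pos u0 by simp
  then obtain L' v' where L': "P (of_nat (p * u)) L' v'" using ex[of "of_nat (p * u)"] p_pos u0 by auto
  define \<phi> where "\<phi> = FEx 0 (FEq (TMul (TVar 0) (TVar 0)) (numeral_term p))"
  have sat: "satisfies K w' e \<phi> \<longleftrightarrow> (\<exists>x\<in>K. x * x = of_nat p)" for K :: "complex set" and w' :: "complex \<Rightarrow> rat" and e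
    by (simp add: \<phi>_def numeral_term)
  have "satisfies L v (\<lambda>_. 0) \<phi>" using L unfolding sat P_def by simp
  moreover have "\<not> satisfies L' v' (\<lambda>_. 0) \<phi>"
  proof
    assume "satisfies L' v' (\<lambda>_. 0) \<phi>"
    then obtain x where x: "x \<in> L'" "x * x = of_nat p" unfolding sat by blast
    obtain s where s: "s \<in> L'" "s * s = of_nat p * of_nat u"    proof -
      obtain s where "s \<in> L'" "s * s = of_rat (of_nat (p * u))" using L' unfolding P_def by blast
      then show ?thesis using that by (simp add: of_rat_mult)
    qed
    have "is_subfield L'" using L' unfolding P_def by blast
    \<comment> \<open>The quotient is a square root of \<open>u\<close>, which makes
      \<open>u\<close> a quadratic residue.\<close>
    then have "s / x \<in> L'" using s(1) x(1) by (rule is_subfieldD(8))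
    moreover have "(s / x) * (s / x) = of_nat u" using s(2) x(2) p_pos by (simp add: field_simps)
    ultimately obtain k :: nat where "(k * k) mod p = u mod p" using L' pu unfolding P_def by blast
    then show False using u(2) by blast
  qed
  moreover have "is_sentence \<phi>" by (simp add: is_sentence_def \<phi>_def numeral_term)
  ultimately have "\<not> elementarily_equivalent L v L' v'" unfolding elementarily_equivalent_def by blast
  then show ?thesis using L L' unfolding P_def by blast
qed

end
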